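(* Let $Q\in\mathbb{R}^{n\times n}$ be symmetric with $\lambda_Q<0$, let $g\in\mathbb{R}^n$, $h(y):=y^\top Qy+2g^\top y$, $\epsilon>0$ and $\delta\in(0,1)$. With probability $1-\delta$, a solution $\bar y$ to the classical trust-region subproblem $\min_{y\in\mathbb{R}^n}\{h(y):\|y\|\le 1\}$, i.e. a point $\bar y$ with $\|\bar y\|\le 1$, satisfying $h(\bar y)-h(y)\le\epsilon$ for all $y$ in the unit ball $\{y:\|y\|\le 1\}$, can be found in time $$O\left(N\left(\frac{\sqrt{\|Q\|}}{\sqrt{\epsilon}}\log\left(\frac{n}{\delta}\right)+\frac{\sqrt{\|Q\|}}{\sqrt{\epsilon}}\right)\right)=O\left(N\frac{\sqrt{\|Q\|}}{\sqrt{\epsilon}}\log\left(\frac{n}{\delta}\right)\right)$$ using the randomized Lanczos method to compute $\lambda_Q$ and Nesterov's accelerated gradient descent algorithm.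
   Context: $\|y\|$ is the Euclidean norm of a vector, $\|Q\|$ is the spectral norm of $Q$ (maximum absolute eigenvalue), $\lambda_Q:=\lambda_{\min}(Q)$ is the minimum eigenvalue of $Q$, and $N$ is the number of nonzero entries of $Q$. Time is measured as the worst-case number of elementary arithmetic operations; a matrix-vector product with $Q$ costs $O(N)$. The probability is over the random starting vector of the Lanczos method. The Lanczos method (with random start) is used to estimate $\lambda_Q$; Nesterov's accelerated gradient descent is applied to the convex problem of minimizing $y^\top(Q-\lambda_Q I_n)y+2g^\top y+\lambda_Q$ over the unit ball (with $\lambda_Q$ replaced by its computed estimate).
   Formalization: The time bounds are shown as written when n ≤ N and ε ≤ ‖Q‖ (the second also needs n/δ ≥ 2), since they fail in degenerate cases; in general N is replaced by max(N,n) and √‖Q‖/√ε by max(1,√‖Q‖/√ε). *)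

theory Defs
  imports
    "HOL-Probability.Probability"
    "HOL-Library.Monad_Syntax"
    "Jordan_Normal_Form.Char_Poly"
begin

no_notation Finite_Cartesian_Product.vec_nth (infixl "$" 90)
no_notation Inner_Product.real_inner_class.inner (infix "\<bullet>" 70)
hide_const (open) Finite_Cartesian_Product.vec
hide_type (open) Finite_Cartesian_Product.vec

section \<open>The trust-region subproblem\<close>

definition vnorm :: "real vec \<Rightarrow> real" where
  "vnorm v = sqrt (v \<bullet> v)"

definition lambda_min :: "real mat \<Rightarrow> real" where
  "lambda_min Q = Min {k. eigenvalue Q k}"

text \<open>Only meant for symmetric matrices, where it is the operator norm.\<close>

definition spectral_norm :: "real mat \<Rightarrow> real" where
  "spectral_norm Q = Max {\<bar>k\<bar> |k. eigenvalue Q k}"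

definition nnz :: "real mat \<Rightarrow> nat" where
  "nnz Q = card {(i, j). i < dim_row Q \<and> j < dim_col Q \<and> Q $$ (i, j) \<noteq> 0}"

definition trs_obj :: "real mat \<Rightarrow> real vec \<Rightarrow> real vec \<Rightarrow> real" where
  "trs_obj Q g y = y \<bullet> (Q *\<^sub>v y) + 2 * (g \<bullet> y)"

definition eps_solution :: "nat \<Rightarrow> real mat \<Rightarrow> real vec \<Rightarrow> real \<Rightarrow> real vec \<Rightarrow> bool" where
  "eps_solution n Q g \<epsilon> ybar \<longleftrightarrow>
     ybar \<in> carrier_vec n \<and> vnorm ybar \<le> 1 \<and>
     (\<forall>y \<in> carrier_vec n. vnorm y \<le> 1 \<longrightarrow> trs_obj Q g ybar - trs_obj Q g y \<le> \<epsilon>)"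


section \<open>Counting arithmetic operations\<close>

text \<open>
  A timed value carries the number of elementary operations spent on it. Elementary operations,
  in exact real arithmetic, are the four arithmetic operations, square root, absolute value,
  minimum, maximum, logarithm, rounding up, comparison, and drawing one random number. Loop
  control and data movement are free. All costs enter through \<open>ops\<close> and the vector operations
  below, so the number in front of each expression has to be at least its operation count.
\<close>

datatype 'a timed = Timed (result: 'a) (cost: nat)

definition ret :: "'a \<Rightarrow> 'a timed" where
  "ret a = Timed a 0"

definition bind_timed :: "'a timed \<Rightarrow> ('a \<Rightarrow> 'b timed) \<Rightarrow> 'b timed" where
  "bind_timed m f = Timed (result (f (result m))) (cost m + cost (f (result m)))"

adhoc_overloading Monad_Syntax.bind \<rightleftharpoons> bind_timed

definition ops :: "nat \<Rightarrow> 'a \<Rightarrow> 'a timed" where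
  "ops c a = Timed a c"

definition t_dot :: "real vec \<Rightarrow> real vec \<Rightarrow> real timed" where
  "t_dot u v = Timed (u \<bullet> v) (2 * dim_vec v)"

definition t_norm :: "real vec \<Rightarrow> real timed" where
  "t_norm v = Timed (vnorm v) (2 * dim_vec v + 1)"

definition t_scale :: "real \<Rightarrow> real vec \<Rightarrow> real vec timed" where
  "t_scale c v = Timed (c \<cdot>\<^sub>v v) (dim_vec v)"

definition t_axpy :: "real \<Rightarrow> real vec \<Rightarrow> real vec \<Rightarrow> real vec timed" where
  "t_axpy c v u = Timed (c \<cdot>\<^sub>v v + u) (2 * dim_vec u)"

text \<open>Product with a sparse matrix: one multiplication and one addition per nonzero entry.\<close>

definition t_matvec :: "real mat \<Rightarrow> real vec \<Rightarrow> real vec timed" where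
  "t_matvec Q v = Timed (Q *\<^sub>v v) (2 * nnz Q)"

definition t_normalize :: "real vec \<Rightarrow> real vec timed" where
  "t_normalize v = do {
     r \<leftarrow> t_norm v;
     c \<leftarrow> ops 1 (1 / r);
     t_scale c v }"


section \<open>The Lanczos method\<close>

text \<open>
  The three-term recurrence, started with \<open>v\<close> (and previous vector \<open>p = 0\<close>, \<open>\<beta> = 0\<close>). The result
  \<open>[(\<alpha>\<^sub>1, \<beta>\<^sub>1, v\<^sub>1), \<dots>, (\<alpha>\<^sub>j, \<beta>\<^sub>j, v\<^sub>j)]\<close> describes the Lanczos vectors \<open>v\<^sub>i\<close> and the tridiagonal matrix
  \<open>T\<close> with diagonal entries \<open>\<alpha>\<^sub>1, \<dots>, \<alpha>\<^sub>j\<close> and off-diagonal entries \<open>\<beta>\<^sub>1, \<dots>, \<beta>\<^bsub>j-1\<^esub>\<close>; the last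
  number \<open>\<beta>\<^sub>j\<close> is the residual norm and not an entry of \<open>T\<close>.
\<close>

fun lanczos :: "real mat \<Rightarrow> nat \<Rightarrow> real vec \<Rightarrow> real \<Rightarrow> real vec \<Rightarrow> (real \<times> real \<times> real vec) list timed" where
  "lanczos Q 0 p \<beta> v = ret []"
| "lanczos Q (Suc k) p \<beta> v = do {
     w \<leftarrow> t_matvec Q v;
     c \<leftarrow> ops 1 (- \<beta>);
     w' \<leftarrow> t_axpy c p w;
     \<alpha> \<leftarrow> t_dot v w';
     c' \<leftarrow> ops 1 (- \<alpha>);
     r \<leftarrow> t_axpy c' v w';
     \<beta>' \<leftarrow> t_norm r;
     stop \<leftarrow> ops 1 (\<beta>' = 0);
     if stop then ret [(\<alpha>, \<beta>', v)]
     else do {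
       c'' \<leftarrow> ops 1 (1 / \<beta>');
       v' \<leftarrow> t_scale c'' r;
       rest \<leftarrow> lanczos Q k v \<beta>' v';
       ret ((\<alpha>, \<beta>', v) # rest) } }"

definition tridiag :: "(real \<times> real \<times> real vec) list \<Rightarrow> (real \<times> real) list" where
  "tridiag = map (\<lambda>(\<alpha>, \<beta>, v). (\<alpha>, \<beta>))"

definition basis :: "(real \<times> real \<times> real vec) list \<Rightarrow> real vec list" where
  "basis = map (\<lambda>(\<alpha>, \<beta>, v). v)"

text \<open>
  Maximal absolute row sum of \<open>T\<close> (with the residual norm added in the last row, which keeps it
  at most three times the spectral norm of \<open>Q\<close>). First argument: the preceding \<open>\<beta>\<close>.
\<close>

fun tri_bound :: "real \<Rightarrow> (real \<times> real) list \<Rightarrow> real timed" where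
  "tri_bound b [] = ret 0"
| "tri_bound b ((\<alpha>, \<beta>) # ts) = do {
     s \<leftarrow> ops 5 (\<bar>b\<bar> + \<bar>\<alpha>\<bar> + \<bar>\<beta>\<bar>);
     m \<leftarrow> tri_bound \<beta> ts;
     ops 1 (max s m) }"

text \<open>
  Whether all pivots of \<open>T - \<mu> I\<close> are positive, i.e. whether \<open>T - \<mu> I\<close> is positive definite.
  The argument \<open>c\<close> is \<open>\<beta>\<^sup>2 / d\<close> of the preceding row, where \<open>d\<close> is the pivot.
\<close>

fun pivots_pos :: "real \<Rightarrow> real \<Rightarrow> (real \<times> real) list \<Rightarrow> bool timed" where
  "pivots_pos \<mu> c [] = ret True"
| "pivots_pos \<mu> c ((\<alpha>, \<beta>) # ts) = do {
     d \<leftarrow> ops 2 (\<alpha> - \<mu> - c);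
     pos \<leftarrow> ops 1 (0 < d);
     if pos then do { c' \<leftarrow> ops 2 (\<beta> * \<beta> / d); pivots_pos \<mu> c' ts } else ret False }"

text \<open>Bisection for a lower estimate of the minimum eigenvalue of \<open>T\<close> in \<open>[lo, hi]\<close>.\<close>

fun bisect :: "(real \<times> real) list \<Rightarrow> nat \<Rightarrow> real \<Rightarrow> real \<Rightarrow> real timed" where
  "bisect ts 0 lo hi = ret lo"
| "bisect ts (Suc m) lo hi = do {
     mid \<leftarrow> ops 2 ((lo + hi) / 2);
     pos \<leftarrow> pivots_pos mid 0 ts;
     if pos then bisect ts m mid hi else bisect ts m lo mid }"

text \<open>
  Gaussian elimination for \<open>(T - \<mu> I) u = w\<close>. The arguments \<open>c\<close> and \<open>e\<close> are the contributions of
  the preceding row to the pivot and to the right-hand side.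
\<close>

fun tri_solve :: "real \<Rightarrow> real \<Rightarrow> real \<Rightarrow> (real \<times> real) list \<Rightarrow> real list \<Rightarrow> real list timed" where
  "tri_solve \<mu> c e ((\<alpha>, \<beta>) # ts) (w # ws) = do {
     d \<leftarrow> ops 2 (\<alpha> - \<mu> - c);
     w' \<leftarrow> ops 1 (w - e);
     c' \<leftarrow> ops 2 (\<beta> * \<beta> / d);
     e' \<leftarrow> ops 2 (\<beta> * w' / d);
     us \<leftarrow> tri_solve \<mu> c' e' ts ws;
     u \<leftarrow> (case us of [] \<Rightarrow> ops 1 (w' / d) | u' # _ \<Rightarrow> ops 3 ((w' - \<beta> * u') / d));
     ret (u # us) }"
| "tri_solve \<mu> c e _ _ = ret []"

fun inverse_iteration :: "real \<Rightarrow> (real \<times> real) list \<Rightarrow> nat \<Rightarrow> real list \<Rightarrow> real list timed" where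
  "inverse_iteration \<mu> ts 0 z = ret z"
| "inverse_iteration \<mu> ts (Suc p) z = do {
     z' \<leftarrow> tri_solve \<mu> 0 0 ts z;
     inverse_iteration \<mu> ts p z' }"

fun lin_comb :: "nat \<Rightarrow> real list \<Rightarrow> real vec list \<Rightarrow> real vec timed" where
  "lin_comb n (c # cs) (v # vs) = do {
     u \<leftarrow> lin_comb n cs vs;
     t_axpy c v u }"
| "lin_comb n _ _ = ret (0\<^sub>v n)"

text \<open>
  Given the outcome of the recurrence, estimate of the smallest Ritz value (the minimum eigenvalue
  of \<open>T\<close>) from below, up to \<open>(2 R + \<epsilon>) / 2 ^ m\<close>, together with a unit vector in the Krylov space
  computed by \<open>p\<close> steps of inverse iteration on \<open>T\<close>, started with the first unit vector.
\<close>

definition ritz_pair ::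
  "nat \<Rightarrow> real \<Rightarrow> real \<Rightarrow> nat \<Rightarrow> nat \<Rightarrow> (real \<times> real \<times> real vec) list \<Rightarrow> (real \<times> real vec) timed" where
  "ritz_pair n \<epsilon> R m p rs = do {
     lo0 \<leftarrow> ops 2 (- R - \<epsilon>);
     lo \<leftarrow> bisect (tridiag rs) m lo0 R;
     z \<leftarrow> inverse_iteration lo (tridiag rs) p (1 # replicate (length rs - 1) 0);
     x0 \<leftarrow> lin_comb n z (basis rs);
     x \<leftarrow> t_normalize x0;
     ret (lo, x) }"


section \<open>Nesterov's accelerated gradient descent\<close>

definition proj_ball :: "real vec \<Rightarrow> real vec timed" where
  "proj_ball v = do {
     r \<leftarrow> t_norm v;
     inside \<leftarrow> ops 1 (r \<le> 1);
     if inside then ret v else do { c \<leftarrow> ops 1 (1 / r); t_scale c v } }"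

text \<open>
  Accelerated projected gradient steps of length \<open>1 / L\<close> for minimizing
  \<open>y\<^sup>T (Q - \<gamma> I) y + 2 g\<^sup>T y + \<gamma>\<close> over the unit ball; \<open>d\<close> is half the gradient at \<open>y\<close>.
\<close>

fun agd :: "real mat \<Rightarrow> real vec \<Rightarrow> real \<Rightarrow> real \<Rightarrow> nat \<Rightarrow> real vec \<Rightarrow> real vec \<Rightarrow> real \<Rightarrow> real vec timed" where
  "agd Q g \<gamma> L 0 x y t = ret x"
| "agd Q g \<gamma> L (Suc a) x y t = do {
     q \<leftarrow> t_matvec Q y;
     c \<leftarrow> ops 1 (- \<gamma>);
     q' \<leftarrow> t_axpy c y q;
     d \<leftarrow> t_axpy 1 g q';
     s \<leftarrow> ops 2 (- (2 / L));
     u \<leftarrow> t_axpy s d y;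
     x' \<leftarrow> proj_ball u;
     t' \<leftarrow> ops 6 ((1 + sqrt (1 + 4 * t * t)) / 2);
     m \<leftarrow> ops 2 ((t - 1) / t');
     \<Delta> \<leftarrow> t_axpy (- 1) x x';
     y' \<leftarrow> t_axpy m \<Delta> x';
     agd Q g \<gamma> L a x' y' t' }"


section \<open>The solver\<close>

text \<open>
  Moves \<open>y\<close> in the unit ball along the unit vector \<open>x\<close> to the unit sphere, in the direction in which
  \<open>y\<^sup>T (Q - \<gamma> I) y + 2 g\<^sup>T y\<close> does not increase to first order.
\<close>

definition to_sphere :: "real mat \<Rightarrow> real vec \<Rightarrow> real \<Rightarrow> real vec \<Rightarrow> real vec \<Rightarrow> real vec timed" where
  "to_sphere Q g \<gamma> x y = do {
     s \<leftarrow> t_dot y x;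
     r \<leftarrow> t_dot y y;
     D \<leftarrow> ops 4 (sqrt (s * s + (1 - r)));
     q \<leftarrow> t_matvec Q x;
     c \<leftarrow> ops 1 (- \<gamma>);
     q' \<leftarrow> t_axpy c x q;
     a \<leftarrow> t_dot y q';
     b \<leftarrow> t_dot g x;
     up \<leftarrow> ops 2 (0 < a + b);
     \<tau> \<leftarrow> ops 2 (if up then - s - D else - s + D);
     t_axpy \<tau> x y }"

text \<open>
  The random input \<open>\<omega>\<close> is a standard Gaussian vector, so that the normalized starting vector \<open>v\<close> is
  uniformly distributed on the unit sphere.
\<close>

definition gauss :: "nat \<Rightarrow> (nat \<Rightarrow> real) measure" where
  "gauss n = (\<Pi>\<^sub>M i\<in>{..<n}. density lborel (\<lambda>x. ennreal (std_normal_density x)))"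

definition draw :: "nat \<Rightarrow> (nat \<Rightarrow> real) \<Rightarrow> real vec timed" where
  "draw n \<omega> = Timed (Matrix.vec n \<omega>) n"

text \<open>
  Spectral quantities of \<open>Q\<close> are not available to the solver: a first short Lanczos run yields
  \<open>M\<close>, an estimate of the spectral norm up to a constant factor, which determines the number of
  steps of the main Lanczos run and of the gradient method. The parameter \<open>\<kappa>\<close> is the constant
  factor in all iteration counts. In exact arithmetic Lanczos terminates after at most \<open>n\<close> steps,
  hence the cap at \<open>n\<close>. The shift by \<open>\<epsilon> / 64\<close> turns the estimate \<open>lo\<close> of the minimum eigenvalue
  of \<open>Q\<close> into a lower bound (up to the failure probability), so that the problem passed to \<open>agd\<close>
  is convex.
\<close>

definition trs_solver ::
  "real \<Rightarrow> nat \<Rightarrow> real mat \<Rightarrow> real vec \<Rightarrow> real \<Rightarrow> real \<Rightarrow> (nat \<Rightarrow> real) \<Rightarrow> real vec timed" where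
  "trs_solver \<kappa> n Q g \<epsilon> \<delta> \<omega> = do {
     v0 \<leftarrow> draw n \<omega>;
     v \<leftarrow> t_normalize v0;
     l \<leftarrow> ops 3 (ln (real n / \<delta>) + 1);
     k0 \<leftarrow> ops 3 (min n (nat \<lceil>\<kappa> * l\<rceil>));
     rs0 \<leftarrow> lanczos Q k0 (0\<^sub>v n) 0 v;
     R0 \<leftarrow> tri_bound 0 (tridiag rs0);
     M \<leftarrow> ops 1 (2 * R0);
     s \<leftarrow> ops 3 (sqrt (M / \<epsilon>) + 1);
     k \<leftarrow> ops 4 (min n (nat \<lceil>\<kappa> * s * l\<rceil>));
     rs \<leftarrow> lanczos Q k (0\<^sub>v n) 0 v;
     R \<leftarrow> tri_bound 0 (tridiag rs);
     m \<leftarrow> ops 6 (nat \<lceil>\<kappa> * (ln (R / \<epsilon> + 1) + 1)\<rceil>);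
     p \<leftarrow> ops 2 (nat \<lceil>\<kappa> * l\<rceil>);
     (lo, x) \<leftarrow> ritz_pair n \<epsilon> R m p rs;
     \<gamma> \<leftarrow> ops 2 (lo - \<epsilon> / 64);
     L \<leftarrow> ops 3 (2 * (M + \<bar>\<gamma>\<bar>));
     a \<leftarrow> ops 2 (nat \<lceil>\<kappa> * s\<rceil>);
     y \<leftarrow> agd Q g \<gamma> L a (0\<^sub>v n) (0\<^sub>v n) 1;
     to_sphere Q g \<gamma> x y }"

end

theory Submission
  imports Defs
begin

text \<open>
  For polynomials \<open>q\<close> of degree less than the number of Lanczos steps,
  \<open>\<Sum> q(\<theta>\<^sub>i)\<^sup>2 d\<^sub>i\<^sup>2 = \<parallel>q(Q) v\<parallel>\<^sup>2 = \<Sum> q(\<lambda>\<^sub>i)\<^sup>2 c\<^sub>i\<^sup>2\<close>, where \<open>\<theta>\<^sub>i\<close> are the Ritz values and \<open>d\<^sub>i\<close>, \<open>c\<^sub>i\<close> the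
  coefficients of the starting vector \<open>v\<close> with respect to Ritz vectors and eigenvectors. A Chebyshev
  polynomial that is large at \<open>\<lambda>\<^sub>1 = \<lambda>\<^sub>m\<^sub>i\<^sub>n\<close> and at most 1 in absolute value above \<open>\<lambda>\<^sub>1 + \<eta>\<close> therefore forces
  Ritz values below \<open>\<lambda>\<^sub>1 + \<eta>\<close> whose vectors carry at least half of the weight \<open>c\<^sub>1\<^sup>2\<close>. For a Gaussian
  start \<open>c\<^sub>1\<^sup>2\<close> is at least \<open>\<delta>\<^sup>3 / (64 n)\<close> with probability \<open>1 - \<delta>\<close>, which gives the factor
  \<open>log (n / \<delta>)\<close>, without a further logarithm of \<open>\<parallel>Q\<parallel> / \<epsilon>\<close>. The same weight bound makes a logarithmic number of
  inverse iteration steps sufficient. The choice \<open>q(\<lambda>) = T\<^sub>m(2 \<lambda> / \<parallel>Q\<parallel>)\<close> shows that the first short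
  run estimates \<open>\<parallel>Q\<parallel>\<close>. Finally, with \<open>\<gamma> \<le> \<lambda>\<^sub>m\<^sub>i\<^sub>n < 0\<close>, the convex objective plus \<open>\<gamma>\<close> is a lower bound of
  \<open>h\<close> on the ball with equality on the sphere, and moving along an approximate eigenvector from the
  accelerated gradient point to the sphere costs at most four times the excess of its Rayleigh quotient over \<open>\<gamma>\<close>.
\<close>

text \<open>Convergence of the smallest Ritz value alone would not suffice: the solver also needs a
  vector, and it starts inverse iteration with the first unit vector, so the weight of the low Ritz
  vectors in that start must be bounded from below. Stopping early or at the cap \<open>n\<close> is
  harmless, because then the residual vanishes and the moment identity holds in every degree. Only
  two coefficients of the random start matter, one for the smallest eigenvalue and one for an
  eigenvalue of largest modulus. The operation count holds for every draw, even for the zero vector.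
  The constants are generous: in units of \<epsilon>/64, the gradient method spends one and the move
  to the sphere at most 20. The logarithm of \<epsilon> in the number of bisection steps is absorbed
  by ln (x + 1) \<le> 2 sqrt x.\<close>

declare carrier_vecD [simp del] carrier_dim_vec [simp]
  smult_scalar_prod_distrib [simp del] scalar_prod_smult_distrib [simp del]


section \<open>Inner products and orthonormal families\<close>

text \<open>The rules on inner products ask for equal \<open>dim_vec\<close>, which rewriting can
  check; a carrier premise would leave the dimension to be guessed.\<close>

lemma ip_add_left: "dim_vec u = dim_vec w \<Longrightarrow> dim_vec v = dim_vec w \<Longrightarrow> (u + v) \<bullet> w = u \<bullet> w + v \<bullet> (w :: real vec)"
  by (rule add_scalar_prod_distrib[of _ "dim_vec w"]) auto

lemma ip_add_right: "dim_vec u = dim_vec w \<Longrightarrow> dim_vec v = dim_vec w \<Longrightarrow> w \<bullet> (u + v) = w \<bullet> u + w \<bullet> (v :: real vec)"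
  by (rule scalar_prod_add_distrib[of _ "dim_vec w"]) auto

lemma ip_diff_left: "dim_vec u = dim_vec w \<Longrightarrow> dim_vec v = dim_vec w \<Longrightarrow> (u - v) \<bullet> w = u \<bullet> w - v \<bullet> (w :: real vec)"
  by (rule minus_scalar_prod_distrib[of _ "dim_vec w"]) auto

lemma ip_diff_right: "dim_vec u = dim_vec w \<Longrightarrow> dim_vec v = dim_vec w \<Longrightarrow> w \<bullet> (u - v) = w \<bullet> u - w \<bullet> (v :: real vec)"
  by (rule scalar_prod_minus_distrib[of _ "dim_vec w"]) auto

lemma ip_comm: "dim_vec u = dim_vec v \<Longrightarrow> u \<bullet> v = v \<bullet> (u :: real vec)"
  by (rule comm_scalar_prod[of _ "dim_vec v"]) auto

lemma ip_smult_left: "dim_vec u = dim_vec v \<Longrightarrow> (c \<cdot>\<^sub>v u) \<bullet> v = c * (u \<bullet> (v :: real vec))"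
  by simp

lemma ip_smult_right: "dim_vec u = dim_vec v \<Longrightarrow> u \<bullet> (c \<cdot>\<^sub>v v) = c * (u \<bullet> (v :: real vec))"
  by simp

lemmas ip_simps = ip_add_left ip_add_right ip_diff_left ip_diff_right ip_smult_left ip_smult_right

lemma ip_sum: "dim_vec v = n \<Longrightarrow> u \<bullet> v = (\<Sum>i<n. u $ i * v $ i)"
  by (auto simp: scalar_prod_def atLeast0LessThan)

lemma ip_self_nonneg [simp]: "0 \<le> v \<bullet> (v :: real vec)"
  by (simp add: ip_sum sum_nonneg)

lemma ip_self_eq_0: "v \<bullet> (v :: real vec) = 0 \<longleftrightarrow> v = 0\<^sub>v (dim_vec v)"
proof -
  have "v \<bullet> v = 0 \<longleftrightarrow> (\<forall>i\<in>{..<dim_vec v}. v $ i * v $ i = 0)"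
    unfolding ip_sum[OF refl] by (rule sum_nonneg_eq_0_iff) auto
  also have "\<dots> \<longleftrightarrow> v = 0\<^sub>v (dim_vec v)"
    by (auto simp: vec_eq_iff)
  finally show ?thesis .
qed

lemma ip_self_pos: "w \<noteq> 0\<^sub>v n \<Longrightarrow> dim_vec w = n \<Longrightarrow> 0 < w \<bullet> (w :: real vec)"
  using ip_self_eq_0[of w] ip_self_nonneg[of w] by (auto simp: less_le)

lemma vec_eq_if_diff_eq_0:
  assumes "u - v = 0\<^sub>v n" "dim_vec u = n" "dim_vec (v :: real vec) = n"
  shows "u = v"
proof (rule eq_vecI)
  fix i assume "i < dim_vec v"
  moreover have "(u - v) $ i = 0\<^sub>v n $ i" using assms(1) by simp
  ultimately show "u $ i = v $ i" using assms(2,3) by simp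
qed (use assms in simp)

lemma vnorm_sq [simp]: "(vnorm v)\<^sup>2 = v \<bullet> v"
  by (simp add: vnorm_def)

lemma vnorm_nonneg [simp]: "0 \<le> vnorm v"
  by (simp add: vnorm_def)

lemma vnorm_le_1: "vnorm v \<le> 1 \<longleftrightarrow> v \<bullet> v \<le> 1"
  by (simp add: vnorm_def)

lemma vnorm_eq_0: "vnorm v = 0 \<longleftrightarrow> v \<bullet> v = 0"
  by (simp add: vnorm_def)

lemma cauchy_schwarz_vec:
  assumes "dim_vec u = n" "dim_vec v = n"
  shows "(u \<bullet> v)\<^sup>2 \<le> (u \<bullet> u) * (v \<bullet> (v :: real vec))"
  using Cauchy_Schwarz_ineq_sum[of "\<lambda>i. u $ i" "\<lambda>i. v $ i" "{..<n}"] assms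
  by (simp add: ip_sum[of _ n] power2_eq_square)

lemma symmetric_ip:
  assumes "Q \<in> carrier_mat n n" "transpose_mat Q = Q" "dim_vec x = n" "dim_vec y = n"
  shows "(Q *\<^sub>v x) \<bullet> y = x \<bullet> (Q *\<^sub>v (y :: real vec))"
  using transpose_vec_mult_scalar[OF assms(1), of y x] assms by simp

text \<open>With a function and a cut-off \<open>k\<close>, a function update adds the next vector,
  and the case \<open>k = n\<close> is an orthonormal basis.\<close>

definition orthonormal :: "nat \<Rightarrow> nat \<Rightarrow> (nat \<Rightarrow> real vec) \<Rightarrow> bool" where
  "orthonormal n k u \<longleftrightarrow> (\<forall>i<k. dim_vec (u i) = n) \<and> (\<forall>i<k. \<forall>j<k. u i \<bullet> u j = (if i = j then 1 else 0))"

text \<open>Summation is done in each coordinate because the type contains vectors of all dimensions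
  and so has no single zero vector.\<close>

definition vsum :: "nat \<Rightarrow> nat \<Rightarrow> (nat \<Rightarrow> real) \<Rightarrow> (nat \<Rightarrow> real vec) \<Rightarrow> real vec" where
  "vsum n k c u = Matrix.vec n (\<lambda>a. \<Sum>i<k. c i * u i $ a)"

lemma dim_vsum [simp]: "dim_vec (vsum n k c u) = n"
  by (simp add: vsum_def)

lemma ip_vsum_left:
  assumes "dim_vec y = n"
  shows "vsum n k c u \<bullet> y = (\<Sum>i<k. c i * (u i \<bullet> y))"
proof -
  have "vsum n k c u \<bullet> y = (\<Sum>a<n. \<Sum>i<k. c i * u i $ a * y $ a)"
    using assms by (simp add: ip_sum vsum_def sum_distrib_right)
  also have "\<dots> = (\<Sum>i<k. \<Sum>a<n. c i * u i $ a * y $ a)" by (rule sum.swap)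
  finally show ?thesis using assms by (simp add: ip_sum sum_distrib_left mult.assoc)
qed

lemma ip_vsum_right:
  assumes "dim_vec y = n" "\<And>i. i < k \<Longrightarrow> dim_vec (u i) = n"
  shows "y \<bullet> vsum n k c u = (\<Sum>i<k. c i * (y \<bullet> u i))"
proof -
  have "y \<bullet> vsum n k c u = vsum n k c u \<bullet> y" using assms(1) by (intro ip_comm) simp
  also have "\<dots> = (\<Sum>i<k. c i * (u i \<bullet> y))" by (rule ip_vsum_left[OF assms(1)])
  also have "\<dots> = (\<Sum>i<k. c i * (y \<bullet> u i))"
    using assms by (intro sum.cong arg_cong2[where f="(*)"] ip_comm) auto
  finally show ?thesis .
qed

lemma ip_orthonormal_vsum:
  assumes "orthonormal n k u" "j < k"
  shows "u j \<bullet> vsum n k c u = c j"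
proof -
  have "u j \<bullet> vsum n k c u = (\<Sum>i<k. c i * (u j \<bullet> u i))"
    using assms by (intro ip_vsum_right) (auto simp: orthonormal_def)
  also have "\<dots> = (\<Sum>i<k. if i = j then c i else 0)"
    using assms by (intro sum.cong) (auto simp: orthonormal_def)
  finally show ?thesis using assms(2) by simp
qed

lemma ip_vsum_vsum:
  assumes "orthonormal n k u"
  shows "vsum n k c u \<bullet> vsum n k d u = (\<Sum>i<k. c i * d i)"
  unfolding ip_vsum_left[OF dim_vsum] by (intro sum.cong) (auto simp: ip_orthonormal_vsum[OF assms])

lemma residual_ip:
  assumes "orthonormal n k u" "dim_vec w = n" "j < k"
  shows "u j \<bullet> (w - vsum n k (\<lambda>i. u i \<bullet> w) u) = 0"
  using assms by (simp add: ip_diff_right orthonormal_def) (simp add: ip_orthonormal_vsum[OF assms(1,3)])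

lemma residual_self_ip:
  assumes "orthonormal n k u" "dim_vec w = n"
  shows "(w - vsum n k (\<lambda>i. u i \<bullet> w) u) \<bullet> (w - vsum n k (\<lambda>i. u i \<bullet> w) u) = w \<bullet> w - (\<Sum>i<k. (u i \<bullet> w)\<^sup>2)"
proof -
  let ?s = "vsum n k (\<lambda>i. u i \<bullet> w) u"
  have "?s \<bullet> w = (\<Sum>i<k. (u i \<bullet> w)\<^sup>2)" 
    using assms by (simp add: ip_vsum_left power2_eq_square)
  moreover have "?s \<bullet> ?s = (\<Sum>i<k. (u i \<bullet> w)\<^sup>2)"
    by (simp add: ip_vsum_vsum[OF assms(1)] power2_eq_square)
  moreover have "w \<bullet> ?s = ?s \<bullet> w" using assms by (intro ip_comm) simp
  ultimately show ?thesis using assms(2) by (simp add: ip_simps)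
qed

lemma bessel:
  assumes "orthonormal n k u" "dim_vec w = n"
  shows "(\<Sum>i<k. (u i \<bullet> w)\<^sup>2) \<le> w \<bullet> w"
  using residual_self_ip[OF assms] ip_self_nonneg[of "w - vsum n k (\<lambda>i. u i \<bullet> w) u"] by linarith

text \<open>The trace of the projection onto the span, computed in two ways. Counting with it
  replaces linear dependence arguments, both in \<open>orthonormal_le\<close> and when a family is
  extended.\<close>

lemma orthonormal_trace:
  assumes "orthonormal n k u"
  shows "(\<Sum>a<n. \<Sum>i<k. (u i $ a)\<^sup>2) = real k"
proof -
  have "(\<Sum>a<n. \<Sum>i<k. (u i $ a)\<^sup>2) = (\<Sum>i<k. \<Sum>a<n. (u i $ a)\<^sup>2)" by (rule sum.swap)
  also have "\<dots> = (\<Sum>i<k. u i \<bullet> u i)"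
    using assms by (intro sum.cong) (auto simp: orthonormal_def ip_sum power2_eq_square)
  finally show ?thesis using assms by (simp add: orthonormal_def)
qed

lemma orthonormal_coord_le:
  assumes "orthonormal n k u" "a < n"
  shows "(\<Sum>i<k. (u i $ a)\<^sup>2) \<le> 1"
  using bessel[OF assms(1), of "unit_vec n a"] assms by (simp add: orthonormal_def)

lemma orthonormal_le:
  assumes "orthonormal n k u"
  shows "k \<le> n"
proof -
  have "real k = (\<Sum>a<n. \<Sum>i<k. (u i $ a)\<^sup>2)" by (rule orthonormal_trace[OF assms, symmetric])
  also have "\<dots> \<le> (\<Sum>a<n. 1)" by (intro sum_mono orthonormal_coord_le[OF assms]) auto
  finally show ?thesis by simp
qed

lemma orthonormal_Suc:
  assumes "orthonormal n k u" "dim_vec x = n" "x \<bullet> x = 1" "\<And>i. i < k \<Longrightarrow> u i \<bullet> x = 0"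
  shows "orthonormal n (Suc k) (u(k := x))"
proof -
  have "x \<bullet> u i = 0" if "i < k" for i
    using assms that ip_comm[of x "u i"] by (simp add: orthonormal_def)
  thus ?thesis using assms by (simp add: orthonormal_def less_Suc_eq)
qed

text \<open>The diagonal entries of the projection are at most 1 and sum to \<open>k < n\<close>, so
  some coordinate vector has a nonzero residual, which is normalized.\<close>

lemma orthonormal_extend:
  assumes "orthonormal n k u" "k < n"
  obtains w where "dim_vec w = n" "w \<bullet> w = 1" "\<And>i. i < k \<Longrightarrow> u i \<bullet> w = 0"
proof -
  have "\<exists>a<n. (\<Sum>i<k. (u i $ a)\<^sup>2) < 1"
  proof (rule ccontr)
    assume "\<not> ?thesis"
    hence "1 \<le> (\<Sum>i<k. (u i $ a)\<^sup>2)" if "a < n" for a using that by (meson not_less)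
    hence "(\<Sum>a<n. 1) \<le> (\<Sum>a<n. \<Sum>i<k. (u i $ a)\<^sup>2)" by (intro sum_mono) simp
    thus False using assms orthonormal_trace[OF assms(1)] by simp
  qed
  then obtain a where a: "a < n" "(\<Sum>i<k. (u i $ a)\<^sup>2) < 1" by blast
  define e where "e = unit_vec n a - vsum n k (\<lambda>i. u i \<bullet> unit_vec n a) u"
  have e: "dim_vec e = n" by (simp add: e_def)
  have "e \<bullet> e > 0" using residual_self_ip[OF assms(1), of "unit_vec n a"] a by (simp add: e_def)
  moreover have "u i \<bullet> e = 0" if "i < k" for i
    unfolding e_def by (rule residual_ip[OF assms(1) _ that]) simp
  moreover have "dim_vec (u i) = n" if "i < k" for i using assms that by (simp add: orthonormal_def)
  ultimately show thesis using e
    by (intro that[of "(1 / vnorm e) \<cdot>\<^sub>v e"]) (auto simp: ip_simps vnorm_def)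
qed

text \<open>Otherwise normalization would give \<open>n + 1\<close> orthonormal vectors in dimension
  \<open>n\<close>.\<close>

lemma orthonormal_complete:
  assumes "orthonormal n n u" "dim_vec w = n" "\<And>i. i < n \<Longrightarrow> u i \<bullet> w = 0"
  shows "w = 0\<^sub>v n"
proof (rule ccontr)
  assume w: "w \<noteq> 0\<^sub>v n"
  let ?w = "(1 / vnorm w) \<cdot>\<^sub>v w"
  have pos: "w \<bullet> w > 0" by (rule ip_self_pos[OF w assms(2)])
  have "orthonormal n (Suc n) (u(n := ?w))"
    using assms pos
    by (intro orthonormal_Suc) (auto simp: ip_simps vnorm_def orthonormal_def)
  thus False using orthonormal_le by fastforce
qed

lemma orthonormal_expand:
  assumes "orthonormal n n u" "dim_vec w = n"
  shows "vsum n n (\<lambda>i. u i \<bullet> w) u = w"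
proof -
  have "w - vsum n n (\<lambda>i. u i \<bullet> w) u = 0\<^sub>v n"
    by (rule orthonormal_complete[OF assms(1)]) (use residual_ip[OF assms] in auto)
  hence "w = vsum n n (\<lambda>i. u i \<bullet> w) u" by (rule vec_eq_if_diff_eq_0) (use assms in auto)
  thus ?thesis by simp
qed

lemma parseval:
  assumes "orthonormal n n u" "dim_vec x = n" "dim_vec y = n"
  shows "x \<bullet> y = (\<Sum>i<n. (u i \<bullet> x) * (u i \<bullet> y))"
  using ip_vsum_vsum[OF assms(1)] orthonormal_expand[OF assms(1)] assms by metis

section \<open>The spectral theorem for real symmetric matrices\<close>

text \<open>First-order optimality: at \<open>t = - b / d\<close> with \<open>c < 2 * d\<close> the
  expression equals \<open>(b / d)\<^sup>2 * (c - 2 * d)\<close>, which is negative unless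
  \<open>b\<close> vanishes.\<close>

lemma linear_le_quadratic_imp_zero:
  fixes b c :: real
  assumes "\<And>t. 0 \<le> 2 * t * b + t\<^sup>2 * c"
  shows "b = 0"
proof (rule ccontr)
  assume b: "b \<noteq> 0"
  define d where "d = \<bar>c\<bar> + 1"
  have d: "d > 0" "c < 2 * d" unfolding d_def by auto
  have "0 \<le> 2 * (- b / d) * b + (- b / d)\<^sup>2 * c" by (rule assms)
  also have "\<dots> = (b / d)\<^sup>2 * (c - 2 * d)"
    using d by (simp add: field_simps power2_eq_square)
  also have "\<dots> < 0" using b d by (intro mult_pos_neg) auto
  finally show False by simp
qed

lemma mult_mat_vec_nth: "A \<in> carrier_mat n m \<Longrightarrow> dim_vec x = m \<Longrightarrow> i < n \<Longrightarrow> (A *\<^sub>v x) $ i = (\<Sum>j<m. A $$ (i, j) * x $ j)"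
  by (auto simp: scalar_prod_def atLeast0LessThan)

lemma rayleigh_minimizer:
  assumes Q: "Q \<in> carrier_mat n n" and u: "orthonormal n k u" "k < n"
  obtains x where "dim_vec x = n" "x \<bullet> x = 1" "\<And>i. i < k \<Longrightarrow> u i \<bullet> x = 0"
    "\<And>y. dim_vec y = n \<Longrightarrow> y \<bullet> y = 1 \<Longrightarrow> (\<And>i. i < k \<Longrightarrow> u i \<bullet> y = 0) \<Longrightarrow> x \<bullet> (Q *\<^sub>v x) \<le> y \<bullet> (Q *\<^sub>v (y :: real vec))"
proof -
  \<comment> \<open>Vectors become functions on the naturals that vanish from \<open>n\<close> on.
    The surrounding box is compact in the product topology, and the remaining conditions are
    closed.\<close>
  define S where "S = (PiE UNIV (\<lambda>i. if i < n then {-1..1} else {0 :: real})) \<inter>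
     {f. (\<Sum>i<n. f i * f i) = 1} \<inter> (\<Inter>l<k. {f. (\<Sum>i<n. u l $ i * f i) = 0})"
  define q where "q f = (\<Sum>i<n. f i * (\<Sum>j<n. Q $$ (i, j) * f j))" for f :: "nat \<Rightarrow> real"
  have c: "compact (PiE UNIV (\<lambda>i. if i < n then {-1..1} else {0 :: real}))"
  proof -
    have "compactin euclidean (PiE UNIV (\<lambda>i. if i < n then {-1..1} else {0 :: real}))"
      unfolding euclidean_product_topology[symmetric]
      by (subst compactin_PiE) (auto simp: compactin_euclidean_iff)
    thus ?thesis by (simp only: compactin_euclidean_iff)
  qed
  have "closed {f :: nat \<Rightarrow> real. (\<Sum>i<n. f i * f i) = 1}"
    by (intro closed_Collect_eq continuous_intros continuous_on_product_then_coordinatewise continuous_on_id)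
  moreover have "closed (\<Inter>l<k. {f :: nat \<Rightarrow> real. (\<Sum>i<n. u l $ i * f i) = 0})"
    by (intro closed_INT ballI closed_Collect_eq continuous_intros continuous_on_product_then_coordinatewise continuous_on_id)
  ultimately have "compact S" unfolding S_def
    by (intro compact_Int_closed c)
  have vecS: "(\<lambda>i. if i < n then y $ i else 0) \<in> S"
    if y: "dim_vec y = n" "y \<bullet> y = 1" "\<And>i. i < k \<Longrightarrow> u i \<bullet> y = 0" for y
  proof -
    have "\<bar>y $ i\<bar> \<le> 1" if "i < n" for i
    proof -
      have "y $ i * y $ i \<le> (\<Sum>i<n. y $ i * y $ i)"
        by (rule member_le_sum) (use that in auto)
      thus ?thesis using y abs_square_le_1[of "y $ i"] by (simp add: ip_sum power2_eq_square)
    qed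
    thus ?thesis using y by (fastforce simp: S_def ip_sum[of y n] abs_le_iff)
  qed
  obtain w where "dim_vec w = n" "w \<bullet> w = 1" "\<And>i. i < k \<Longrightarrow> u i \<bullet> w = 0"
    using orthonormal_extend[OF u] by blast
  hence "S \<noteq> {}" using vecS by blast
  have "continuous_on S q" unfolding q_def
    by (intro continuous_intros continuous_on_product_then_coordinatewise continuous_on_id)
  then obtain f where f: "f \<in> S" "\<And>h. h \<in> S \<Longrightarrow> q f \<le> q h"
    using continuous_attains_inf[OF \<open>compact S\<close> \<open>S \<noteq> {}\<close>] by blast
  define x where "x = Matrix.vec n f"
  have qv: "y \<bullet> (Q *\<^sub>v y) = (\<Sum>i<n. y $ i * (\<Sum>j<n. Q $$ (i, j) * y $ j))" if "dim_vec y = n" for y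
  proof -
    have "y \<bullet> (Q *\<^sub>v y) = (\<Sum>i<n. y $ i * (Q *\<^sub>v y) $ i)" using Q by (intro ip_sum) simp
    also have "\<dots> = (\<Sum>i<n. y $ i * (\<Sum>j<n. Q $$ (i, j) * y $ j))"
      by (intro sum.cong refl) (simp only: lessThan_iff mult_mat_vec_nth[OF Q that])
    finally show ?thesis .
  qed
  show thesis
  proof (rule that[of x])
    show "dim_vec x = n" "x \<bullet> x = 1" "\<And>i. i < k \<Longrightarrow> u i \<bullet> x = 0"
      using f(1) by (auto simp: x_def S_def ip_sum[of "Matrix.vec n f" n])
    fix y :: "real vec" assume y: "dim_vec y = n" "y \<bullet> y = 1" "\<And>i. i < k \<Longrightarrow> u i \<bullet> y = 0"
    have "q f \<le> q (\<lambda>i. if i < n then y $ i else 0)" using f(2) vecS[OF y] by simp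
    moreover have "x \<bullet> (Q *\<^sub>v x) = q f" by (simp add: qv x_def q_def)
    moreover have "y \<bullet> (Q *\<^sub>v y) = q (\<lambda>i. if i < n then y $ i else 0)" by (simp add: qv y q_def)
    ultimately show "x \<bullet> (Q *\<^sub>v x) \<le> y \<bullet> (Q *\<^sub>v y)" by simp
  qed
qed

text \<open>A minimizer \<open>x\<close> of the Rayleigh quotient on the complement is an
  eigenvector: its residual \<open>w\<close> is orthogonal to \<open>x\<close> and to all
  \<open>u i\<close>, so every x + t w competes, and the first variation forces w \<bullet> w =
  0.\<close>

lemma symmetric_next_eigenvector:
  assumes Q: "Q \<in> carrier_mat n n" "transpose_mat Q = Q" and u: "orthonormal n k u" "k < n"
    and ev: "\<And>i. i < k \<Longrightarrow> Q *\<^sub>v u i = \<mu> i \<cdot>\<^sub>v u i"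
  obtains x \<theta> where "dim_vec x = n" "x \<bullet> x = 1" "\<And>i. i < k \<Longrightarrow> u i \<bullet> x = 0" "Q *\<^sub>v x = \<theta> \<cdot>\<^sub>v (x :: real vec)"
proof -
  from rayleigh_minimizer[OF Q(1) u] obtain x where x: "dim_vec x = n" "x \<bullet> x = 1" "\<And>i. i < k \<Longrightarrow> u i \<bullet> x = 0"
    and min: "\<And>y. dim_vec y = n \<Longrightarrow> y \<bullet> y = 1 \<Longrightarrow> (\<And>i. i < k \<Longrightarrow> u i \<bullet> y = 0) \<Longrightarrow> x \<bullet> (Q *\<^sub>v x) \<le> y \<bullet> (Q *\<^sub>v y)"
    by blast
  define \<theta> where "\<theta> = x \<bullet> (Q *\<^sub>v x)"
  define w where "w = Q *\<^sub>v x - \<theta> \<cdot>\<^sub>v x"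
  have dQ: "dim_row Q = n" "dim_col Q = n" using Q by auto
  have dw: "dim_vec w = n" using x by (simp add: w_def)
  have du: "dim_vec (u i) = n" if "i < k" for i using u that by (simp add: orthonormal_def)
  have uw: "u i \<bullet> w = 0" if i: "i < k" for i
  proof -
    have "u i \<bullet> (Q *\<^sub>v x) = (Q *\<^sub>v u i) \<bullet> x" using symmetric_ip[OF Q, of "u i" x] x du[OF i] by simp
    also have "\<dots> = 0" using ev[OF i] x(3)[OF i] du[OF i] x(1) by (simp add: ip_simps)
    finally show ?thesis using x(1) x(3)[OF i] du[OF i] dQ by (simp add: w_def ip_simps)
  qed
  have xw: "x \<bullet> w = 0" using x dQ by (simp add: w_def ip_simps \<theta>_def)
  have scale: "\<theta> * (y \<bullet> y) \<le> y \<bullet> (Q *\<^sub>v y)" if y: "dim_vec y = n" "\<And>i. i < k \<Longrightarrow> u i \<bullet> y = 0" for y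
  proof (cases "y \<bullet> y = 0")
    case True
    hence "y = 0\<^sub>v n" using ip_self_eq_0[of y] y by simp
    thus ?thesis using dQ by simp
  next
    case False
    hence pos: "y \<bullet> y > 0" using ip_self_nonneg[of y] by linarith
    let ?y = "(1 / vnorm y) \<cdot>\<^sub>v y"
    have "?y \<bullet> ?y = 1" using pos by (simp add: ip_simps vnorm_def)
    hence "\<theta> \<le> ?y \<bullet> (Q *\<^sub>v ?y)" unfolding \<theta>_def using y du by (intro min) (auto simp: ip_simps)
    also have "Q *\<^sub>v ?y = (1 / vnorm y) \<cdot>\<^sub>v (Q *\<^sub>v y)"
      using Q y by (intro mult_mat_vec[of _ n n]) auto
    also have "?y \<bullet> ((1 / vnorm y) \<cdot>\<^sub>v (Q *\<^sub>v y)) = (y \<bullet> (Q *\<^sub>v y)) / (vnorm y)\<^sup>2"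
      using y dQ by (simp add: ip_simps power2_eq_square)
    finally show ?thesis using pos by (simp add: field_simps)
  qed
  have xQw: "x \<bullet> (Q *\<^sub>v w) = w \<bullet> (Q *\<^sub>v x)" using symmetric_ip[OF Q, of x w] x dw dQ by (simp add: ip_comm)
  have "0 \<le> 2 * t * (w \<bullet> (Q *\<^sub>v x)) + t\<^sup>2 * (w \<bullet> (Q *\<^sub>v w) - \<theta> * (w \<bullet> w))" for t
  proof -
    let ?y = "x + t \<cdot>\<^sub>v w"
    have "Q *\<^sub>v ?y = Q *\<^sub>v x + t \<cdot>\<^sub>v (Q *\<^sub>v w)"
      using Q x(1) dw by (simp add: mult_add_distrib_mat_vec[of Q n n] mult_mat_vec[of Q n n])
    hence "?y \<bullet> (Q *\<^sub>v ?y) = \<theta> + 2 * t * (w \<bullet> (Q *\<^sub>v x)) + t\<^sup>2 * (w \<bullet> (Q *\<^sub>v w))"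
      using x(1) dw dQ xQw by (simp add: ip_simps \<theta>_def algebra_simps power2_eq_square)
    moreover have "?y \<bullet> ?y = 1 + t\<^sup>2 * (w \<bullet> w)"
      using x(1,2) dw xw ip_comm[of w x] by (simp add: ip_simps power2_eq_square)
    moreover have "\<theta> * (?y \<bullet> ?y) \<le> ?y \<bullet> (Q *\<^sub>v ?y)"
      by (rule scale) (use x dw uw du in \<open>auto simp: ip_simps\<close>)
    ultimately show ?thesis by (simp add: algebra_simps)
  qed
  hence "w \<bullet> (Q *\<^sub>v x) = 0" by (rule linear_le_quadratic_imp_zero)
  hence "w \<bullet> w = 0" using x dw dQ xw by (subst (2) w_def) (simp add: ip_simps ip_comm[of w x])
  hence "w = 0\<^sub>v n" using dw by (simp add: ip_self_eq_0)
  hence "Q *\<^sub>v x = \<theta> \<cdot>\<^sub>v x" unfolding w_def by (rule vec_eq_if_diff_eq_0) (use x dQ in auto)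
  with x show thesis by (intro that[of x \<theta>]) simp_all
qed

definition eigenbasis :: "nat \<Rightarrow> real mat \<Rightarrow> (nat \<Rightarrow> real vec) \<Rightarrow> (nat \<Rightarrow> real) \<Rightarrow> bool" where
  "eigenbasis n Q u \<mu> \<longleftrightarrow> orthonormal n n u \<and> (\<forall>i<n. Q *\<^sub>v u i = \<mu> i \<cdot>\<^sub>v u i)"

theorem eigenbasis_exists:
  assumes Q: "Q \<in> carrier_mat n n" "transpose_mat Q = Q"
  obtains u \<mu> where "eigenbasis n Q u \<mu>"
proof -
  have "\<exists>u \<mu>. orthonormal n k u \<and> (\<forall>i<k. Q *\<^sub>v u i = \<mu> i \<cdot>\<^sub>v u i)" if "k \<le> n" for k
    using that
  proof (induction k)
    case 0
    show ?case by (simp add: orthonormal_def)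
  next
    case (Suc k)
    then obtain u \<mu> where u: "orthonormal n k u" "\<And>i. i < k \<Longrightarrow> Q *\<^sub>v u i = \<mu> i \<cdot>\<^sub>v u i" by auto
    have "k < n" using Suc by simp
    from symmetric_next_eigenvector[OF Q u(1) this u(2)] obtain x \<theta>
      where x: "dim_vec x = n" "x \<bullet> x = 1" "\<And>i. i < k \<Longrightarrow> u i \<bullet> x = 0" "Q *\<^sub>v x = \<theta> \<cdot>\<^sub>v x"
      by blast
    have "orthonormal n (Suc k) (u(k := x))" using u(1) x by (intro orthonormal_Suc)
    moreover have "\<forall>i<Suc k. Q *\<^sub>v (u(k := x)) i = (\<mu>(k := \<theta>)) i \<cdot>\<^sub>v (u(k := x)) i"
      using u(2) x by (auto simp: less_Suc_eq)
    ultimately show ?case by blast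
  qed
  thus thesis using that unfolding eigenbasis_def by blast
qed

text \<open>Any eigenvector has a nonzero coordinate along some \<open>u i\<close>, and symmetry
  makes the two eigenvalues agree there.\<close>

lemma symmetric_eigenvalues:
  assumes Q: "Q \<in> carrier_mat n n" "transpose_mat Q = Q" and e: "eigenbasis n Q u \<mu>"
  shows "{k. eigenvalue Q k} = \<mu> ` {..<n}"
proof (intro equalityI subsetI)
  fix k assume "k \<in> {k. eigenvalue Q k}"
  then obtain x where x: "dim_vec x = n" "x \<noteq> 0\<^sub>v n" "Q *\<^sub>v x = k \<cdot>\<^sub>v x"
    using Q by (auto simp: eigenvalue_def eigenvector_def)
  have on: "orthonormal n n u" and ev: "\<And>i. i < n \<Longrightarrow> Q *\<^sub>v u i = \<mu> i \<cdot>\<^sub>v u i"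
    using e by (auto simp: eigenbasis_def)
  then obtain i where i: "i < n" "u i \<bullet> x \<noteq> 0" using orthonormal_complete[OF on x(1)] x(2) by blast
  have d: "dim_vec (u i) = n" using on i by (simp add: orthonormal_def)
  have "(Q *\<^sub>v u i) \<bullet> x = u i \<bullet> (Q *\<^sub>v x)" by (rule symmetric_ip[OF Q d x(1)])
  hence "\<mu> i * (u i \<bullet> x) = k * (u i \<bullet> x)" using ev[OF i(1)] x d by (simp add: ip_simps)
  thus "k \<in> \<mu> ` {..<n}" using i by auto
next
  fix k assume "k \<in> \<mu> ` {..<n}"
  then obtain i where i: "i < n" "k = \<mu> i" by auto
  have "u i \<bullet> u i = 1" using e i by (auto simp: eigenbasis_def orthonormal_def)
  hence "u i \<noteq> 0\<^sub>v n" by auto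
  thus "k \<in> {k. eigenvalue Q k}" using e i Q
    by (auto simp: eigenbasis_def orthonormal_def eigenvalue_def eigenvector_def)
qed

section \<open>Rayleigh quotients in an eigenbasis\<close>

context
  fixes n :: nat and Q :: "real mat" and u :: "nat \<Rightarrow> real vec" and \<mu> :: "nat \<Rightarrow> real"
  assumes Q: "Q \<in> carrier_mat n n" "transpose_mat Q = Q" and e: "eigenbasis n Q u \<mu>"
begin

lemma eigenbasis_ip:
  assumes "i < n" "dim_vec x = n"
  shows "u i \<bullet> (Q *\<^sub>v x) = \<mu> i * (u i \<bullet> x)"
proof -
  have "dim_vec (u i) = n" "Q *\<^sub>v u i = \<mu> i \<cdot>\<^sub>v u i" using e assms by (auto simp: eigenbasis_def orthonormal_def)
  thus ?thesis using symmetric_ip[OF Q, of "u i" x] assms by (simp add: ip_simps)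
qed

lemma eigenbasis_bilinear:
  assumes "dim_vec x = n" "dim_vec y = n"
  shows "x \<bullet> (Q *\<^sub>v y) = (\<Sum>i<n. \<mu> i * (u i \<bullet> x) * (u i \<bullet> y))"
proof -
  have "x \<bullet> (Q *\<^sub>v y) = (\<Sum>i<n. (u i \<bullet> x) * (u i \<bullet> (Q *\<^sub>v y)))"
    using e Q assms by (intro parseval) (auto simp: eigenbasis_def)
  thus ?thesis using assms by (simp add: eigenbasis_ip mult_ac)
qed

lemma eigenbasis_norm:
  assumes "dim_vec x = n"
  shows "x \<bullet> x = (\<Sum>i<n. (u i \<bullet> x)\<^sup>2)"
  using parseval[of n u x x] e assms by (simp add: eigenbasis_def power2_eq_square)

context
  assumes n: "0 < n"
begin

lemma lambda_min_le: "i < n \<Longrightarrow> lambda_min Q \<le> \<mu> i"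
  unfolding lambda_min_def symmetric_eigenvalues[OF Q e] by (rule Min_le) auto

lemma lambda_min_attained: obtains i where "i < n" "\<mu> i = lambda_min Q"
proof -
  have "lambda_min Q \<in> \<mu> ` {..<n}"
    unfolding lambda_min_def symmetric_eigenvalues[OF Q e] by (rule Min_in) (use n in auto)
  thus thesis using that by auto
qed

lemma spectral_norm_eq: "spectral_norm Q = Max ((\<lambda>i. \<bar>\<mu> i\<bar>) ` {..<n})"
proof -
  have "{\<bar>k\<bar> |k. eigenvalue Q k} = abs ` {k. eigenvalue Q k}" by auto
  thus ?thesis by (simp add: spectral_norm_def symmetric_eigenvalues[OF Q e] image_image)
qed

lemma spectral_norm_ge: "i < n \<Longrightarrow> \<bar>\<mu> i\<bar> \<le> spectral_norm Q"
  unfolding spectral_norm_eq by (rule Max_ge) auto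

lemma spectral_norm_attained: obtains i where "i < n" "\<bar>\<mu> i\<bar> = spectral_norm Q"
proof -
  have "spectral_norm Q \<in> (\<lambda>i. \<bar>\<mu> i\<bar>) ` {..<n}"
    unfolding spectral_norm_eq by (rule Max_in) (use n in auto)
  thus thesis using that by auto
qed

lemma spectral_norm_nonneg: "0 \<le> spectral_norm Q"
  using spectral_norm_ge[OF n] by linarith

lemma rayleigh_lower:
  assumes "dim_vec x = n"
  shows "lambda_min Q * (x \<bullet> x) \<le> x \<bullet> (Q *\<^sub>v x)"
proof -
  have "lambda_min Q * (x \<bullet> x) = (\<Sum>i<n. lambda_min Q * (u i \<bullet> x)\<^sup>2)"
    by (simp add: eigenbasis_norm[OF assms] sum_distrib_left)
  also have "\<dots> \<le> (\<Sum>i<n. \<mu> i * (u i \<bullet> x)\<^sup>2)"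
    by (intro sum_mono mult_right_mono lambda_min_le) auto
  finally show ?thesis using assms by (simp add: eigenbasis_bilinear power2_eq_square mult.assoc)
qed

lemma rayleigh_abs:
  assumes "dim_vec x = n"
  shows "\<bar>x \<bullet> (Q *\<^sub>v x)\<bar> \<le> spectral_norm Q * (x \<bullet> x)"
proof -
  have "\<bar>x \<bullet> (Q *\<^sub>v x)\<bar> \<le> (\<Sum>i<n. \<bar>\<mu> i * (u i \<bullet> x)\<^sup>2\<bar>)"
    using assms by (simp add: eigenbasis_bilinear power2_eq_square mult.assoc sum_abs)
  also have "\<dots> \<le> (\<Sum>i<n. spectral_norm Q * (u i \<bullet> x)\<^sup>2)"
    by (intro sum_mono) (auto simp: abs_mult intro!: mult_right_mono spectral_norm_ge)
  finally show ?thesis by (simp add: eigenbasis_norm[OF assms] sum_distrib_left)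
qed

lemma mult_norm_le:
  assumes "dim_vec x = n"
  shows "(Q *\<^sub>v x) \<bullet> (Q *\<^sub>v x) \<le> (spectral_norm Q)\<^sup>2 * (x \<bullet> x)"
proof -
  have "(Q *\<^sub>v x) \<bullet> (Q *\<^sub>v x) = (\<Sum>i<n. (\<mu> i * (u i \<bullet> x))\<^sup>2)"
    using assms Q by (subst eigenbasis_norm) (auto simp: eigenbasis_ip)
  also have "\<dots> \<le> (\<Sum>i<n. (spectral_norm Q)\<^sup>2 * (u i \<bullet> x)\<^sup>2)"
    unfolding power_mult_distrib
    by (intro sum_mono mult_right_mono) (use spectral_norm_ge spectral_norm_nonneg in \<open>auto simp: abs_le_square_iff[symmetric]\<close>)
  finally show ?thesis by (simp add: eigenbasis_norm[OF assms] sum_distrib_left)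
qed

end
end

section \<open>Chebyshev polynomials\<close>

fun cheb :: "nat \<Rightarrow> real \<Rightarrow> real" where
  "cheb 0 x = 1"
| "cheb (Suc 0) x = x"
| "cheb (Suc (Suc m)) x = 2 * x * cheb (Suc m) x - cheb m x"

lemma cheb_cos: "cheb m (cos t) = cos (real m * t)"
proof (induction m "cos t" rule: cheb.induct)
  case (3 m)
  have "cos ((real m + 1) * t + t) + cos ((real m + 1) * t - t) = 2 * cos t * cos ((real m + 1) * t)"
    by (simp add: cos_add cos_diff)
  thus ?case using 3 by (simp add: algebra_simps)
qed auto

lemma cheb_cosh: "cheb m (cosh t) = cosh (real m * t)"
proof (induction m "cosh t" rule: cheb.induct)
  case (3 m)
  have "cosh ((real m + 1) * t + t) + cosh ((real m + 1) * t - t) = 2 * cosh t * cosh ((real m + 1) * t)"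
    by (simp add: cosh_add cosh_diff)
  thus ?case using 3 by (simp add: algebra_simps)
qed auto

text \<open>Covers the case that the eigenvalue of largest modulus is negative.\<close>

lemma cheb_minus: "cheb m (- x) = (-1) ^ m * cheb m x"
  by (induction m x rule: cheb.induct) (auto simp: algebra_simps)

lemma cheb_abs_le:
  assumes "\<bar>x\<bar> \<le> 1"
  shows "\<bar>cheb m x\<bar> \<le> 1"
proof -
  have "cheb m x = cos (real m * arccos x)" using assms cheb_cos[of m "arccos x"] by (simp add: cos_arccos abs_le_iff)
  thus ?thesis by simp
qed

text \<open>Beyond 1 every argument is the cosh of an angle, and \<open>cheb m\<close> multiplies
  this angle by \<open>m\<close>; monotonicity of cosh does the work of a derivative.\<close>

lemma cheb_ge:
  assumes "1 \<le> x" "x \<le> cosh t" "0 \<le> t"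
  shows "\<bar>cheb m x\<bar> \<le> cheb m (cosh t)"
proof -
  have s: "cosh (arcosh x) = x" "0 \<le> arcosh x" using assms by auto
  hence "cosh (arcosh x) \<le> cosh t" using assms by simp
  hence "arcosh x \<le> t" using s(2) assms(3) by (subst (asm) cosh_real_nonneg_le_iff)
  hence "cosh (real m * arcosh x) \<le> cosh (real m * t)"
    using s assms by (subst cosh_real_nonneg_le_iff) (auto intro: mult_left_mono)
  moreover have "cheb m x = cosh (real m * arcosh x)" using cheb_cosh[of m "arcosh x"] s by simp
  ultimately show ?thesis by (simp add: cheb_cosh)
qed

lemma cheb_cosh_ge: "exp (real m * t) / 2 \<le> cheb m (cosh t)"
  unfolding cheb_cosh by (simp add: cosh_def)

text \<open>The Chebyshev polynomial of the matrix c0 + c1 Q, applied to \<open>x\<close>. The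
  recurrence on vectors avoids polynomials in matrices; the affine map is there to scale the
  spectrum.\<close>

fun cheb_vec :: "real mat \<Rightarrow> real \<Rightarrow> real \<Rightarrow> real vec \<Rightarrow> nat \<Rightarrow> real vec" where
  "cheb_vec Q c0 c1 x 0 = x"
| "cheb_vec Q c0 c1 x (Suc 0) = c0 \<cdot>\<^sub>v x + c1 \<cdot>\<^sub>v (Q *\<^sub>v x)"
| "cheb_vec Q c0 c1 x (Suc (Suc m)) =
     2 \<cdot>\<^sub>v (c0 \<cdot>\<^sub>v cheb_vec Q c0 c1 x (Suc m) + c1 \<cdot>\<^sub>v (Q *\<^sub>v cheb_vec Q c0 c1 x (Suc m)))
       - cheb_vec Q c0 c1 x m"

lemma dim_cheb_vec [simp]:
  assumes "Q \<in> carrier_mat n n" "dim_vec x = n"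
  shows "dim_vec (cheb_vec Q c0 c1 x m) = n"
  using assms by (induction Q c0 c1 x m rule: cheb_vec.induct) auto

text \<open>The hypothesis asks \<open>y\<close> to act as an eigenvector only on the vectors
  \<open>cheb_vec Q c0 c1 x i\<close> with \<open>i < m\<close>. Thus \<open>y\<close> may be a Ritz
  vector, for which the relation holds on the Krylov space only.\<close>

lemma cheb_vec_ip:
  assumes Q: "Q \<in> carrier_mat n n" and x: "dim_vec x = n" and y: "dim_vec y = n"
    and ev: "\<And>i. i < m \<Longrightarrow> y \<bullet> (Q *\<^sub>v cheb_vec Q c0 c1 x i) = t * (y \<bullet> cheb_vec Q c0 c1 x i)"
  shows "y \<bullet> cheb_vec Q c0 c1 x m = cheb m (c0 + c1 * t) * (y \<bullet> x)"
  using ev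
proof (induction m rule: less_induct)
  case (less m)
  have d: "dim_row Q = n" "\<And>i. dim_vec (cheb_vec Q c0 c1 x i) = n" using Q x by auto
  consider "m = 0" | "m = 1" | k where "m = Suc (Suc k)" by (metis One_nat_def not0_implies_Suc)
  thus ?case
  proof cases
    case 2
    thus ?thesis using less.prems[of 0] x y d by (simp add: ip_simps algebra_simps)
  next
    case 3
    have "y \<bullet> cheb_vec Q c0 c1 x (Suc k) = cheb (Suc k) (c0 + c1 * t) * (y \<bullet> x)"
      "y \<bullet> cheb_vec Q c0 c1 x k = cheb k (c0 + c1 * t) * (y \<bullet> x)"
      using less 3 by auto
    thus ?thesis using less.prems[of "Suc k"] 3 y d by (simp add: ip_simps algebra_simps)
  qed simp
qed

section \<open>Krylov spaces\<close>

definition compression :: "real mat \<Rightarrow> nat \<Rightarrow> (nat \<Rightarrow> real vec) \<Rightarrow> real mat" where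
  "compression Q j v = mat j j (\<lambda>(i, l). v i \<bullet> (Q *\<^sub>v v l))"

text \<open>
  The span of the first \<open>m\<close> vectors, described as a double orthogonal complement so that
  invariance under a symmetric matrix needs no linear combinations.
\<close>

definition kspan :: "nat \<Rightarrow> (nat \<Rightarrow> real vec) \<Rightarrow> nat \<Rightarrow> real vec set" where
  "kspan n v m = {w. dim_vec w = n \<and> (\<forall>y. dim_vec y = n \<longrightarrow> (\<forall>l<m. v l \<bullet> y = 0) \<longrightarrow> w \<bullet> y = 0)}"

lemma kspan_mono: "m \<le> m' \<Longrightarrow> kspan n v m \<subseteq> kspan n v m'"
  by (auto simp: kspan_def)

lemma kspan_add: "w \<in> kspan n v m \<Longrightarrow> w' \<in> kspan n v m \<Longrightarrow> w + w' \<in> kspan n v m"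
  by (auto simp: kspan_def ip_simps)

lemma kspan_diff: "w \<in> kspan n v m \<Longrightarrow> w' \<in> kspan n v m \<Longrightarrow> w - w' \<in> kspan n v m"
  by (auto simp: kspan_def ip_simps)

lemma kspan_smult: "w \<in> kspan n v m \<Longrightarrow> c \<cdot>\<^sub>v w \<in> kspan n v m"
  by (auto simp: kspan_def ip_simps)

lemmas kspan_closed = kspan_add kspan_diff kspan_smult

text \<open>The residual is orthogonal to all \<open>v l\<close>, hence to \<open>w\<close> by the
  definition of \<open>kspan\<close> and to the sum, and therefore to itself.\<close>

lemma kspan_expand:
  assumes "orthonormal n j v" "w \<in> kspan n v j"
  shows "vsum n j (\<lambda>l. v l \<bullet> w) v = w"
proof -
  let ?r = "w - vsum n j (\<lambda>l. v l \<bullet> w) v"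
  have w: "dim_vec w = n" using assms by (simp add: kspan_def)
  have r: "v l \<bullet> ?r = 0" if "l < j" for l using residual_ip[OF assms(1) w that] .
  hence "w \<bullet> ?r = 0" using assms by (simp add: kspan_def)
  moreover have "vsum n j (\<lambda>l. v l \<bullet> w) v \<bullet> ?r = 0" using r by (simp add: ip_vsum_left)
  ultimately have "?r \<bullet> ?r = 0" using w by (simp add: ip_diff_left)
  hence "?r = 0\<^sub>v n" by (simp add: ip_self_eq_0)
  hence "w = vsum n j (\<lambda>l. v l \<bullet> w) v" by (rule vec_eq_if_diff_eq_0) (use w in auto)
  thus ?thesis by simp
qed

text \<open>Outcome of a Lanczos run. The three-term recurrence is stated weakly, tested against
  every \<open>y\<close>. In its last row the unnormalized residual \<open>r\<close> takes the place
  of the next basis vector, and \<open>r = 0\<^sub>v n\<close> means that the Krylov space is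
  invariant.\<close>

locale krylov =
  fixes n j :: nat and Q :: "real mat" and v :: "nat \<Rightarrow> real vec" and a b :: "nat \<Rightarrow> real" and r :: "real vec"
  assumes Q: "Q \<in> carrier_mat n n" "transpose_mat Q = Q"
    and on: "orthonormal n j v" and j: "0 < j"
    and r: "dim_vec r = n" "\<And>l. l < j \<Longrightarrow> v l \<bullet> r = 0"
    and rec: "\<And>l y. l < j \<Longrightarrow> dim_vec y = n \<Longrightarrow> (Q *\<^sub>v v l) \<bullet> y =
       (if l = 0 then 0 else b (l - 1) * (v (l - 1) \<bullet> y)) + a l * (v l \<bullet> y) +
       (if Suc l < j then b l * (v (Suc l) \<bullet> y) else r \<bullet> y)"
begin

lemma dims [simp]: "dim_row Q = n" "dim_col Q = n" "l < j \<Longrightarrow> dim_vec (v l) = n"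
  using Q on by (auto simp: orthonormal_def)

abbreviation "T \<equiv> compression Q j v"

lemma T_carrier: "T \<in> carrier_mat j j"
  by (simp add: compression_def)

lemma T_nth: "i < j \<Longrightarrow> l < j \<Longrightarrow> T $$ (i, l) = v i \<bullet> (Q *\<^sub>v v l)"
  by (simp add: compression_def)

lemma T_sym: "transpose_mat T = T"
  using symmetric_ip[OF Q] by (intro eq_matI) (auto simp: compression_def ip_comm)

lemma T_tridiagonal:
  assumes "i < j" "l < j"
  shows "T $$ (i, l) = (if i = l then a i else if l = Suc i then b i else if i = Suc l then b l else 0)"
proof -
  have "T $$ (i, l) = (Q *\<^sub>v v l) \<bullet> v i" using assms by (simp add: T_nth ip_comm)
  also have "\<dots> = (if i = l then a i else if l = Suc i then b i else if i = Suc l then b l else 0)"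
    using on assms r by (subst rec) (auto simp: orthonormal_def ip_comm[of r])
  finally show ?thesis .
qed

text \<open>By symmetry \<open>Q\<close> can be moved to the test vector \<open>y\<close>. The
  recurrence shows that Q y is orthogonal to the first \<open>m\<close> vectors, hence to
  \<open>w\<close>.\<close>

lemma krylov_step:
  assumes "w \<in> kspan n v m" "m < j \<or> (m = j \<and> r = 0\<^sub>v n)"
  shows "Q *\<^sub>v w \<in> kspan n v (if m < j then Suc m else j)"
proof -
  have w: "dim_vec w = n" using assms by (simp add: kspan_def)
  have "(Q *\<^sub>v w) \<bullet> y = 0" if y: "dim_vec y = n" "\<forall>l<(if m < j then Suc m else j). v l \<bullet> y = 0" for y
  proof -
    have "v l \<bullet> (Q *\<^sub>v y) = 0" if "l < m" for l
      using that y assms(2) symmetric_ip[OF Q, of "v l" y] rec[of l y] by (auto split: if_splits)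
    hence "w \<bullet> (Q *\<^sub>v y) = 0" using assms(1) y(1) by (simp add: kspan_def)
    thus ?thesis using symmetric_ip[OF Q w y(1)] by simp
  qed
  thus ?thesis by (simp add: kspan_def)
qed

lemma cheb_vec_kspan_Suc:
  "m < j \<Longrightarrow> cheb_vec Q c0 c1 (v 0) m \<in> kspan n v (Suc m)"
proof (induction m rule: less_induct)
  case (less m)
  have v0: "v 0 \<in> kspan n v (Suc 0)" using j by (simp add: kspan_def)
  consider "m = 0" | "m = 1" | k where "m = Suc (Suc k)" by (metis One_nat_def not0_implies_Suc)
  thus ?case
  proof cases
    case 2
    thus ?thesis using v0 krylov_step[OF v0] kspan_mono[of "Suc 0" "Suc m" n v] less.prems
      by (auto intro!: kspan_closed)
  next
    case 3
    let ?w = "cheb_vec Q c0 c1 (v 0)"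
    have "?w (Suc k) \<in> kspan n v (Suc (Suc k))" "?w k \<in> kspan n v (Suc k)" using less 3 by auto
    moreover from this have "Q *\<^sub>v ?w (Suc k) \<in> kspan n v (Suc m)" using krylov_step[of "?w (Suc k)" "Suc (Suc k)"] less.prems 3 by simp
    ultimately show ?thesis using kspan_mono[of "Suc k" "Suc m" n v] kspan_mono[of "Suc (Suc k)" "Suc m" n v] 3
      by (auto intro!: kspan_closed)
  qed (use v0 in auto)
qed

text \<open>Without a residual the space is invariant under \<open>Q\<close> and the degree is
  unrestricted. This is why early termination does no harm.\<close>

lemma cheb_vec_kspan:
  assumes "m < j \<or> r = 0\<^sub>v n"
  shows "cheb_vec Q c0 c1 (v 0) m \<in> kspan n v j"
proof (cases "m < j")
  case True
  thus ?thesis using cheb_vec_kspan_Suc[OF True] kspan_mono[of "Suc m" j n v] by auto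
next
  case False
  hence r0: "r = 0\<^sub>v n" using assms by simp
  have v0: "v 0 \<in> kspan n v j" using j by (simp add: kspan_def)
  have st: "Q *\<^sub>v w \<in> kspan n v j" if "w \<in> kspan n v j" for w using krylov_step[OF that] r0 by simp
  show ?thesis
  proof (induction m rule: less_induct)
    case (less m)
    consider "m = 0" | "m = 1" | k where "m = Suc (Suc k)" by (metis One_nat_def not0_implies_Suc)
    thus ?case
    proof cases
      case 3
      thus ?thesis using less[of k] less[of "Suc k"] by (auto intro!: kspan_closed st)
    qed (auto intro!: kspan_closed v0 st)
  qed
qed

text \<open>Multiplication by the matrix of Lanczos vectors, an isometry from the coordinates of
  \<open>T\<close> onto the Krylov space.\<close>

definition lift :: "real vec \<Rightarrow> real vec" where
  "lift z = vsum n j (\<lambda>l. z $ l) v"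

lemma dim_lift [simp]: "dim_vec (lift z) = n"
  by (simp add: lift_def)

lemma lift_ip: "dim_vec z = j \<Longrightarrow> dim_vec z' = j \<Longrightarrow> lift z \<bullet> lift z' = z \<bullet> z'"
  unfolding lift_def ip_vsum_vsum[OF on] by (simp add: ip_sum)

lemma lift_quadratic:
  assumes "dim_vec z = j" "dim_vec z' = j"
  shows "lift z \<bullet> (Q *\<^sub>v lift z') = z \<bullet> (T *\<^sub>v z')"
proof -
  have "v i \<bullet> (Q *\<^sub>v lift z') = (T *\<^sub>v z') $ i" if "i < j" for i
  proof -
    have "v i \<bullet> (Q *\<^sub>v lift z') = (Q *\<^sub>v v i) \<bullet> lift z'" using symmetric_ip[OF Q, of "v i" "lift z'"] that by simp
    also have "\<dots> = (\<Sum>l<j. z' $ l * ((Q *\<^sub>v v i) \<bullet> v l))" unfolding lift_def by (rule ip_vsum_right) auto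
    also have "\<dots> = (\<Sum>l<j. T $$ (i, l) * z' $ l)" using that symmetric_ip[OF Q] by (auto intro!: sum.cong simp: T_nth)
    finally show ?thesis using mult_mat_vec_nth[OF T_carrier assms(2) that] by simp
  qed
  thus ?thesis using T_carrier by (simp add: lift_def ip_vsum_left ip_sum[of "T *\<^sub>v z'" j])
qed

lemma lift_ip_kspan:
  assumes "w \<in> kspan n v j" "dim_vec z = j"
  shows "lift z \<bullet> w = z \<bullet> Matrix.vec j (\<lambda>l. v l \<bullet> w)"
  using assms by (simp add: lift_def ip_vsum_left kspan_def ip_sum[of "Matrix.vec j (\<lambda>l. v l \<bullet> w)" j])

lemma kspan_lift:
  assumes "w \<in> kspan n v j"
  shows "lift (Matrix.vec j (\<lambda>l. v l \<bullet> w)) = w"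
proof -
  have "lift (Matrix.vec j (\<lambda>l. v l \<bullet> w)) = vsum n j (\<lambda>l. v l \<bullet> w) v"
    by (auto simp: lift_def vsum_def)
  thus ?thesis using kspan_expand[OF on assms] by simp
qed

lemma v0_lift_ip: "dim_vec z = j \<Longrightarrow> lift z \<bullet> v 0 = z $ 0"
  using ip_orthonormal_vsum[OF on j] j by (simp add: lift_def ip_comm)

lemma ritz_cheb_moment:
  assumes u: "eigenbasis n Q u \<mu>" and e: "eigenbasis j T e \<theta>" and m: "m < j \<or> r = 0\<^sub>v n"
  shows "(\<Sum>i<j. (cheb m (c0 + c1 * \<theta> i) * e i $ 0)\<^sup>2) = (\<Sum>i<n. (cheb m (c0 + c1 * \<mu> i) * (u i \<bullet> v 0))\<^sup>2)"
proof -
  let ?w = "cheb_vec Q c0 c1 (v 0)"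
  have v0: "dim_vec (v 0) = n" using j by simp
  have dw: "dim_vec (?w i) = n" for i using Q v0 by simp
  have de: "dim_vec (e i) = j" if "i < j" for i using e that by (simp add: eigenbasis_def orthonormal_def)
  have du: "dim_vec (u i) = n" if "i < n" for i using u that by (simp add: eigenbasis_def orthonormal_def)
  have k: "?w i \<in> kspan n v j" if "i \<le> m" for i using m that by (intro cheb_vec_kspan) auto
  have Qw: "?w m \<bullet> ?w m = (\<Sum>i<n. (cheb m (c0 + c1 * \<mu> i) * (u i \<bullet> v 0))\<^sup>2)"
  proof -
    have "u i \<bullet> ?w m = cheb m (c0 + c1 * \<mu> i) * (u i \<bullet> v 0)" if "i < n" for i
      by (rule cheb_vec_ip[OF Q(1) v0 du[OF that]]) (use eigenbasis_ip[OF Q u that] dw in auto)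
    thus ?thesis by (simp add: eigenbasis_norm[OF Q u dw])
  qed
  have Tw: "?w m \<bullet> ?w m = (\<Sum>i<j. (cheb m (c0 + c1 * \<theta> i) * e i $ 0)\<^sup>2)"
  proof -
    \<comment> \<open>A Ritz vector need not be an eigenvector of \<open>Q\<close>; the relation is
      only valid when tested on the Krylov space.\<close>
    have ritz: "lift (e i) \<bullet> (Q *\<^sub>v w) = \<theta> i * (lift (e i) \<bullet> w)" if "i < j" "w \<in> kspan n v j" for i w
    proof -
      let ?z = "Matrix.vec j (\<lambda>l. v l \<bullet> w)"
      have "lift (e i) \<bullet> (Q *\<^sub>v w) = e i \<bullet> (T *\<^sub>v ?z)"
        using lift_quadratic[of "e i" ?z] kspan_lift[OF that(2)] de[OF that(1)] by simp
      also have "\<dots> = \<theta> i * (e i \<bullet> ?z)" by (rule eigenbasis_ip[OF T_carrier T_sym e that(1)]) simp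
      finally show ?thesis using lift_ip_kspan[OF that(2) de[OF that(1)]] by simp
    qed
    have "lift (e i) \<bullet> ?w m = cheb m (c0 + c1 * \<theta> i) * e i $ 0" if "i < j" for i
    proof -
      have "lift (e i) \<bullet> ?w m = cheb m (c0 + c1 * \<theta> i) * (lift (e i) \<bullet> v 0)"
        by (rule cheb_vec_ip[OF Q(1) v0]) (use ritz[OF that] k in auto)
      thus ?thesis using v0_lift_ip de that by simp
    qed
    moreover have "?w m \<bullet> ?w m = (\<Sum>i<j. (e i \<bullet> Matrix.vec j (\<lambda>l. v l \<bullet> ?w m))\<^sup>2)"
      using lift_ip[of "Matrix.vec j (\<lambda>l. v l \<bullet> ?w m)" "Matrix.vec j (\<lambda>l. v l \<bullet> ?w m)"] kspan_lift[OF k[OF order.refl]]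
        eigenbasis_norm[OF T_carrier T_sym e, of "Matrix.vec j (\<lambda>l. v l \<bullet> ?w m)"] by simp
    ultimately show ?thesis using lift_ip_kspan[OF k[OF order.refl]] de by simp
  qed
  show ?thesis using Qw Tw by simp
qed

end

section \<open>Tridiagonal matrices\<close>

definition tri_mat :: "nat \<Rightarrow> (nat \<Rightarrow> real) \<Rightarrow> (nat \<Rightarrow> real) \<Rightarrow> real mat" where
  "tri_mat j a b = mat j j (\<lambda>(i, l). if i = l then a i else if l = Suc i then b i else if i = Suc l then b l else 0)"

lemma tri_mat_carrier: "tri_mat j a b \<in> carrier_mat j j"
  by (simp add: tri_mat_def)

lemma tri_mat_sym: "transpose_mat (tri_mat j a b) = tri_mat j a b"
  by (intro eq_matI) (auto simp: tri_mat_def)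

lemma tri_mat_mult_nth:
  assumes "dim_vec x = j" "i < j"
  shows "(tri_mat j a b *\<^sub>v x) $ i = (if i = 0 then 0 else b (i - 1) * x $ (i - 1)) + a i * x $ i +
    (if Suc i < j then b i * x $ Suc i else 0)"
proof -
  have "(tri_mat j a b *\<^sub>v x) $ i = (\<Sum>l<j. tri_mat j a b $$ (i, l) * x $ l)"
    by (rule mult_mat_vec_nth[OF tri_mat_carrier assms])
  also have "\<dots> = (\<Sum>l<j. (if l = i - 1 then (if i = 0 then 0 else b l * x $ l) else 0) +
      (if l = i then a l * x $ l else 0) + (if l = Suc i then b i * x $ l else 0))"
    using assms(2) by (intro sum.cong) (auto simp: tri_mat_def)
  finally show ?thesis using assms(2) by (simp add: sum.distrib)
qed

text \<open>Gershgorin's argument, in the row where the eigenvector has its largest component. The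
  row sums are those of \<open>tri_bound\<close>, whose last row also counts the residual
  norm.\<close>

lemma gershgorin_tri_mat:
  assumes e: "eigenbasis j (tri_mat j a b) e \<theta>" and i: "i < j"
    and R: "\<And>l. l < j \<Longrightarrow> (if l = 0 then 0 else \<bar>b (l - 1)\<bar>) + \<bar>a l\<bar> + \<bar>b l\<bar> \<le> R"
  shows "\<bar>\<theta> i\<bar> \<le> R"
proof -
  have d: "dim_vec (e i) = j" and ee: "e i \<bullet> e i = 1" and ev: "tri_mat j a b *\<^sub>v e i = \<theta> i \<cdot>\<^sub>v e i"
    using e i by (auto simp: eigenbasis_def orthonormal_def)
  have "finite {..<j}" "{..<j} \<noteq> {}" using i by auto
  then obtain l where l: "l < j" and max: "\<And>k. k < j \<Longrightarrow> \<bar>e i $ k\<bar> \<le> \<bar>e i $ l\<bar>"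
    using obtains_MAX[of "{..<j}" "\<lambda>k. \<bar>e i $ k\<bar>"] by (metis (no_types, lifting) Max_ge finite_imageI image_eqI lessThan_iff)
  have pos: "\<bar>e i $ l\<bar> > 0"
  proof (rule ccontr)
    assume "\<not> ?thesis"
    hence "e i $ k = 0" if "k < j" for k using max[OF that] by simp
    hence "e i \<bullet> e i = 0" using d by (simp add: ip_sum)
    thus False using ee by simp
  qed
  have "\<theta> i * e i $ l = (tri_mat j a b *\<^sub>v e i) $ l" using ev l d by simp
  hence "\<bar>\<theta> i\<bar> * \<bar>e i $ l\<bar> = \<bar>(if l = 0 then 0 else b (l - 1) * e i $ (l - 1)) + a l * e i $ l +
    (if Suc l < j then b l * e i $ Suc l else 0)\<bar>"
    unfolding tri_mat_mult_nth[OF d l] by (simp add: abs_mult[symmetric])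
  also have "\<dots> \<le> \<bar>if l = 0 then 0 else b (l - 1) * e i $ (l - 1)\<bar> + \<bar>a l * e i $ l\<bar> +
    \<bar>if Suc l < j then b l * e i $ Suc l else 0\<bar>" by linarith
  also have "\<dots> \<le> (if l = 0 then 0 else \<bar>b (l - 1)\<bar>) * \<bar>e i $ l\<bar> + \<bar>a l\<bar> * \<bar>e i $ l\<bar> + \<bar>b l\<bar> * \<bar>e i $ l\<bar>"
    using l max by (intro add_mono) (auto simp: abs_mult intro!: mult_left_mono)
  also have "\<dots> = ((if l = 0 then 0 else \<bar>b (l - 1)\<bar>) + \<bar>a l\<bar> + \<bar>b l\<bar>) * \<bar>e i $ l\<bar>"
    by (simp add: algebra_simps)
  also have "\<dots> \<le> R * \<bar>e i $ l\<bar>" by (intro mult_right_mono R l) simp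
  finally show ?thesis using pos by simp
qed

text \<open>Parseval for the first unit vector, which represents the starting vector in Lanczos
  coordinates: the weights of the Ritz vectors in the start sum to 1.\<close>

lemma eigenbasis_first_coords:
  assumes "eigenbasis j A e \<theta>" "A \<in> carrier_mat j j" "transpose_mat A = A" "0 < j"
  shows "(\<Sum>i<j. (e i $ 0)\<^sup>2) = 1"
proof -
  have "1 = unit_vec j 0 \<bullet> (unit_vec j 0 :: real vec)" using assms by simp
  also have "\<dots> = (\<Sum>i<j. (e i \<bullet> unit_vec j 0)\<^sup>2)" by (rule eigenbasis_norm[OF assms(2,3,1)]) simp
  finally show ?thesis using assms(4) by simp
qed

section \<open>Quality of Ritz values\<close>

lemma cosh_le_1_add_sq:
  assumes "0 \<le> x" "x \<le> (1 :: real)"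
  shows "cosh x \<le> 1 + x\<^sup>2"
proof -
  have "exp x \<le> 1 + x + x\<^sup>2" using exp_bound[OF assms] .
  moreover have "exp (- x) \<le> 1 - x + x\<^sup>2"
  proof -
    \<comment> \<open>The product is 1 + x^3; with 1 + x \<le> exp x this gives the bound for exp (-
      x).\<close>
    have "1 \<le> (1 - x + x\<^sup>2) * (1 + x)" using assms by (simp add: algebra_simps power2_eq_square)
    also have "\<dots> \<le> (1 - x + x\<^sup>2) * exp x"
    proof (rule mult_left_mono)
      show "1 + x \<le> exp x" by simp
      have "0 \<le> x\<^sup>2" by simp
      thus "0 \<le> 1 - x + x\<^sup>2" using assms by linarith
    qed
    finally show ?thesis by (simp add: exp_minus field_simps)
  qed
  ultimately show ?thesis by (simp add: cosh_def)
qed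

context krylov
begin

lemma T_eq: "T = tri_mat j a b"
  using T_tridiagonal T_carrier by (intro eq_matI) (auto simp: tri_mat_def)

context
  fixes u \<mu> e \<theta>
  assumes u: "eigenbasis n Q u \<mu>" and e: "eigenbasis j T e \<theta>"
begin

lemma v0_unit: "v 0 \<bullet> v 0 = 1" "dim_vec (v 0) = n" "0 < n"
  using on j orthonormal_le[OF on] by (auto simp: orthonormal_def)

lemma ritz_rayleigh:
  assumes "i < j"
  shows "lift (e i) \<bullet> (Q *\<^sub>v lift (e i)) = \<theta> i" "lift (e i) \<bullet> lift (e i) = 1"
  using e assms by (auto simp: eigenbasis_def orthonormal_def lift_ip lift_quadratic ip_simps)

lemma ritz_ge_lambda_min: "i < j \<Longrightarrow> lambda_min Q \<le> \<theta> i"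
  using rayleigh_lower[OF Q u v0_unit(3), of "lift (e i)"] ritz_rayleigh[of i] by simp

lemma ritz_abs_le: "i < j \<Longrightarrow> \<bar>\<theta> i\<bar> \<le> spectral_norm Q"
  using rayleigh_abs[OF Q u v0_unit(3), of "lift (e i)"] ritz_rayleigh[of i] by simp

lemma cheb_moment_ge:
  assumes "m < j \<or> r = 0\<^sub>v n" "i < n" "\<tau> \<le> (u i \<bullet> v 0)\<^sup>2"
  shows "\<tau> * (cheb m (c0 + c1 * \<mu> i))\<^sup>2 \<le> (\<Sum>i<j. (cheb m (c0 + c1 * \<theta> i))\<^sup>2 * (e i $ 0)\<^sup>2)"
proof -
  have "\<tau> * (cheb m (c0 + c1 * \<mu> i))\<^sup>2 \<le> (cheb m (c0 + c1 * \<mu> i) * (u i \<bullet> v 0))\<^sup>2"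
    using assms(3) by (simp add: power_mult_distrib mult.commute mult_right_mono)
  also have "\<dots> \<le> (\<Sum>i<n. (cheb m (c0 + c1 * \<mu> i) * (u i \<bullet> v 0))\<^sup>2)"
    using assms(2) by (intro member_le_sum) auto
  finally show ?thesis using ritz_cheb_moment[OF u e assms(1), of c0 c1] by (simp add: power_mult_distrib)
qed

text \<open>If all Ritz values were smaller, every Chebyshev value on the Ritz side would be at most
  1 in modulus and the sum at most 1, whereas the single eigenvalue \<open>\<mu> i\<close>, scaled
  to 2 or - 2, already contributes more.\<close>

lemma ritz_abs_attained:
  assumes m: "m < j \<or> r = 0\<^sub>v n" and i: "i < n" "\<bar>\<mu> i\<bar> = spectral_norm Q" "\<tau> \<le> (u i \<bullet> v 0)\<^sup>2"
    and \<rho>: "0 < spectral_norm Q" and big: "4 < \<tau> * exp (2 * real m)" and \<tau>: "0 < \<tau>"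
  shows "\<exists>l<j. spectral_norm Q / 2 \<le> \<bar>\<theta> l\<bar>"
proof (rule ccontr)
  let ?\<rho> = "spectral_norm Q"
  assume "\<not> ?thesis"
  hence small: "\<bar>2 / ?\<rho> * \<theta> l\<bar> \<le> 1" if "l < j" for l using that \<rho> by (force simp: field_simps abs_mult)
  have "\<bar>cheb m (2 / ?\<rho> * \<mu> i)\<bar> = \<bar>cheb m 2\<bar>"
  proof -
    have "2 / ?\<rho> * \<mu> i = 2 \<or> 2 / ?\<rho> * \<mu> i = - 2" using i(2) \<rho> by (cases "\<mu> i \<ge> 0") (auto simp: field_simps)
    thus ?thesis by (auto simp: cheb_minus abs_mult power_abs)
  qed
  \<comment> \<open>Since cosh 1 \<le> 2, the growth rate arcosh 2 may be replaced by 1.\<close>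
  moreover have "exp (real m) / 2 \<le> \<bar>cheb m 2\<bar>"
  proof -
    have "cosh 1 \<le> (2 :: real)" using cosh_le_1_add_sq[of 1] by simp
    hence "\<bar>cheb m (cosh 1)\<bar> \<le> cheb m (cosh (arcosh 2))"
      by (intro cheb_ge) (auto simp: cosh_real_ge_1)
    thus ?thesis using cheb_cosh_ge[of m 1] by simp
  qed
  ultimately have "(exp (real m) / 2)\<^sup>2 \<le> (cheb m (2 / ?\<rho> * \<mu> i))\<^sup>2"
    by (intro abs_le_square_iff[THEN iffD1]) auto
  hence "\<tau> * (exp (2 * real m) / 4) \<le> \<tau> * (cheb m (2 / ?\<rho> * \<mu> i))\<^sup>2"
    using \<tau> by (intro mult_left_mono) (auto simp: power_divide exp_double)
  also have "\<dots> \<le> (\<Sum>i<j. (cheb m (2 / ?\<rho> * \<theta> i))\<^sup>2 * (e i $ 0)\<^sup>2)"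
    using cheb_moment_ge[OF m i(1) i(3), of 0 "2 / ?\<rho>"] by simp
  also have "\<dots> \<le> (\<Sum>i<j. 1 * (e i $ 0)\<^sup>2)"
  proof (intro sum_mono mult_right_mono)
    fix l assume "l \<in> {..<j}"
    thus "(cheb m (2 / ?\<rho> * \<theta> l))\<^sup>2 \<le> 1" using cheb_abs_le[OF small, of l m] by (simp only: abs_square_le_1 lessThan_iff)
  qed simp
  also have "\<dots> = 1" using eigenbasis_first_coords[OF e T_carrier T_sym j] by simp
  finally show False using big by simp
qed

text \<open>Ritz values with scaled argument in [-1, 1] add at most 1 to the moment sum in total, as
  the weights sum to 1. All others are low and add at most \<open>C\<close> times their
  weight.\<close>

lemma ritz_low_weight:
  assumes m: "m < j \<or> r = 0\<^sub>v n" and i: "i < n" "\<mu> i = lambda_min Q" "\<tau> \<le> (u i \<bullet> v 0)\<^sup>2"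
    and \<rho>: "0 < spectral_norm Q" and big: "8 \<le> \<tau> * exp (2 * real m * t)" and \<tau>: "0 < \<tau>"
    and t: "0 < t" "t \<le> 1" "spectral_norm Q * t\<^sup>2 \<le> \<eta>"
  shows "\<tau> / 2 \<le> (\<Sum>l | l < j \<and> \<theta> l < lambda_min Q + \<eta>. (e l $ 0)\<^sup>2)"
proof -
  let ?\<rho> = "spectral_norm Q"
  let ?S = "\<Sum>l | l < j \<and> \<theta> l < lambda_min Q + \<eta>. (e l $ 0)\<^sup>2"
  \<comment> \<open>The affine map sends \<open>lambda_min Q\<close> to cosh t with slope - 1 /
    ?\<rho>. All Ritz values then land in [cosh t - 2, cosh t], never below -1, and an argument
    above 1 means a distance less than ?\<rho> t^2 from \<open>lambda_min Q\<close>, because cosh t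
    \<le> 1 + t^2.\<close>
  define c1 where "c1 = - 1 / ?\<rho>"
  define c0 where "c0 = cosh t - c1 * lambda_min Q"
  have arg: "c0 + c1 * x = cosh t - (x - lambda_min Q) / ?\<rho>" for x
    using \<rho> by (simp add: c0_def c1_def field_simps)
  define C where "C = (cheb m (cosh t))\<^sup>2"
  have c1t: "1 \<le> cosh t" "cosh t \<le> 1 + t\<^sup>2" using cosh_le_1_add_sq[of t] t by (auto simp: cosh_real_ge_1)
  have C: "8 / \<tau> \<le> 4 * C"
  proof -
    have "(exp (real m * t) / 2)\<^sup>2 \<le> C" unfolding C_def
      by (intro power_mono cheb_cosh_ge) auto
    hence "exp (2 * real m * t) / 4 \<le> C" using exp_double[of "real m * t"]
      by (simp add: power_divide mult.assoc)
    hence "\<tau> * exp (2 * real m * t) \<le> \<tau> * (4 * C)" using \<tau> by (intro mult_left_mono) auto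
    hence "8 \<le> \<tau> * (4 * C)" using big by linarith
    thus ?thesis using \<tau> by (simp add: field_simps)
  qed
  have bound: "(cheb m (c0 + c1 * \<theta> l))\<^sup>2 * (e l $ 0)\<^sup>2 \<le>
      (if \<theta> l < lambda_min Q + \<eta> then C * (e l $ 0)\<^sup>2 else 0) + (e l $ 0)\<^sup>2" if l: "l < j" for l
  proof (cases "\<bar>c0 + c1 * \<theta> l\<bar> \<le> 1")
    case True
    hence "(cheb m (c0 + c1 * \<theta> l))\<^sup>2 \<le> 1" by (simp add: abs_square_le_1 cheb_abs_le)
    hence "(cheb m (c0 + c1 * \<theta> l))\<^sup>2 * (e l $ 0)\<^sup>2 \<le> 1 * (e l $ 0)\<^sup>2" by (intro mult_right_mono) auto
    moreover have "0 \<le> C * (e l $ 0)\<^sup>2" by (simp add: C_def)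
    ultimately show ?thesis by simp
  next
    case False
    have "lambda_min Q \<le> \<theta> l" "\<theta> l \<le> ?\<rho>" using ritz_ge_lambda_min[OF l] ritz_abs_le[OF l] by auto
    moreover have "- ?\<rho> \<le> lambda_min Q" using i spectral_norm_ge[OF Q u v0_unit(3) i(1)] by simp
    ultimately have "0 \<le> (\<theta> l - lambda_min Q) / ?\<rho>" "(\<theta> l - lambda_min Q) / ?\<rho> \<le> 2"
      using \<rho> by (auto simp: field_simps)
    hence *: "1 < c0 + c1 * \<theta> l" "c0 + c1 * \<theta> l \<le> cosh t" using False c1t unfolding arg by auto
    hence "(\<theta> l - lambda_min Q) / ?\<rho> < t\<^sup>2" using c1t unfolding arg by linarith
    hence "\<theta> l < lambda_min Q + \<eta>" using t(3) \<rho> by (simp add: field_simps)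
    moreover have "(cheb m (c0 + c1 * \<theta> l))\<^sup>2 \<le> C" unfolding C_def
      using cheb_ge[of "c0 + c1 * \<theta> l" t m] * t by (intro abs_le_square_iff[THEN iffD1]) auto
    hence "(cheb m (c0 + c1 * \<theta> l))\<^sup>2 * (e l $ 0)\<^sup>2 \<le> C * (e l $ 0)\<^sup>2" by (intro mult_right_mono) auto
    ultimately show ?thesis by (simp add: add_increasing2)
  qed
  have "\<tau> * C \<le> (\<Sum>i<j. (cheb m (c0 + c1 * \<theta> i))\<^sup>2 * (e i $ 0)\<^sup>2)"
    using cheb_moment_ge[OF m i(1) i(3), of c0 c1] by (simp add: arg i(2) C_def)
  also have "\<dots> \<le> (\<Sum>l<j. (if \<theta> l < lambda_min Q + \<eta> then C * (e l $ 0)\<^sup>2 else 0) + (e l $ 0)\<^sup>2)"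
    by (intro sum_mono bound) auto
  also have "\<dots> = C * ?S + 1"
  proof -
    have "C * ?S = (\<Sum>l\<in>{l\<in>{..<j}. \<theta> l < lambda_min Q + \<eta>}. C * (e l $ 0)\<^sup>2)"
      unfolding sum_distrib_left by (rule sum.cong) auto
    also have "\<dots> = (\<Sum>l<j. if \<theta> l < lambda_min Q + \<eta> then C * (e l $ 0)\<^sup>2 else 0)"
      by (rule sum.inter_filter) simp
    finally show ?thesis using eigenbasis_first_coords[OF e T_carrier T_sym j] by (simp add: sum.distrib)
  qed
  \<comment> \<open>Division by \<open>C\<close> leaves \<tau> \<le> ?S + 1 / C. Here C \<ge> 2 /
    \<tau>, which is the origin of the 8 in \<open>big\<close>.\<close>
  finally have "\<tau> * C \<le> C * ?S + 1" .
  moreover have "0 < C" using C \<tau> by (smt (verit) divide_pos_pos)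
  ultimately have "\<tau> \<le> ?S + 1 / C" by (simp add: field_simps)
  moreover have "1 / C \<le> \<tau> / 2" using C \<tau> \<open>0 < C\<close> by (simp add: field_simps)
  ultimately show ?thesis by linarith
qed

end

end

section \<open>Algorithms for tridiagonal matrices\<close>

lemma result_bind [simp]: "result (bind_timed m f) = result (f (result m))"
  by (simp add: bind_timed_def)

lemma cost_bind [simp]: "cost (bind_timed m f) = cost m + cost (f (result m))"
  by (simp add: bind_timed_def)

lemma ops_simps [simp]: "result (ops c x) = x" "cost (ops c x) = c"
  by (simp_all add: ops_def)

lemma ret_simps [simp]: "result (ret x) = x" "cost (ret x) = 0"
  by (simp_all add: ret_def)

abbreviation tmat :: "(real \<times> real) list \<Rightarrow> real mat" where
  "tmat ts \<equiv> tri_mat (length ts) (\<lambda>i. fst (ts ! i)) (\<lambda>i. snd (ts ! i))"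

text \<open>The quadratic form of \<open>tmat ts\<close>, by recursion on the list so that it
  follows the elimination in \<open>pivots_pos\<close>.\<close>

fun tqf :: "(real \<times> real) list \<Rightarrow> real list \<Rightarrow> real" where
  "tqf ((\<alpha>, \<beta>) # ts) (z # zs) = \<alpha> * z\<^sup>2 + (case zs of [] \<Rightarrow> 0 | z' # _ \<Rightarrow> 2 * \<beta> * z * z') + tqf ts zs"
| "tqf _ _ = 0"

lemma tqf_index:
  "length zs = length ts \<Longrightarrow> tqf ts zs = (\<Sum>i<length ts. zs ! i *
     ((if i = 0 then 0 else snd (ts ! (i - 1)) * zs ! (i - 1)) + fst (ts ! i) * zs ! i +
      (if Suc i < length ts then snd (ts ! i) * zs ! Suc i else 0)))"
proof (induction ts zs rule: tqf.induct)
  case (1 \<alpha> \<beta> ts z zs)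
  let ?n = "length ts"
  let ?f = "\<lambda>ts zs i. zs ! i * ((if i = 0 then 0 else snd (ts ! (i - 1)) * zs ! (i - 1)) + fst (ts ! i) * zs ! i +
      (if Suc i < length ts then snd (ts ! i) * zs ! Suc i else 0))"
  have "?f ((\<alpha>, \<beta>) # ts) (z # zs) (Suc i) = (if i = 0 then \<beta> * z * zs ! i else 0) + ?f ts zs i" for i
    by (cases i) (simp_all add: algebra_simps)
  hence "(\<Sum>i<length ((\<alpha>, \<beta>) # ts). ?f ((\<alpha>, \<beta>) # ts) (z # zs) i) = ?f ((\<alpha>, \<beta>) # ts) (z # zs) 0 +
      (\<Sum>i<?n. (if i = 0 then \<beta> * z * zs ! i else 0) + ?f ts zs i)"
    by (simp only: length_Cons sum.lessThan_Suc_shift)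
  also have "\<dots> = ?f ((\<alpha>, \<beta>) # ts) (z # zs) 0 + (if ?n = 0 then 0 else \<beta> * z * zs ! 0) + tqf ts zs"
    using 1 by (simp add: sum.distrib)
  finally show ?case using 1(2)
    by (cases zs) (auto simp: power2_eq_square algebra_simps)
qed auto

lemma tmat_quadratic:
  assumes "length zs = length ts"
  shows "vec_of_list zs \<bullet> (tmat ts *\<^sub>v vec_of_list zs) = tqf ts zs"
proof -
  let ?n = "length ts" and ?z = "vec_of_list zs"
  have d: "dim_vec ?z = ?n" using assms by simp
  have "dim_vec (tmat ts *\<^sub>v ?z) = ?n" by (simp add: tri_mat_def)
  hence "?z \<bullet> (tmat ts *\<^sub>v ?z) = (\<Sum>i<?n. ?z $ i * (tmat ts *\<^sub>v ?z) $ i)" by (rule ip_sum)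
  also have "\<dots> = tqf ts zs" unfolding tqf_index[OF assms]
    by (intro sum.cong refl) (simp add: tri_mat_mult_nth[OF d] vec_of_list_index del: index_mult_mat_vec)
  finally show ?thesis .
qed

lemma ip_vec_of_list: "vec_of_list zs \<bullet> vec_of_list zs = sum_list (map (\<lambda>z. z\<^sup>2) (zs :: real list))"
proof -
  have "vec_of_list zs \<bullet> vec_of_list zs = (\<Sum>i<length zs. zs ! i * zs ! i)"
    by (simp add: ip_sum vec_of_list_index)
  thus ?thesis by (simp add: sum_list_sum_nth atLeast0LessThan power2_eq_square)
qed

text \<open>
  Here \<open>c\<close> is what the elimination of the preceding row subtracts from the first pivot; completing
  the square in the first variable performs one step of \<open>pivots_pos\<close>.
\<close>

definition pivot_form :: "real \<Rightarrow> real \<Rightarrow> (real \<times> real) list \<Rightarrow> real list \<Rightarrow> real" where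
  "pivot_form \<mu> c ts zs = tqf ts zs - \<mu> * sum_list (map (\<lambda>z. z\<^sup>2) zs) - (case zs of [] \<Rightarrow> 0 | z # _ \<Rightarrow> c * z\<^sup>2)"

lemma pivot_form_Cons:
  assumes "d = \<alpha> - \<mu> - c" "d \<noteq> 0"
  shows "pivot_form \<mu> c ((\<alpha>, \<beta>) # ts) (z # zs) =
    d * (z + (case zs of [] \<Rightarrow> 0 | z' # _ \<Rightarrow> \<beta> * z' / d))\<^sup>2 + pivot_form \<mu> (\<beta> * \<beta> / d) ts zs"
proof -
  have \<alpha>: "\<alpha> = d + \<mu> + c" by (simp add: assms(1))
  show ?thesis using assms(2)
    by (cases zs) (auto simp: pivot_form_def \<alpha> field_simps power2_eq_square)
qed

text \<open>Completing squares writes the form as a sum of squares with positive pivots. If it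
  vanishes, the tail is zero by induction, and then the first square forces the head to be
  zero.\<close>

lemma pivots_pos_positive:
  assumes "result (pivots_pos \<mu> c ts)" "length zs = length ts"
  shows "0 \<le> pivot_form \<mu> c ts zs \<and> (pivot_form \<mu> c ts zs = 0 \<longrightarrow> (\<forall>z\<in>set zs. z = 0))"
  using assms
proof (induction ts arbitrary: c zs)
  case Nil
  thus ?case by (simp add: pivot_form_def)
next
  case (Cons t ts)
  obtain \<alpha> \<beta> where t: "t = (\<alpha>, \<beta>)" by (cases t)
  from Cons.prems obtain z ws where zs: "zs = z # ws" "length ws = length ts" by (cases zs) auto
  define d where "d = \<alpha> - \<mu> - c"
  from Cons.prems have d: "0 < d" and p: "result (pivots_pos \<mu> (\<beta> * \<beta> / d) ts)"
    by (auto simp: d_def t split: if_splits)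
  have IH: "0 \<le> pivot_form \<mu> (\<beta> * \<beta> / d) ts ws"
    "pivot_form \<mu> (\<beta> * \<beta> / d) ts ws = 0 \<Longrightarrow> \<forall>z\<in>set ws. z = 0"
    using Cons.IH[OF p zs(2)] by auto
  define q where "q = z + (case ws of [] \<Rightarrow> 0 | z' # _ \<Rightarrow> \<beta> * z' / d)"
  have eq: "pivot_form \<mu> c (t # ts) zs = d * q\<^sup>2 + pivot_form \<mu> (\<beta> * \<beta> / d) ts ws"
    using pivot_form_Cons[OF d_def] d unfolding zs t q_def by simp
  have nn: "0 \<le> d * q\<^sup>2" using d by simp
  show ?case
  proof (intro conjI impI)
    show "0 \<le> pivot_form \<mu> c (t # ts) zs" using eq nn IH(1) by simp
    assume "pivot_form \<mu> c (t # ts) zs = 0"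
    hence z: "d * q\<^sup>2 = 0" "pivot_form \<mu> (\<beta> * \<beta> / d) ts ws = 0" using eq nn IH(1) by linarith+
    from IH(2)[OF z(2)] have w: "\<forall>z\<in>set ws. z = 0" .
    have "q = 0" using d z(1) by simp
    moreover have "q = z" using w by (cases ws) (auto simp: q_def)
    ultimately show "\<forall>z\<in>set zs. z = 0" using w zs by simp
  qed
qed

lemma tqf_zeros: "tqf ts (replicate k 0) = 0"
proof (induction k arbitrary: ts)
  case (Suc k)
  show ?case using Suc[of "tl ts"] by (cases ts, simp, cases k) auto
qed simp

text \<open>The direction is built backwards: the first unit vector at the failing pivot, and in
  each earlier row the coordinate that makes the completed square vanish.\<close>

lemma pivots_pos_nonpositive:
  assumes "\<not> result (pivots_pos \<mu> c ts)"
  shows "\<exists>zs. length zs = length ts \<and> (\<exists>z\<in>set zs. z \<noteq> 0) \<and> pivot_form \<mu> c ts zs \<le> 0"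
  using assms
proof (induction ts arbitrary: c)
  case (Cons t ts)
  obtain \<alpha> \<beta> where t: "t = (\<alpha>, \<beta>)" by (cases t)
  define d where "d = \<alpha> - \<mu> - c"
  show ?case
  proof (cases "0 < d")
    case False
    have "pivot_form \<mu> c (t # ts) (1 # replicate (length ts) 0) = d"
      by (cases "length ts") (auto simp: pivot_form_def d_def t tqf_zeros[of _ "Suc _", simplified] tqf_zeros[of _ 0, simplified] sum_list_replicate)
    thus ?thesis using False by (intro exI[of _ "1 # replicate (length ts) 0"]) auto
  next
    case True
    hence "\<not> result (pivots_pos \<mu> (\<beta> * \<beta> / d) ts)" using Cons.prems by (simp add: d_def t)
    from Cons.IH[OF this]
    obtain zs where zs: "length zs = length ts" "\<exists>z\<in>set zs. z \<noteq> 0" "pivot_form \<mu> (\<beta> * \<beta> / d) ts zs \<le> 0"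
      by blast
    let ?z = "- (case zs of [] \<Rightarrow> 0 | z' # _ \<Rightarrow> \<beta> * z' / d)"
    have "pivot_form \<mu> c (t # ts) (?z # zs) = pivot_form \<mu> (\<beta> * \<beta> / d) ts zs"
      using pivot_form_Cons[OF d_def, of \<beta> ts ?z zs] True by (simp add: t)
    thus ?thesis using zs by (intro exI[of _ "?z # zs"]) auto
  qed
qed simp

text \<open>Each eigenvector tests its own eigenvalue. Conversely, a nonzero direction of
  nonpositive value is incompatible with the spectral expansion when all \<theta> i - \<mu> are
  positive.\<close>

lemma pivots_pos_iff:
  assumes e: "eigenbasis (length ts) (tmat ts) e \<theta>"
  shows "result (pivots_pos \<mu> 0 ts) \<longleftrightarrow> (\<forall>i<length ts. \<mu> < \<theta> i)"
proof -
  let ?n = "length ts"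
  note T = tri_mat_carrier[of ?n "\<lambda>i. fst (ts ! i)" "\<lambda>i. snd (ts ! i)"] tri_mat_sym[of ?n "\<lambda>i. fst (ts ! i)" "\<lambda>i. snd (ts ! i)"]
  have pf: "pivot_form \<mu> 0 ts zs = (\<Sum>i<?n. (\<theta> i - \<mu>) * (e i \<bullet> vec_of_list zs)\<^sup>2)" if "length zs = ?n" for zs
  proof -
    have d: "dim_vec (vec_of_list zs) = ?n" using that by simp
    have "pivot_form \<mu> 0 ts zs = vec_of_list zs \<bullet> (tmat ts *\<^sub>v vec_of_list zs) - \<mu> * (vec_of_list zs \<bullet> vec_of_list zs)"
      using that by (simp add: pivot_form_def tmat_quadratic ip_vec_of_list split: list.split)
    thus ?thesis unfolding eigenbasis_bilinear[OF T e d d] eigenbasis_norm[OF T e d]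
      by (simp add: sum_distrib_left sum_subtractf[symmetric] algebra_simps power2_eq_square)
  qed
  show ?thesis
  proof (intro iffI allI impI)
    fix i assume p: "result (pivots_pos \<mu> 0 ts)" and i: "i < ?n"
    have on: "dim_vec (e l) = ?n" "e l \<bullet> e i = (if l = i then 1 else 0)" if "l < ?n" for l
      using e i that by (auto simp: eigenbasis_def orthonormal_def)
    let ?z = "list_of_vec (e i)"
    have z: "length ?z = ?n" "vec_of_list ?z = e i" using on[OF i] by (auto simp: vec_list)
    have "pivot_form \<mu> 0 ts ?z = (\<Sum>l<?n. if l = i then \<theta> i - \<mu> else 0)"
      unfolding pf[OF z(1)] z(2) by (intro sum.cong) (auto simp: on)
    hence "pivot_form \<mu> 0 ts ?z = \<theta> i - \<mu>" using i by simp
    moreover have "\<not> (\<forall>z\<in>set ?z. z = 0)"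
    proof
      assume "\<forall>z\<in>set ?z. z = 0"
      hence "sum_list (map (\<lambda>z. z\<^sup>2) ?z) = 0" by (intro sum_list_nonneg_eq_0_iff[THEN iffD2]) auto
      hence "e i \<bullet> e i = 0" using ip_vec_of_list[of ?z] z(2) by simp
      thus False using on[OF i] by simp
    qed
    ultimately show "\<mu> < \<theta> i" using pivots_pos_positive[OF p z(1)] by auto
  next
    assume \<theta>: "\<forall>i<?n. \<mu> < \<theta> i"
    show "result (pivots_pos \<mu> 0 ts)"
    proof (rule ccontr)
      assume "\<not> ?thesis"
      from pivots_pos_nonpositive[OF this] obtain zs where zs: "length zs = ?n" "\<exists>z\<in>set zs. z \<noteq> 0" "pivot_form \<mu> 0 ts zs \<le> 0"
        by blast
      have "(\<Sum>i<?n. (\<theta> i - \<mu>) * (e i \<bullet> vec_of_list zs)\<^sup>2) = 0"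
        using zs(3) \<theta> unfolding pf[OF zs(1)] by (intro antisym sum_nonneg) (auto simp: less_imp_le)
      hence "\<forall>i\<in>{..<?n}. (\<theta> i - \<mu>) * (e i \<bullet> vec_of_list zs)\<^sup>2 = 0"
        using \<theta> by (subst (asm) sum_nonneg_eq_0_iff) (auto simp: less_imp_le)
      hence "e i \<bullet> vec_of_list zs = 0" if "i < ?n" for i using \<theta> that by force
      hence "vec_of_list zs = 0\<^sub>v ?n"
        by (intro orthonormal_complete[of ?n e]) (use e zs in \<open>auto simp: eigenbasis_def\<close>)
      hence "vec_of_list zs $ i = 0" if "i < ?n" for i using that by simp
      hence "zs ! i = 0" if "i < ?n" for i using that by (simp add: vec_of_list_index)
      thus False using zs(1,2) by (auto simp: in_set_conv_nth)
    qed
  qed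
qed

text \<open>Invariant: all eigenvalues exceed \<open>lo\<close> and some is at most
  \<open>hi\<close>. Strictness on the left keeps T - lo I positive definite, so that the
  elimination in inverse iteration has positive pivots.\<close>

lemma bisect_bounds:
  assumes e: "eigenbasis (length ts) (tmat ts) e \<theta>"
    and "\<And>i. i < length ts \<Longrightarrow> lo < \<theta> i" "\<exists>i<length ts. \<theta> i \<le> hi"
  shows "(\<forall>i<length ts. result (bisect ts m lo hi) < \<theta> i) \<and>
    (\<exists>i<length ts. \<theta> i \<le> result (bisect ts m lo hi) + (hi - lo) / 2 ^ m)"
  using assms(2,3)
proof (induction m arbitrary: lo hi)
  case (Suc m)
  define mid where "mid = (lo + hi) / 2"
  have half: "(hi - lo) / 2 ^ Suc m = (hi - mid) / 2 ^ m" "(hi - lo) / 2 ^ Suc m = (mid - lo) / 2 ^ m"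
    by (simp_all add: mid_def field_simps)
  show ?case
  proof (cases "result (pivots_pos mid 0 ts)")
    case True
    thus ?thesis using Suc.IH[of mid hi] Suc.prems pivots_pos_iff[OF e, of mid]
      by (simp add: half(1) flip: mid_def del: power_Suc)
  next
    case False
    hence "\<exists>i<length ts. \<theta> i \<le> mid" using pivots_pos_iff[OF e, of mid] by (auto simp: not_less)
    thus ?thesis using Suc.IH[of lo mid] Suc.prems False
      by (simp add: half(2) flip: mid_def del: power_Suc)
  qed
qed auto

text \<open>
  \<open>us\<close> solves \<open>(T - \<mu> I) us = ws\<close>, where \<open>q\<close> is the contribution of the variable preceding \<open>us\<close> to the
  first row.
\<close>

fun tri_sol :: "real \<Rightarrow> real \<Rightarrow> (real \<times> real) list \<Rightarrow> real list \<Rightarrow> real list \<Rightarrow> bool" where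
  "tri_sol \<mu> q ((\<alpha>, \<beta>) # ts) (u # us) (w # ws) \<longleftrightarrow>
     q + (\<alpha> - \<mu>) * u + (case us of [] \<Rightarrow> 0 | u' # _ \<Rightarrow> \<beta> * u') = w \<and> tri_sol \<mu> (\<beta> * u) ts us ws"
| "tri_sol \<mu> q ts us ws \<longleftrightarrow> ts = [] \<and> us = [] \<and> ws = []"

lemma length_tri_solve: "length ws = length ts \<Longrightarrow> length (result (tri_solve \<mu> c e ts ws)) = length ts"
  by (induction \<mu> c e ts ws rule: tri_solve.induct) auto

text \<open>Back substitution expresses the preceding unknown by the current one, and its
  contribution to the current row is \<open>e - c * u\<close>. The value \<open>e\<close> in the
  empty case makes this contribution 0.\<close>

lemma tri_solve_correct:
  assumes "result (pivots_pos \<mu> c ts)" "length ws = length ts"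
  shows "tri_sol \<mu> (e - (case result (tri_solve \<mu> c e ts ws) of [] \<Rightarrow> e | u # _ \<Rightarrow> c * u)) ts (result (tri_solve \<mu> c e ts ws)) ws"
  using assms
proof (induction ts arbitrary: c e ws)
  case (Cons t ts)
  obtain \<alpha> \<beta> where t: "t = (\<alpha>, \<beta>)" by (cases t)
  from Cons.prems obtain w vs where ws: "ws = w # vs" "length vs = length ts" by (cases ws) auto
  define d where "d = \<alpha> - \<mu> - c"
  have \<alpha>: "\<alpha> = d + \<mu> + c" by (simp add: d_def)
  from Cons.prems have d: "0 < d" and p: "result (pivots_pos \<mu> (\<beta> * \<beta> / d) ts)"
    by (auto simp: d_def t split: if_splits)
  define us where "us = result (tri_solve \<mu> (\<beta> * \<beta> / d) (\<beta> * (w - e) / d) ts vs)"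
  define u where "u = (w - e - (case us of [] \<Rightarrow> 0 | u' # _ \<Rightarrow> \<beta> * u')) / d"
  have res: "result (tri_solve \<mu> c e (t # ts) ws) = u # us"
    by (simp add: t ws d_def us_def u_def split: list.split)
  have len: "length us = length ts" using length_tri_solve[OF ws(2)] by (simp add: us_def)
  have IH: "tri_sol \<mu> (\<beta> * (w - e) / d - (case us of [] \<Rightarrow> \<beta> * (w - e) / d | u # _ \<Rightarrow> \<beta> * \<beta> / d * u)) ts us vs"
    using Cons.IH[OF p ws(2)] unfolding us_def .
  have "tri_sol \<mu> (\<beta> * u) ts us vs"
  proof (cases us)
    case Nil
    thus ?thesis using len ws(2) by simp
  next
    case (Cons u' us')
    have "\<beta> * (w - e) / d - \<beta> * \<beta> / d * u' = \<beta> * u" using d Cons by (simp add: u_def field_simps)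
    thus ?thesis using IH Cons by simp
  qed
  moreover have "d * u = w - e - (case us of [] \<Rightarrow> 0 | u' # _ \<Rightarrow> \<beta> * u')" using d by (simp add: u_def)
  ultimately show ?case unfolding res by (simp add: t ws \<alpha> algebra_simps)
qed simp

lemma tri_sol_nth:
  assumes "tri_sol \<mu> q ts us ws" "i < length ts"
  shows "(if i = 0 then q else snd (ts ! (i - 1)) * us ! (i - 1)) + (fst (ts ! i) - \<mu>) * us ! i +
    (if Suc i < length ts then snd (ts ! i) * us ! Suc i else 0) = ws ! i"
  using assms
proof (induction \<mu> q ts us ws arbitrary: i rule: tri_sol.induct)
  case (1 \<mu> q \<alpha> \<beta> ts u us w ws)
  have len: "length us = length ts" if "tri_sol \<mu> q ts us ws" for \<mu> q ts us ws
    using that by (induction \<mu> q ts us ws rule: tri_sol.induct) auto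
  from 1 have l: "length us = length ts" using len by auto
  show ?case
  proof (cases i)
    case 0
    thus ?thesis using 1 l by (cases us) auto
  next
    case (Suc k)
    thus ?thesis using "1.IH"[of k] "1.prems" by (cases k) auto
  qed
qed auto

section \<open>Inverse iteration in spectral coordinates\<close>

lemma tri_solve_ip:
  assumes e: "eigenbasis (length ts) (tmat ts) e \<theta>" and \<mu>: "\<And>i. i < length ts \<Longrightarrow> \<mu> < \<theta> i"
    and i: "i < length ts" and len: "length ws = length ts"
  shows "(\<theta> i - \<mu>) * (e i \<bullet> vec_of_list (result (tri_solve \<mu> 0 0 ts ws))) = e i \<bullet> vec_of_list ws"
proof -
  let ?n = "length ts"
  let ?us = "result (tri_solve \<mu> 0 0 ts ws)"
  have p: "result (pivots_pos \<mu> 0 ts)" using pivots_pos_iff[OF e] \<mu> by simp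
  have sol: "tri_sol \<mu> 0 ts ?us ws"
    using tri_solve_correct[OF p len, of 0] by (auto split: list.splits)
  have lu: "length ?us = ?n" by (rule length_tri_solve[OF len])
  have d: "dim_vec (vec_of_list ?us) = ?n" using lu by simp
  have de: "dim_vec (e i) = ?n" using e i by (auto simp: eigenbasis_def orthonormal_def)
  have "tmat ts *\<^sub>v vec_of_list ?us = vec_of_list ws + \<mu> \<cdot>\<^sub>v vec_of_list ?us"
  proof (rule eq_vecI)
    fix l assume "l < dim_vec (vec_of_list ws + \<mu> \<cdot>\<^sub>v vec_of_list ?us)"
    hence l: "l < ?n" using d by simp
    show "(tmat ts *\<^sub>v vec_of_list ?us) $ l = (vec_of_list ws + \<mu> \<cdot>\<^sub>v vec_of_list ?us) $ l"
    proof -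
      have "(vec_of_list ws + \<mu> \<cdot>\<^sub>v vec_of_list ?us) $ l = ws ! l + \<mu> * ?us ! l"
        using l by (simp add: vec_of_list_index lu len)
      thus ?thesis unfolding tri_mat_mult_nth[OF d l] vec_of_list_index
        using tri_sol_nth[OF sol l] unfolding left_diff_distrib by linarith
    qed
  qed (use d in \<open>simp add: tri_mat_def\<close>)
  hence "\<theta> i * (e i \<bullet> vec_of_list ?us) = e i \<bullet> (vec_of_list ws + \<mu> \<cdot>\<^sub>v vec_of_list ?us)"
    using eigenbasis_ip[OF tri_mat_carrier tri_mat_sym e i d] by simp
  thus ?thesis using d de len by (simp add: ip_simps algebra_simps)
qed

lemma length_inverse_iteration:
  "length z = length ts \<Longrightarrow> length (result (inverse_iteration \<mu> ts p z)) = length ts"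
  by (induction p arbitrary: z) (auto simp: length_tri_solve)

lemma inverse_iteration_ip:
  assumes e: "eigenbasis (length ts) (tmat ts) e \<theta>" and \<mu>: "\<And>i. i < length ts \<Longrightarrow> \<mu> < \<theta> i"
    and i: "i < length ts" and len: "length z = length ts"
  shows "(\<theta> i - \<mu>) ^ p * (e i \<bullet> vec_of_list (result (inverse_iteration \<mu> ts p z))) = e i \<bullet> vec_of_list z"
  using len
proof (induction p arbitrary: z)
  case (Suc p)
  thus ?case using tri_solve_ip[OF e \<mu> i Suc.prems] Suc.IH[of "result (tri_solve \<mu> 0 0 ts z)"]
    by (simp add: length_tri_solve mult.assoc)
qed simp

text \<open>Compare term by term. Indices with x i < \<eta> contribute at most - w i / \<eta>^p to
  the difference, those up to 2 \<eta> nothing positive, and the rest at most w i / (2 \<eta>)^p.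
  The total is at most (1 / 2^p - \<tau> / 2) / \<eta>^p, so a number of steps logarithmic in 1 /
  \<tau> suffices, whatever the spectral gap.\<close>

lemma inverse_power_weights:
  fixes x w :: "nat \<Rightarrow> real"
  assumes x: "\<And>i. i < j \<Longrightarrow> 0 < x i" and w: "\<And>i. i < j \<Longrightarrow> 0 \<le> w i" "(\<Sum>i<j. w i) = 1"
    and \<tau>: "\<tau> / 2 \<le> (\<Sum>i | i < j \<and> x i < \<eta>. w i)" "2 \<le> \<tau> * 2 ^ p" and \<eta>: "0 < \<eta>"
  shows "(\<Sum>i<j. w i / x i ^ p) \<le> 2 * \<eta> * (\<Sum>i<j. w i / x i ^ Suc p)"
proof -
  let ?S = "\<Sum>i | i < j \<and> x i < \<eta>. w i"
  have tm: "w i / x i ^ p - 2 * \<eta> * (w i / x i ^ Suc p) \<le>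
      (if x i < \<eta> then - (w i / \<eta> ^ p) else 0) + w i / (2 * \<eta>) ^ p" if i: "i < j" for i
  proof -
    have pos: "0 < x i" "0 \<le> w i" using x w i by auto
    have eq: "w i / x i ^ p - 2 * \<eta> * (w i / x i ^ Suc p) = w i / x i ^ p * (1 - 2 * \<eta> / x i)"
      using pos by (simp add: field_simps)
    have nn: "0 \<le> w i / (2 * \<eta>) ^ p" "0 \<le> w i / x i ^ p" using pos \<eta> by auto
    consider "x i < \<eta>" | "\<eta> \<le> x i" "x i \<le> 2 * \<eta>" | "2 * \<eta> < x i" by linarith
    thus ?thesis
    proof cases
      case 1
      have "1 - 2 * \<eta> / x i \<le> - 1" using 1 pos by (simp add: field_simps)
      hence "w i / x i ^ p * (1 - 2 * \<eta> / x i) \<le> w i / x i ^ p * (- 1)" using nn(2) by (intro mult_left_mono) auto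
      moreover have "w i / \<eta> ^ p \<le> w i / x i ^ p" using pos 1 by (intro divide_left_mono power_mono) auto
      ultimately show ?thesis using eq nn 1 by simp
    next
      case 2
      hence "1 - 2 * \<eta> / x i \<le> 0" using pos by (simp add: field_simps)
      hence "w i / x i ^ p * (1 - 2 * \<eta> / x i) \<le> 0" using nn(2) by (intro mult_nonneg_nonpos)
      thus ?thesis using eq nn 2 by simp
    next
      case 3
      have "w i / x i ^ p * (1 - 2 * \<eta> / x i) \<le> w i / x i ^ p * 1" using nn(2) pos \<eta> by (intro mult_left_mono) auto
      also have "\<dots> = w i / x i ^ p" by simp
      also have "\<dots> \<le> w i / (2 * \<eta>) ^ p" using pos 3 \<eta> power_mono[of "2 * \<eta>" "x i" p]
        by (intro divide_left_mono mult_pos_pos) auto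
      finally show ?thesis using eq 3 \<eta> by simp
    qed
  qed
  have "(\<Sum>i<j. w i / x i ^ p) - 2 * \<eta> * (\<Sum>i<j. w i / x i ^ Suc p) =
      (\<Sum>i<j. w i / x i ^ p - 2 * \<eta> * (w i / x i ^ Suc p))"
    by (simp only: sum_subtractf sum_distrib_left)
  also have "\<dots> \<le> (\<Sum>i<j. (if x i < \<eta> then - (w i / \<eta> ^ p) else 0) + w i / (2 * \<eta>) ^ p)"
    by (intro sum_mono tm) auto
  also have "\<dots> = - ?S / \<eta> ^ p + 1 / (2 * \<eta>) ^ p"
  proof -
    have "- ?S / \<eta> ^ p = (\<Sum>i\<in>{i\<in>{..<j}. x i < \<eta>}. - (w i / \<eta> ^ p))"
      unfolding sum_negf sum_divide_distrib[symmetric] by simp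
    also have "\<dots> = (\<Sum>i<j. if x i < \<eta> then - (w i / \<eta> ^ p) else 0)" by (rule sum.inter_filter) simp
    finally show ?thesis using w(2) by (simp add: sum.distrib sum_divide_distrib[symmetric])
  qed
  also have "\<dots> \<le> 0"
  proof -
    have "1 \<le> \<tau> / 2 * 2 ^ p" using \<tau>(2) by simp
    also have "\<dots> \<le> ?S * 2 ^ p" using \<tau>(1) by (intro mult_right_mono) auto
    finally show ?thesis using \<eta> by (simp add: field_simps power_mult_distrib)
  qed
  finally show ?thesis by simp
qed

section \<open>Row sums of the tridiagonal matrix\<close>

lemma tri_bound_row:
  "i < length ts \<Longrightarrow> (if i = 0 then \<bar>q\<bar> else \<bar>snd (ts ! (i - 1))\<bar>) + \<bar>fst (ts ! i)\<bar> + \<bar>snd (ts ! i)\<bar> \<le> result (tri_bound q ts)"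
proof (induction q ts arbitrary: i rule: tri_bound.induct)
  case (2 b \<alpha> \<beta> ts)
  thus ?case
  proof (cases i)
    case (Suc k)
    thus ?thesis using 2(1)[of k] 2(2) by (cases k) (auto simp: le_max_iff_disj)
  qed simp
qed simp

lemma tri_bound_le:
  assumes "\<bar>q\<bar> \<le> B" "\<And>t. t \<in> set ts \<Longrightarrow> \<bar>fst t\<bar> \<le> B \<and> \<bar>snd t\<bar> \<le> B"
  shows "result (tri_bound q ts) \<le> 3 * B \<and> 0 \<le> result (tri_bound q ts)"
  using assms
proof (induction q ts rule: tri_bound.induct)
  case (2 b \<alpha> \<beta> ts)
  have b: "\<bar>\<alpha>\<bar> \<le> B" "\<bar>\<beta>\<bar> \<le> B" "\<bar>b\<bar> \<le> B" using 2(2) 2(3)[of "(\<alpha>, \<beta>)"] by auto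
  have "result (tri_bound \<beta> ts) \<le> 3 * B \<and> 0 \<le> result (tri_bound \<beta> ts)"
    using 2(1)[OF b(2)] 2(3) by simp
  thus ?case using b by simp
qed simp

section \<open>Correctness of the Lanczos recurrence\<close>

abbreviation "orthonormal_list n vs \<equiv> orthonormal n (length vs) ((!) vs)"

lemma orthonormal_list_snoc:
  assumes "orthonormal_list n hs" "dim_vec v = n" "v \<bullet> v = 1" "\<And>h. h \<in> set hs \<Longrightarrow> h \<bullet> v = 0"
  shows "orthonormal_list n (hs @ [v])"
proof -
  have "orthonormal n (Suc (length hs)) (((!) hs)(length hs := v))"
    by (rule orthonormal_Suc[OF assms(1-3)]) (use assms(4) in auto)
  moreover have "(((!) hs)(length hs := v)) i = (hs @ [v]) ! i" if "i < Suc (length hs)" for i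
    using that by (auto simp: nth_append)
  ultimately show ?thesis by (simp add: orthonormal_def)
qed

lemma orthonormal_list_mem:
  assumes "orthonormal_list n hs" "h \<in> set hs"
  shows "dim_vec h = n" "h \<bullet> h = 1"
  using assms by (auto simp: orthonormal_def in_set_conv_nth)

lemma orthonormal_list_last:
  assumes "orthonormal_list n (hs @ [v])" "h \<in> set hs"
  shows "h \<bullet> v = 0"
proof -
  obtain i where i: "i < length hs" "hs ! i = h" using assms(2) by (auto simp: in_set_conv_nth)
  hence "(hs @ [v]) ! i \<bullet> (hs @ [v]) ! length hs = 0"
    using assms(1) unfolding orthonormal_def by (auto simp del: nth_append_length)
  thus ?thesis using i by (simp add: nth_append)
qed

text \<open>
  In a run, \<open>hs\<close> is the list of earlier Lanczos vectors and \<open>p\<close> its last element (or 0 initially).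
  The quantification over \<open>y\<close> says that \<open>Q h\<close> and \<open>p\<close> lie in the span of \<open>hs @ [v]\<close> and \<open>hs\<close>, respectively.
\<close>

lemma lanczos_invariant:
  assumes Q: "Q \<in> carrier_mat n n" "transpose_mat Q = Q"
    and "orthonormal_list n (hs @ [v])" "dim_vec p = n"
    and "\<And>h. h \<in> set hs \<Longrightarrow> (Q *\<^sub>v h) \<bullet> v = \<beta> * (h \<bullet> p)"
    and "\<And>h y. h \<in> set hs \<Longrightarrow> dim_vec y = n \<Longrightarrow> \<forall>z\<in>set (hs @ [v]). z \<bullet> y = 0 \<Longrightarrow> (Q *\<^sub>v h) \<bullet> y = 0"
    and "\<And>y. dim_vec y = n \<Longrightarrow> \<forall>z\<in>set hs. z \<bullet> y = 0 \<Longrightarrow> p \<bullet> y = 0"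
    and "0 < k" and rs: "rs = result (lanczos Q k p \<beta> v)"
  shows "\<exists>r. orthonormal_list n (hs @ basis rs) \<and> rs \<noteq> [] \<and> length rs \<le> k \<and> basis rs ! 0 = v \<and>
    dim_vec r = n \<and> (length rs = k \<or> r = 0\<^sub>v n) \<and> snd (tridiag rs ! (length rs - 1)) = vnorm r \<and>
    (\<forall>z\<in>set (hs @ basis rs). z \<bullet> r = 0) \<and>
    (\<forall>l<length rs. \<forall>y. dim_vec y = n \<longrightarrow> (Q *\<^sub>v basis rs ! l) \<bullet> y =
      (if l = 0 then \<beta> * (p \<bullet> y) else snd (tridiag rs ! (l - 1)) * (basis rs ! (l - 1) \<bullet> y)) +
      fst (tridiag rs ! l) * (basis rs ! l \<bullet> y) +
      (if Suc l < length rs then snd (tridiag rs ! l) * (basis rs ! Suc l \<bullet> y) else r \<bullet> y))"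
  using assms(3-)
proof (induction k arbitrary: hs p \<beta> v rs)
  case (Suc k)
  note on = Suc.prems(1) and p = Suc.prems(2) and Qh = Suc.prems(3) and Qy = Suc.prems(4) and py = Suc.prems(5)
  have dQ [simp]: "dim_row Q = n" using Q by auto
  have v: "dim_vec v = n" "v \<bullet> v = 1" using orthonormal_list_mem[OF on, of v] by auto
  have hd: "dim_vec h = n" if "h \<in> set hs" for h using orthonormal_list_mem[OF on, of h] that by auto
  have hv: "h \<bullet> v = 0" if "h \<in> set hs" for h using orthonormal_list_last[OF on that] .
  define w' where "w' = (- \<beta>) \<cdot>\<^sub>v p + Q *\<^sub>v v"
  define \<alpha> where "\<alpha> = v \<bullet> w'"
  define r where "r = (- \<alpha>) \<cdot>\<^sub>v v + w'"
  define \<beta>' where "\<beta>' = vnorm r"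
  have dr: "dim_vec r = n" "dim_vec w' = n" by (auto simp: r_def w'_def)
  have vr: "v \<bullet> r = 0" using v dr p by (simp add: r_def ip_simps \<alpha>_def)
  \<comment> \<open>Only \<open>p\<close> and \<open>v\<close> are subtracted, yet \<open>r\<close>
    is orthogonal to all earlier vectors: by symmetry h \<bullet> Q v is (Q h) \<bullet> v, which
    the invariant gives as \<beta> times h \<bullet> p.\<close>
  have hr: "h \<bullet> r = 0" if "h \<in> set hs" for h
  proof -
    have "h \<bullet> (Q *\<^sub>v v) = \<beta> * (h \<bullet> p)" using Qh[OF that] symmetric_ip[OF Q hd[OF that] v(1)] by simp
    thus ?thesis using hv[OF that] hd[OF that] v p dr by (simp add: r_def w'_def ip_simps)
  qed
  have Qv: "(Q *\<^sub>v v) \<bullet> y = \<beta> * (p \<bullet> y) + \<alpha> * (v \<bullet> y) + r \<bullet> y" if "dim_vec y = n" for y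
    using that v p by (simp add: r_def w'_def ip_simps)
  have perp: "\<forall>z\<in>set (hs @ [v]). z \<bullet> r = 0" using hr vr by auto
  have step: "result (lanczos Q (Suc k) p \<beta> v) = (if \<beta>' = 0 then [(\<alpha>, \<beta>', v)]
      else (\<alpha>, \<beta>', v) # result (lanczos Q k v \<beta>' ((1 / \<beta>') \<cdot>\<^sub>v r)))"
    by (simp add: t_matvec_def t_axpy_def t_dot_def t_norm_def t_scale_def r_def w'_def \<alpha>_def \<beta>'_def)
  consider "\<beta>' = 0" | "\<beta>' \<noteq> 0" "k = 0" | "\<beta>' \<noteq> 0" "0 < k" by blast
  thus ?case
  proof cases
    case 1
    hence r0: "r = 0\<^sub>v n" using dr ip_self_eq_0[of r] by (simp add: \<beta>'_def vnorm_eq_0)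
    have rs: "rs = [(\<alpha>, \<beta>', v)]" using Suc.prems(7) step 1 by simp
    show ?thesis
      by (rule exI[of _ r]) (use on perp dr Qv r0 in \<open>auto simp: rs basis_def tridiag_def \<beta>'_def\<close>)
  next
    case 2
    have rs: "rs = [(\<alpha>, \<beta>', v)]" using Suc.prems(7) step 2 by (simp add: ret_def)
    show ?thesis
      by (rule exI[of _ r]) (use on perp dr Qv 2 in \<open>auto simp: rs basis_def tridiag_def \<beta>'_def\<close>)
  next
    case 3
    define v' where "v' = (1 / \<beta>') \<cdot>\<^sub>v r"
    define rs' where "rs' = result (lanczos Q k v \<beta>' v')"
    have rs: "rs = (\<alpha>, \<beta>', v) # rs'" using Suc.prems(7) step 3 by (simp add: v'_def rs'_def)
    have b2: "\<beta>' * \<beta>' = r \<bullet> r" using vnorm_sq[of r] by (simp add: \<beta>'_def power2_eq_square)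
    have v': "dim_vec v' = n" "v' \<bullet> v' = 1" using dr 3 b2 by (auto simp: v'_def ip_simps field_simps)
    have rv': "r = \<beta>' \<cdot>\<^sub>v v'" using 3 by (intro eq_vecI) (auto simp: v'_def)
    have pv': "z \<bullet> v' = 0" if "z \<in> set (hs @ [v])" for z
      using that perp hd v dr by (auto simp: v'_def ip_simps)
    have ry: "r \<bullet> y = \<beta>' * (v' \<bullet> y)" if "dim_vec y = n" for y
      using that v' by (subst rv') (simp add: ip_simps)
    have on': "orthonormal_list n ((hs @ [v]) @ [v'])"
      by (rule orthonormal_list_snoc[OF on v']) (rule pv')
    \<comment> \<open>For h older than \<open>v\<close>, Q h lies in the span of
      \<open>hs @ [v]\<close>, to which \<open>v'\<close> is orthogonal. Only \<open>v\<close>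
      couples to \<open>v'\<close>, which keeps the recurrence short.\<close>
    have A: "(Q *\<^sub>v h) \<bullet> v' = \<beta>' * (h \<bullet> v)" if "h \<in> set (hs @ [v])" for h
    proof (cases "h \<in> set hs")
      case True
      thus ?thesis using Qy[OF True v'(1)] pv' hv by auto
    next
      case False
      hence h: "h = v" using that by simp
      have "p \<bullet> v' = 0" by (rule py[OF v'(1)]) (use pv' in auto)
      thus ?thesis using Qv[OF v'(1)] pv'[of v] ry[OF v'(1)] v v' h by simp
    qed
    have B: "(Q *\<^sub>v h) \<bullet> y = 0" if "h \<in> set (hs @ [v])" "dim_vec y = n" "\<forall>z\<in>set ((hs @ [v]) @ [v']). z \<bullet> y = 0" for h y
    proof (cases "h \<in> set hs")
      case True
      thus ?thesis using Qy[OF True that(2)] that(3) by auto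
    next
      case False
      hence h: "h = v" using that by simp
      have "p \<bullet> y = 0" by (rule py[OF that(2)]) (use that(3) in auto)
      thus ?thesis using Qv[OF that(2)] ry[OF that(2)] that(3) h by simp
    qed
    have C: "v \<bullet> y = 0" if "dim_vec y = n" "\<forall>z\<in>set (hs @ [v]). z \<bullet> y = 0" for y using that by simp
    obtain r' where r': "orthonormal_list n ((hs @ [v]) @ basis rs')" "rs' \<noteq> []" "length rs' \<le> k" "basis rs' ! 0 = v'"
      "dim_vec r' = n" "length rs' = k \<or> r' = 0\<^sub>v n" "snd (tridiag rs' ! (length rs' - 1)) = vnorm r'"
      "\<forall>z\<in>set ((hs @ [v]) @ basis rs'). z \<bullet> r' = 0"
      and rec: "\<And>l y. l < length rs' \<Longrightarrow> dim_vec y = n \<Longrightarrow> (Q *\<^sub>v basis rs' ! l) \<bullet> y =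
      (if l = 0 then \<beta>' * (v \<bullet> y) else snd (tridiag rs' ! (l - 1)) * (basis rs' ! (l - 1) \<bullet> y)) +
      fst (tridiag rs' ! l) * (basis rs' ! l \<bullet> y) +
      (if Suc l < length rs' then snd (tridiag rs' ! l) * (basis rs' ! Suc l \<bullet> y) else r' \<bullet> y)"
      using Suc.IH[OF on' v(1) A B C 3(2) rs'_def] by blast
    have bs: "basis rs = v # basis rs'" "tridiag rs = (\<alpha>, \<beta>') # tridiag rs'" "length rs = Suc (length rs')" by (simp_all add: rs basis_def tridiag_def)
    have rs_ne: "rs \<noteq> []" by (simp add: rs)
    have "(Q *\<^sub>v basis rs ! l) \<bullet> y =
      (if l = 0 then \<beta> * (p \<bullet> y) else snd (tridiag rs ! (l - 1)) * (basis rs ! (l - 1) \<bullet> y)) +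
      fst (tridiag rs ! l) * (basis rs ! l \<bullet> y) +
      (if Suc l < length rs then snd (tridiag rs ! l) * (basis rs ! Suc l \<bullet> y) else r' \<bullet> y)"
      if l: "l < length rs" and y: "dim_vec y = n" for l y
    proof (cases l)
      case 0
      thus ?thesis using Qv[OF y] ry[OF y] r'(2,4) by (simp add: bs)
    next
      case (Suc l')
      thus ?thesis using rec[of l' y] l y by (cases l') (simp_all add: bs)
    qed
    thus ?thesis using r' by (intro exI[of _ r']) (auto simp: bs nth_Cons' rs_ne)
  qed
qed simp

lemma length_basis [simp]: "length (basis rs) = length rs"
  by (simp add: basis_def)

lemma length_tridiag [simp]: "length (tridiag rs) = length rs"
  by (simp add: tridiag_def)

lemma lanczos_krylov:
  assumes Q: "Q \<in> carrier_mat n n" "transpose_mat Q = Q" and v: "dim_vec v = n" "v \<bullet> v = 1"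
    and k: "0 < K" "0 < n" and rs: "rs = result (lanczos Q (min n K) (0\<^sub>v n) 0 v)"
  obtains r where "krylov n (length rs) Q ((!) (basis rs)) (\<lambda>i. fst (tridiag rs ! i)) (\<lambda>i. snd (tridiag rs ! i)) r"
    "length rs = K \<or> r = 0\<^sub>v n" "basis rs ! 0 = v" "snd (tridiag rs ! (length rs - 1)) = vnorm r"
proof -
  have "orthonormal_list n ([] @ [v])" using v by (simp add: orthonormal_def)
  from lanczos_invariant[OF Q this _ _ _ _ _ rs]
  obtain r where r: "orthonormal_list n (basis rs)" "rs \<noteq> []" "length rs \<le> min n K" "basis rs ! 0 = v"
    "dim_vec r = n" "length rs = min n K \<or> r = 0\<^sub>v n" "snd (tridiag rs ! (length rs - 1)) = vnorm r"
    "\<forall>z\<in>set (basis rs). z \<bullet> r = 0"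
    and rec: "\<And>l y. l < length rs \<Longrightarrow> dim_vec y = n \<Longrightarrow> (Q *\<^sub>v basis rs ! l) \<bullet> y =
      (if l = 0 then 0 * (0\<^sub>v n \<bullet> y) else snd (tridiag rs ! (l - 1)) * (basis rs ! (l - 1) \<bullet> y)) +
      fst (tridiag rs ! l) * (basis rs ! l \<bullet> y) +
      (if Suc l < length rs then snd (tridiag rs ! l) * (basis rs ! Suc l \<bullet> y) else r \<bullet> y)"
    using v k by auto
  have perp: "basis rs ! l \<bullet> r = 0" if "l < length rs" for l using r(8) that by auto
  have "krylov n (length rs) Q ((!) (basis rs)) (\<lambda>i. fst (tridiag rs ! i)) (\<lambda>i. snd (tridiag rs ! i)) r"
  proof
    show "(Q *\<^sub>v basis rs ! l) \<bullet> y =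
      (if l = 0 then 0 else snd (tridiag rs ! (l - 1)) * (basis rs ! (l - 1) \<bullet> y)) +
      fst (tridiag rs ! l) * (basis rs ! l \<bullet> y) +
      (if Suc l < length rs then snd (tridiag rs ! l) * (basis rs ! Suc l \<bullet> y) else r \<bullet> y)"
      if "l < length rs" "dim_vec y = n" for l y using rec[OF that] by simp
  qed (use Q r perp in auto)
  \<comment> \<open>If the cap \<open>n\<close> ends the run, the \<open>n\<close> Lanczos vectors
    are complete and the residual vanishes. Hence the alternative can be stated with
    \<open>K\<close> instead of \<open>min n K\<close>.\<close>
  moreover have "length rs = K \<or> r = 0\<^sub>v n"
  proof (cases "length rs = n")
    case True
    have "orthonormal n n ((!) (basis rs))" using r(1) True by simp
    from orthonormal_complete[OF this r(5)] perp True show ?thesis by simp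
  qed (use r(6) in auto)
  ultimately show thesis using that r by blast
qed

context krylov
begin

lemma entry_bounds:
  assumes "0 < n" "eigenbasis n Q u \<mu>"
  shows "l < j \<Longrightarrow> \<bar>a l\<bar> \<le> spectral_norm Q" "Suc l < j \<Longrightarrow> \<bar>b l\<bar> \<le> spectral_norm Q" "vnorm r \<le> spectral_norm Q"
proof -
  note sn = spectral_norm_nonneg[OF Q assms(2,1)]
  have ip: "\<bar>x \<bullet> (Q *\<^sub>v v l)\<bar> \<le> spectral_norm Q * vnorm x" if "dim_vec x = n" "l < j" for x l
  proof -
    have "(x \<bullet> (Q *\<^sub>v v l))\<^sup>2 \<le> (x \<bullet> x) * ((Q *\<^sub>v v l) \<bullet> (Q *\<^sub>v v l))"
      by (rule cauchy_schwarz_vec[of _ n]) (use that in auto)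
    also have "\<dots> \<le> (x \<bullet> x) * ((spectral_norm Q)\<^sup>2 * (v l \<bullet> v l))"
      by (intro mult_left_mono mult_norm_le[OF Q assms(2,1)]) (use that in auto)
    also have "\<dots> = (spectral_norm Q * vnorm x)\<^sup>2"
      using on that by (simp add: orthonormal_def power_mult_distrib)
    finally have "\<bar>x \<bullet> (Q *\<^sub>v v l)\<bar> \<le> \<bar>spectral_norm Q * vnorm x\<bar>" by (simp only: abs_le_square_iff)
    thus ?thesis using sn by simp
  qed
  have vv: "vnorm (v l) = 1" if "l < j" for l using on that by (simp add: vnorm_def orthonormal_def)
  show "\<bar>a l\<bar> \<le> spectral_norm Q" if "l < j"
    using ip[of "v l" l] T_tridiagonal[of l l] T_nth[of l l] vv that by simp
  show "\<bar>b l\<bar> \<le> spectral_norm Q" if "Suc l < j"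
    using ip[of "v l" "Suc l"] T_tridiagonal[of l "Suc l"] T_nth[of l "Suc l"] vv that by simp
  have l: "j - 1 < j" "\<not> Suc (j - 1) < j" "j - 1 - 1 < j" using j by auto
  \<comment> \<open>Tested against \<open>r\<close>, the last row of the recurrence leaves only r
    \<bullet> r, so Cauchy-Schwarz bounds the residual norm like the matrix entries.\<close>
  have "r \<bullet> (Q *\<^sub>v v (j - 1)) = (Q *\<^sub>v v (j - 1)) \<bullet> r" using r(1) by (intro ip_comm) simp
  also have "\<dots> = r \<bullet> r" unfolding rec[OF l(1) r(1)] using l(2) r(2)[OF l(1)] r(2)[OF l(3)] by simp
  finally have "r \<bullet> (Q *\<^sub>v v (j - 1)) = r \<bullet> r" .
  hence "vnorm r * vnorm r \<le> spectral_norm Q * vnorm r"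
    using ip[OF r(1) l(1)] vnorm_sq[of r] by (simp add: power2_eq_square)
  moreover have "0 < vnorm r \<or> vnorm r = 0" using vnorm_nonneg[of r] by linarith
  ultimately show "vnorm r \<le> spectral_norm Q" using sn by auto
qed

end

section \<open>Accelerated projected gradient descent\<close>

lemma dim_proj_ball [simp]: "dim_vec (result (proj_ball u)) = dim_vec u"
  by (simp add: proj_ball_def t_norm_def t_scale_def)

lemma proj_ball_le_1: "result (proj_ball u) \<bullet> result (proj_ball u) \<le> 1"
proof (cases "vnorm u \<le> 1")
  case True
  thus ?thesis by (simp add: proj_ball_def t_norm_def t_scale_def vnorm_le_1)
next
  case False
  hence "u \<bullet> u = vnorm u * vnorm u" "vnorm u \<noteq> 0" using vnorm_sq[of u] by (auto simp: power2_eq_square)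
  thus ?thesis using False by (simp add: proj_ball_def t_norm_def t_scale_def)
qed

text \<open>The obtuse angle criterion (u - p) \<bullet> (w - p) \<le> 0, expanded. For
  \<open>u\<close> of norm r > 1 it equals (1 - 1 / r) (u \<bullet> w - r), which is nonpositive by
  Cauchy-Schwarz.\<close>

lemma proj_ball_variational:
  assumes "dim_vec u = n" "dim_vec w = n" "w \<bullet> w \<le> 1"
  defines "p \<equiv> result (proj_ball u)"
  shows "u \<bullet> w - u \<bullet> p - p \<bullet> w + p \<bullet> p \<le> 0"
proof (cases "vnorm u \<le> 1")
  case True
  thus ?thesis by (simp add: p_def proj_ball_def t_norm_def t_scale_def)
next
  case False
  define r where "r = vnorm u"
  have r: "1 < r" "u \<bullet> u = r * r" using False vnorm_sq[of u] by (auto simp: r_def power2_eq_square)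
  have "(u \<bullet> w)\<^sup>2 \<le> (u \<bullet> u) * (w \<bullet> w)" using assms by (intro cauchy_schwarz_vec)
  also have "\<dots> \<le> (u \<bullet> u) * 1" using assms(3) by (intro mult_left_mono) auto
  finally have "(u \<bullet> w)\<^sup>2 \<le> r\<^sup>2" using r by (simp add: power2_eq_square)
  hence "\<bar>u \<bullet> w\<bar> \<le> \<bar>r\<bar>" by (simp only: abs_le_square_iff)
  hence "u \<bullet> w \<le> r" using r by simp
  hence "(1 - 1 / r) * (u \<bullet> w - r) \<le> 0" using r by (intro mult_nonneg_nonpos) auto
  moreover have p: "p = (1 / r) \<cdot>\<^sub>v u"
    using False by (simp add: p_def proj_ball_def t_norm_def t_scale_def r_def)
  ultimately show ?thesis using r assms(1,2) by (simp add: ip_simps field_simps)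
qed

text \<open>The convex objective without its additive constant \<gamma>, which cancels in all
  differences.\<close>

definition shifted_obj :: "real mat \<Rightarrow> real vec \<Rightarrow> real \<Rightarrow> real vec \<Rightarrow> real" where
  "shifted_obj Q g \<gamma> y = y \<bullet> (Q *\<^sub>v y) - \<gamma> * (y \<bullet> y) + 2 * (g \<bullet> y)"

text \<open>The quadratic form is half the Hessian, so \<open>L / 2\<close> in \<open>smooth\<close>
  corresponds to the Lipschitz constant \<open>L\<close> of the gradient.\<close>

locale trs_convex =
  fixes n :: nat and Q :: "real mat" and g :: "real vec" and \<gamma> L :: real
  assumes Q: "Q \<in> carrier_mat n n" "transpose_mat Q = Q" and g: "dim_vec g = n" and L: "0 < L"
    and convex: "\<And>y. dim_vec y = n \<Longrightarrow> 0 \<le> y \<bullet> (Q *\<^sub>v y) - \<gamma> * (y \<bullet> y)"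
    and smooth: "\<And>y. dim_vec y = n \<Longrightarrow> y \<bullet> (Q *\<^sub>v y) - \<gamma> * (y \<bullet> y) \<le> L / 2 * (y \<bullet> y)"
begin

abbreviation "F \<equiv> shifted_obj Q g \<gamma>"

lemma dQ [simp]: "dim_row Q = n" "dim_col Q = n"
  using Q by auto

lemma Q_add: "dim_vec x = n \<Longrightarrow> dim_vec y = n \<Longrightarrow> Q *\<^sub>v (x + y) = Q *\<^sub>v x + Q *\<^sub>v y"
  using Q by (intro mult_add_distrib_mat_vec) auto

lemma Q_smult: "dim_vec x = n \<Longrightarrow> Q *\<^sub>v (c \<cdot>\<^sub>v x) = c \<cdot>\<^sub>v (Q *\<^sub>v x)"
  using Q by (intro mult_mat_vec) auto

lemma Q_diff: "dim_vec x = n \<Longrightarrow> dim_vec y = n \<Longrightarrow> Q *\<^sub>v (x - y) = Q *\<^sub>v x - Q *\<^sub>v y"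
  using Q by (intro mult_minus_distrib_mat_vec) auto

lemma Q_sym: "dim_vec x = n \<Longrightarrow> dim_vec y = n \<Longrightarrow> y \<bullet> (Q *\<^sub>v x) = x \<bullet> (Q *\<^sub>v y)"
  using symmetric_ip[OF Q, of x y] by (simp add: ip_comm)

text \<open>Half the gradient, written exactly as \<open>agd\<close> computes it.\<close>

definition grad :: "real vec \<Rightarrow> real vec" where
  "grad y = 1 \<cdot>\<^sub>v g + ((- \<gamma>) \<cdot>\<^sub>v y + Q *\<^sub>v y)"

lemma dim_grad [simp]: "dim_vec (grad y) = n"
  by (simp add: grad_def)

lemma F_expand:
  assumes "dim_vec y = n" "dim_vec w = n"
  shows "F w = F y + 2 * (grad y \<bullet> (w - y)) + ((w - y) \<bullet> (Q *\<^sub>v (w - y)) - \<gamma> * ((w - y) \<bullet> (w - y)))"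
proof -
  have c: "w \<bullet> (Q *\<^sub>v y) = y \<bullet> (Q *\<^sub>v w)" "(Q *\<^sub>v y) \<bullet> w = y \<bullet> (Q *\<^sub>v w)" "(Q *\<^sub>v y) \<bullet> y = y \<bullet> (Q *\<^sub>v y)" "w \<bullet> y = y \<bullet> w"
    using assms Q_sym symmetric_ip[OF Q] by (auto intro: ip_comm)
  show ?thesis using assms g unfolding grad_def shifted_obj_def
    by (simp add: ip_simps Q_diff c algebra_simps)
qed

text \<open>Three-point inequality: convexity bounds \<open>F w\<close> from below by the
  linearization at \<open>y\<close>, smoothness bounds \<open>F x'\<close> from above, and the
  projection compares the linear terms.\<close>

lemma proj_step:
  assumes y: "dim_vec y = n" and w: "dim_vec w = n" "w \<bullet> w \<le> 1"
    and x': "x' = result (proj_ball ((- (2 / L)) \<cdot>\<^sub>v grad y + y))"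
  shows "F x' + L / 2 * ((x' - w) \<bullet> (x' - w)) \<le> F w + L / 2 * ((y - w) \<bullet> (y - w))"
proof -
  let ?u = "(- (2 / L)) \<cdot>\<^sub>v grad y + y"
  have dx: "dim_vec x' = n" using y by (simp add: x')
  have "?u \<bullet> w - ?u \<bullet> x' - x' \<bullet> w + x' \<bullet> x' \<le> 0"
    unfolding x' by (rule proj_ball_variational[of _ n]) (use y w in auto)
  moreover have "?u \<bullet> w = y \<bullet> w - 2 / L * (grad y \<bullet> w)" "?u \<bullet> x' = y \<bullet> x' - 2 / L * (grad y \<bullet> x')"
    using y w dx by (simp_all add: ip_simps)
  ultimately have "y \<bullet> w - y \<bullet> x' - x' \<bullet> w + x' \<bullet> x' \<le> 2 / L * (grad y \<bullet> w - grad y \<bullet> x')"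
    by (simp add: algebra_simps)
  hence "L * (y \<bullet> w - y \<bullet> x' - x' \<bullet> w + x' \<bullet> x') \<le> L * (2 / L * (grad y \<bullet> w - grad y \<bullet> x'))"
    using L by (intro mult_left_mono) auto
  hence pr: "L * (y \<bullet> w - y \<bullet> x' - x' \<bullet> w + x' \<bullet> x') \<le> 2 * (grad y \<bullet> w - grad y \<bullet> x')"
    using L by simp
  have 1: "F w \<ge> F y + 2 * (grad y \<bullet> w - grad y \<bullet> y)"
    using F_expand[OF y w(1)] convex[of "w - y"] y w by (simp add: ip_diff_right)
  have 2: "F x' \<le> F y + 2 * (grad y \<bullet> x' - grad y \<bullet> y) + L / 2 * ((x' - y) \<bullet> (x' - y))"
    using F_expand[OF y dx] smooth[of "x' - y"] y dx by (simp add: ip_diff_right)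
  have 3: "(x' - y) \<bullet> (x' - y) = x' \<bullet> x' - 2 * (y \<bullet> x') + y \<bullet> y"
    "(x' - w) \<bullet> (x' - w) = x' \<bullet> x' - 2 * (x' \<bullet> w) + w \<bullet> w"
    "(y - w) \<bullet> (y - w) = y \<bullet> y - 2 * (y \<bullet> w) + w \<bullet> w"
    using y w dx ip_comm[of x' y] ip_comm[of w x'] ip_comm[of w y] by (simp_all add: ip_simps)
  have "F x' - F w \<le> L / 2 * (x' \<bullet> x' - 2 * (y \<bullet> x') + y \<bullet> y) - L * (y \<bullet> w - y \<bullet> x' - x' \<bullet> w + x' \<bullet> x')"
  proof -
    define P where "P = L * (y \<bullet> w - y \<bullet> x' - x' \<bullet> w + x' \<bullet> x')"
    define R where "R = L / 2 * (x' \<bullet> x' - 2 * (y \<bullet> x') + y \<bullet> y)"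
    show ?thesis using 1 2 pr unfolding 3(1) P_def[symmetric] R_def[symmetric] by argo
  qed
  thus ?thesis unfolding 3 by (simp add: algebra_simps)
qed

text \<open>For a quadratic the convexity defect is exactly \<open>c * (1 - c)\<close> times the
  form at \<open>x - s\<close>. The same identity for the norm gives convexity of the ball.\<close>

lemma F_convex_comb:
  assumes x: "dim_vec x = n" and s: "dim_vec s = n" and c: "0 \<le> c" "c \<le> 1"
  shows "F ((1 - c) \<cdot>\<^sub>v x + c \<cdot>\<^sub>v s) \<le> (1 - c) * F x + c * F s"
proof -
  have comm: "s \<bullet> (Q *\<^sub>v x) = x \<bullet> (Q *\<^sub>v s)" "s \<bullet> x = x \<bullet> s" using x s Q_sym by (auto intro: ip_comm)
  have "(1 - c) * F x + c * F s - F ((1 - c) \<cdot>\<^sub>v x + c \<cdot>\<^sub>v s) =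
      c * (1 - c) * ((x - s) \<bullet> (Q *\<^sub>v (x - s)) - \<gamma> * ((x - s) \<bullet> (x - s)))"
    using x s g by (simp add: shifted_obj_def ip_simps Q_diff Q_add Q_smult comm algebra_simps)
  moreover have "0 \<le> c * (1 - c) * ((x - s) \<bullet> (Q *\<^sub>v (x - s)) - \<gamma> * ((x - s) \<bullet> (x - s)))"
    using convex[of "x - s"] c s by simp
  ultimately show ?thesis by linarith
qed

lemma ball_convex_comb:
  fixes x s :: "real vec"
  assumes x: "dim_vec x = n" "x \<bullet> x \<le> 1" and s: "dim_vec s = n" "s \<bullet> s \<le> 1" and c: "0 \<le> c" "c \<le> 1"
  defines "w \<equiv> (1 - c) \<cdot>\<^sub>v x + c \<cdot>\<^sub>v s"
  shows "w \<bullet> w \<le> 1"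
proof -
  have comm: "s \<bullet> x = x \<bullet> s" using x s by (auto intro: ip_comm)
  have "(1 - c) * (x \<bullet> x) + c * (s \<bullet> s) - w \<bullet> w = c * (1 - c) * ((x - s) \<bullet> (x - s))"
    using x s unfolding w_def by (simp add: ip_simps comm algebra_simps)
  moreover have "0 \<le> c * (1 - c) * ((x - s) \<bullet> (x - s))" using c by simp
  moreover have "(1 - c) * (x \<bullet> x) + c * (s \<bullet> s) \<le> (1 - c) * 1 + c * 1"
    using c x s by (intro add_mono mult_left_mono) auto
  ultimately show ?thesis by argo
qed

text \<open>Lyapunov function of the accelerated method; \<open>s\<close> is the competitor.\<close>

definition energy :: "real vec \<Rightarrow> real vec \<Rightarrow> real vec \<Rightarrow> real \<Rightarrow> real" where
  "energy s x y t = (t\<^sup>2 - t) * (F x - F s) +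
     L / 2 * ((t \<cdot>\<^sub>v y - ((t - 1) \<cdot>\<^sub>v x + s)) \<bullet> (t \<cdot>\<^sub>v y - ((t - 1) \<cdot>\<^sub>v x + s)))"

text \<open>The step is compared not with \<open>s\<close> but with the mixture (1 - 1 / t) x + s /
  t. After multiplication by t^2, squared distances from this point become the square in
  \<open>energy\<close>.\<close>

lemma energy_step:
  assumes x: "dim_vec x = n" "x \<bullet> x \<le> 1" and s: "dim_vec s = n" "s \<bullet> s \<le> 1" and y: "dim_vec y = n"
    and t: "1 \<le> t" and x': "x' = result (proj_ball ((- (2 / L)) \<cdot>\<^sub>v grad y + y))"
  defines "z \<equiv> t \<cdot>\<^sub>v x' - ((t - 1) \<cdot>\<^sub>v x + s)"
  shows "t\<^sup>2 * (F x' - F s) + L / 2 * (z \<bullet> z) \<le> energy s x y t"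
proof -
  define c where "c = 1 / t"
  have c: "0 \<le> c" "c \<le> 1" "t * c = 1" using t by (auto simp: c_def)
  define w where "w = (1 - c) \<cdot>\<^sub>v x + c \<cdot>\<^sub>v s"
  have w: "dim_vec w = n" "w \<bullet> w \<le> 1" using ball_convex_comb[OF x s c(1,2)] s by (simp_all add: w_def)
  have dx: "dim_vec x' = n" using y by (simp add: x')
  have vec: "t \<cdot>\<^sub>v q - ((t - 1) \<cdot>\<^sub>v x + s) = t \<cdot>\<^sub>v (q - w)" if "dim_vec q = n" for q
  proof (rule eq_vecI)
    fix i assume "i < dim_vec (t \<cdot>\<^sub>v (q - w))"
    hence i: "i < n" using w by simp
    have "t * ((1 - c) * x $ i + c * s $ i) = (t - t * c) * x $ i + t * c * s $ i" by (simp add: algebra_simps)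
    thus "(t \<cdot>\<^sub>v q - ((t - 1) \<cdot>\<^sub>v x + s)) $ i = (t \<cdot>\<^sub>v (q - w)) $ i"
      using i x s that c(3) by (simp add: w_def right_diff_distrib)
  qed (use w s in simp)
  have sq: "(t \<cdot>\<^sub>v q - ((t - 1) \<cdot>\<^sub>v x + s)) \<bullet> (t \<cdot>\<^sub>v q - ((t - 1) \<cdot>\<^sub>v x + s)) = t\<^sup>2 * ((q - w) \<bullet> (q - w))"
    if "dim_vec q = n" for q
    unfolding vec[OF that] using w that by (simp add: ip_smult_left ip_smult_right power2_eq_square)
  have "F x' + L / 2 * ((x' - w) \<bullet> (x' - w)) \<le> F w + L / 2 * ((y - w) \<bullet> (y - w))"
    by (rule proj_step[OF y w x'])
  also have "F w \<le> (1 - c) * F x + c * F s" unfolding w_def by (rule F_convex_comb[OF x(1) s(1) c(1,2)])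
  finally have "t\<^sup>2 * (F x' + L / 2 * ((x' - w) \<bullet> (x' - w))) \<le>
      t\<^sup>2 * ((1 - c) * F x + c * F s + L / 2 * ((y - w) \<bullet> (y - w)))"
    by (intro mult_left_mono) auto
  also have "\<dots> = (t\<^sup>2 - t) * F x + t * F s + L / 2 * (t\<^sup>2 * ((y - w) \<bullet> (y - w)))"
  proof -
    have "t\<^sup>2 * c = t" using c(3) by (simp add: power2_eq_square mult.assoc)
    hence "t\<^sup>2 * ((1 - c) * F x + c * F s) = (t\<^sup>2 - t) * F x + t * F s"
      by (simp add: algebra_simps) (simp add: mult.assoc[symmetric])
    thus ?thesis by (simp add: algebra_simps)
  qed
  finally show ?thesis unfolding energy_def z_def sq[OF y] sq[OF dx] by (simp add: algebra_simps)
qed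

text \<open>The energy never increases, and the witness \<open>T\<close> is the momentum parameter
  of the last step, which has grown by at least 1/2 per step.\<close>

lemma agd_energy:
  assumes "dim_vec x = n" "x \<bullet> x \<le> 1" "dim_vec s = n" "s \<bullet> s \<le> 1" "dim_vec y = n" "1 \<le> t"
  shows "dim_vec (result (agd Q g \<gamma> L a x y t)) = n \<and> result (agd Q g \<gamma> L a x y t) \<bullet> result (agd Q g \<gamma> L a x y t) \<le> 1 \<and>
    (0 < a \<longrightarrow> (\<exists>T. t + (real a - 1) / 2 \<le> T \<and> T\<^sup>2 * (F (result (agd Q g \<gamma> L a x y t)) - F s) \<le> energy s x y t))"
  using assms
proof (induction a arbitrary: x y t)
  case 0
  thus ?case by (simp add: ret_def)
next
  case (Suc a)
  note x = Suc.prems(1,2) and s = Suc.prems(3,4) and y = Suc.prems(5) and t = Suc.prems(6)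
  define x' where "x' = result (proj_ball ((- (2 / L)) \<cdot>\<^sub>v grad y + y))"
  define t' where "t' = (1 + sqrt (1 + 4 * t * t)) / 2"
  define y' where "y' = ((t - 1) / t') \<cdot>\<^sub>v ((- 1) \<cdot>\<^sub>v x + x') + x'"
  have step: "result (agd Q g \<gamma> L (Suc a) x y t) = result (agd Q g \<gamma> L a x' y' t')"
    by (simp add: t_matvec_def t_axpy_def grad_def x'_def t'_def y'_def)
  have dx: "dim_vec x' = n" "x' \<bullet> x' \<le> 1" using y proj_ball_le_1 by (simp_all add: x'_def)
  have dy: "dim_vec y' = n" using dx by (simp add: y'_def)
  have "2 * t \<le> sqrt (1 + 4 * t * t)" by (rule real_le_rsqrt) (simp add: power2_eq_square)
  hence t': "t + 1 / 2 \<le> t'" "1 \<le> t'" using t by (auto simp: t'_def)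
  have "2 * t' - 1 = sqrt (1 + 4 * t * t)" by (simp add: t'_def add_divide_distrib)
  hence "(2 * t' - 1)\<^sup>2 = 1 + 4 * t * t" by simp
  \<comment> \<open>The update rule for \<open>t'\<close> solves this equation: it turns the
    coefficient t^2 delivered by \<open>energy_step\<close> into the one that \<open>energy\<close>
    has at \<open>t'\<close>.\<close>
  hence tt: "t'\<^sup>2 - t' = t\<^sup>2" by (simp add: power2_eq_square algebra_simps)
  \<comment> \<open>The momentum weight (t - 1) / t' is chosen so that the vector inside the square
    carries over unchanged.\<close>
  have vec: "t' \<cdot>\<^sub>v y' - ((t' - 1) \<cdot>\<^sub>v x' + s) = t \<cdot>\<^sub>v x' - ((t - 1) \<cdot>\<^sub>v x + s)"
  proof (rule eq_vecI)
    fix i assume "i < dim_vec (t \<cdot>\<^sub>v x' - ((t - 1) \<cdot>\<^sub>v x + s))"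
    hence i: "i < n" using s by simp
    have key: "t' * y' $ i = (t - 1) * (x' $ i - x $ i) + t' * x' $ i"
      using i dx x t' by (simp add: y'_def distrib_left)
    thus "(t' \<cdot>\<^sub>v y' - ((t' - 1) \<cdot>\<^sub>v x' + s)) $ i = (t \<cdot>\<^sub>v x' - ((t - 1) \<cdot>\<^sub>v x + s)) $ i"
      using i x s dx dy by (simp add: key algebra_simps)
  qed (use s in simp)
  have E: "energy s x' y' t' \<le> energy s x y t"
    using energy_step[OF x s y t x'_def] unfolding energy_def[of s x' y' t'] vec tt by simp
  note IH = Suc.IH[OF dx s dy t'(2)]
  show ?case
  proof (cases "a = 0")
    case True
    let ?z = "t \<cdot>\<^sub>v x' - ((t - 1) \<cdot>\<^sub>v x + s)"
    have "t\<^sup>2 * (F x' - F s) \<le> energy s x y t"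
    proof -
      have "0 \<le> L / 2 * (?z \<bullet> ?z)" using L by (intro mult_nonneg_nonneg) auto
      thus ?thesis using energy_step[OF x s y t x'_def] by linarith
    qed
    thus ?thesis unfolding step using True dx by (auto simp: ret_def)
  next
    case False
    then obtain T where "t' + (real a - 1) / 2 \<le> T" "T\<^sup>2 * (F (result (agd Q g \<gamma> L a x' y' t')) - F s) \<le> energy s x' y' t'"
      using IH by auto
    thus ?thesis unfolding step using IH E t' by (intro conjI impI exI[of _ T]) (auto simp: field_simps)
  qed
qed

theorem agd_convergence:
  assumes "dim_vec s = n" "s \<bullet> s \<le> 1" "0 < a"
  defines "y \<equiv> result (agd Q g \<gamma> L a (0\<^sub>v n) (0\<^sub>v n) 1)"
  shows "dim_vec y = n" "y \<bullet> y \<le> 1" "F y - F s \<le> 2 * L / (real a)\<^sup>2"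
proof -
  note E = agd_energy[of "0\<^sub>v n" s "0\<^sub>v n" 1 a, folded y_def]
  show "dim_vec y = n" "y \<bullet> y \<le> 1" using E assms by auto
  obtain T where T: "1 + (real a - 1) / 2 \<le> T" "T\<^sup>2 * (F y - F s) \<le> energy s (0\<^sub>v n) (0\<^sub>v n) 1"
    using E assms by auto
  \<comment> \<open>At \<open>t = 1\<close> the coefficient t^2 - t vanishes and the starting value
    of \<open>F\<close> drops out.\<close>
  have "energy s (0\<^sub>v n) (0\<^sub>v n) 1 = L / 2 * (s \<bullet> s)"
    using assms(1) by (simp add: energy_def ip_simps)
  also have "\<dots> \<le> L / 2 * 1" using assms L by (intro mult_left_mono) auto
  finally have "T\<^sup>2 * (F y - F s) \<le> L / 2" using T by simp
  moreover have Tpos: "real a / 2 < T" "0 < T" using T(1) assms(3) by (auto simp: field_simps)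
  ultimately have "F y - F s \<le> L / 2 / T\<^sup>2" by (simp add: pos_le_divide_eq mult.commute)
  also have "\<dots> \<le> L / 2 / (real a / 2)\<^sup>2"
    using Tpos assms(3) L by (intro divide_left_mono power_mono mult_pos_pos) auto
  finally show "F y - F s \<le> 2 * L / (real a)\<^sup>2" by (simp add: field_simps power2_eq_square)
qed

section \<open>Moving to the sphere\<close>

text \<open>The roots \<open>- s - D\<close> and \<open>- s + D\<close> of the sphere equation lie
  on opposite sides of 0, so one of them makes the linear term nonpositive. Both are at most 2 in
  modulus since \<bar>s\<bar> \<le> D \<le> 1, whence the factor 4.\<close>

lemma to_sphere_correct:
  assumes x: "dim_vec x = n" "x \<bullet> x = 1" and y: "dim_vec y = n" "y \<bullet> y \<le> 1"
  defines "z \<equiv> result (to_sphere Q g \<gamma> x y)"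
  shows "dim_vec z = n" "z \<bullet> z = 1" "F z \<le> F y + 4 * (x \<bullet> (Q *\<^sub>v x) - \<gamma>)"
proof -
  define s where "s = y \<bullet> x"
  define D where "D = sqrt (s * s + (1 - y \<bullet> y))"
  define e where "e = y \<bullet> ((- \<gamma>) \<cdot>\<^sub>v x + Q *\<^sub>v x) + g \<bullet> x"
  define \<tau> where "\<tau> = (if 0 < e then - s - D else - s + D)"
  have z: "z = \<tau> \<cdot>\<^sub>v x + y"
    by (simp add: z_def to_sphere_def t_dot_def t_matvec_def t_axpy_def s_def D_def e_def \<tau>_def)
  show "dim_vec z = n" using y by (simp add: z)
  have D2: "D * D = s * s + (1 - y \<bullet> y)" "0 \<le> D" using y by (simp_all add: D_def)
  have "\<bar>s\<bar> \<le> D" unfolding D_def by (rule real_le_rsqrt) (use y in \<open>simp add: power2_eq_square\<close>)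
  have "s\<^sup>2 \<le> (y \<bullet> y) * (x \<bullet> x)" unfolding s_def using x y by (intro cauchy_schwarz_vec)
  hence "s * s \<le> y \<bullet> y" using x by (simp add: power2_eq_square)
  hence "D \<le> 1" unfolding D_def by simp
  hence \<tau>: "\<bar>\<tau>\<bar> \<le> 2" "\<tau> * e \<le> 0" using \<open>\<bar>s\<bar> \<le> D\<close> D2(2)
    by (auto simp: \<tau>_def mult_nonpos_nonneg mult_nonneg_nonpos)
  have xy: "x \<bullet> y = s" unfolding s_def using x y by (intro ip_comm) simp
  have "\<tau> * \<tau> + 2 * s * \<tau> + y \<bullet> y = 1" using D2 unfolding \<tau>_def by (auto simp: algebra_simps)
  thus "z \<bullet> z = 1" using x y by (simp add: z ip_simps xy s_def[symmetric] algebra_simps)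
  have zy: "dim_vec (\<tau> \<cdot>\<^sub>v x + y) = n" "\<tau> \<cdot>\<^sub>v x + y - y = \<tau> \<cdot>\<^sub>v x" using x y by auto
  have "grad y \<bullet> x = e" unfolding grad_def e_def using x y g Q_sym[of x y] symmetric_ip[OF Q y(1) x(1)] ip_comm[of y x]
    by (simp add: ip_simps)
  hence "F z = F y + 2 * (\<tau> * e) + \<tau>\<^sup>2 * (x \<bullet> (Q *\<^sub>v x) - \<gamma>)"
    unfolding z F_expand[OF y(1) zy(1)] zy(2) using x
    by (simp add: Q_smult ip_simps power2_eq_square algebra_simps)
  moreover have "\<tau>\<^sup>2 \<le> 2\<^sup>2" using \<tau>(1) by (intro abs_le_square_iff[THEN iffD1]) simp
  hence "\<tau>\<^sup>2 * (x \<bullet> (Q *\<^sub>v x) - \<gamma>) \<le> 4 * (x \<bullet> (Q *\<^sub>v x) - \<gamma>)"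
    using convex[OF x(1)] x(2) by (intro mult_right_mono) auto
  ultimately show "F z \<le> F y + 4 * (x \<bullet> (Q *\<^sub>v x) - \<gamma>)" using \<tau>(2) by linarith
qed

lemma sphere_solution:
  assumes "dim_vec z = n" "z \<bullet> z = 1" "\<gamma> \<le> 0"
    and "\<And>s. dim_vec s = n \<Longrightarrow> s \<bullet> s \<le> 1 \<Longrightarrow> F z - F s \<le> \<epsilon>"
  shows "eps_solution n Q g \<epsilon> z"
proof -
  have "trs_obj Q g z - trs_obj Q g s \<le> \<epsilon>" if s: "dim_vec s = n" "s \<bullet> s \<le> 1" for s
  proof -
    have "\<gamma> * 1 \<le> \<gamma> * (s \<bullet> s)" using assms(3) s(2) by (intro mult_left_mono_neg) auto
    thus ?thesis using assms(4)[OF s] assms(2) by (simp add: shifted_obj_def trs_obj_def)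
  qed
  thus ?thesis using assms by (simp add: eps_solution_def vnorm_le_1)
qed

end

section \<open>The random starting vector\<close>

interpretation gauss: prob_space "gauss n"
  unfolding gauss_def by (intro prob_space_PiM prob_space_normal_density) simp

lemma gauss_measurable_coord [measurable]: "i < n \<Longrightarrow> (\<lambda>\<omega>. \<omega> i) \<in> borel_measurable (gauss n)"
  unfolding gauss_def by (rule measurable_compose[OF measurable_component_singleton]) auto

lemma distr_gauss_coord:
  assumes "i < n"
  shows "distr (gauss n) borel (\<lambda>\<omega>. \<omega> i) = std_normal_distribution"
proof -
  have "distr (gauss n) std_normal_distribution (\<lambda>\<omega>. \<omega> i) = std_normal_distribution"
    unfolding gauss_def by (rule distr_PiM_component) (use assms in \<open>auto intro: prob_space_normal_density\<close>)
  moreover have "distr (gauss n) std_normal_distribution (\<lambda>\<omega>. \<omega> i) = distr (gauss n) borel (\<lambda>\<omega>. \<omega> i)"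
    by (rule distr_cong) auto
  ultimately show ?thesis by simp
qed

lemma gauss_coord_distributed:
  assumes "i < n"
  shows "distributed (gauss n) lborel (\<lambda>\<omega>. \<omega> i) std_normal_density"
proof -
  have "distr (gauss n) lborel (\<lambda>\<omega>. \<omega> i) = distr (gauss n) borel (\<lambda>\<omega>. \<omega> i)" by (rule distr_cong) auto
  thus ?thesis using distr_gauss_coord[OF assms] gauss_measurable_coord[OF assms]
    by (simp add: distributed_def)
qed

lemma gauss_indep:
  assumes "I \<subseteq> {..<n}" "I \<noteq> {}"
  shows "gauss.indep_vars n (\<lambda>_. borel) (\<lambda>i \<omega>. \<omega> i) I"
proof -
  have ne: "{..<n} \<noteq> {}" using assms by auto
  have "gauss.indep_vars n (\<lambda>_. borel) (\<lambda>i \<omega>. \<omega> i) {..<n}"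
  proof (subst gauss.indep_vars_iff_distr_eq_PiM'[OF ne])
    have "distr (gauss n) (Pi\<^sub>M {..<n} (\<lambda>i. borel)) (\<lambda>\<omega>. \<lambda>i\<in>{..<n}. \<omega> i) = distr (gauss n) (gauss n) (\<lambda>\<omega>. \<omega>)"
    proof (rule distr_cong)
      show "sets (Pi\<^sub>M {..<n} (\<lambda>i. borel)) = sets (gauss n)" unfolding gauss_def by (rule sets_PiM_cong) auto
      show "(\<lambda>i\<in>{..<n}. \<omega> i) = \<omega>" if "\<omega> \<in> space (gauss n)" for \<omega>
        using that by (auto simp: gauss_def space_PiM PiE_def extensional_def restrict_def)
    qed simp
    also have "\<dots> = gauss n" by (rule distr_id)
    also have "\<dots> = (\<Pi>\<^sub>M i\<in>{..<n}. distr (gauss n) borel (\<lambda>\<omega>. \<omega> i))"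
      unfolding gauss_def[of n, symmetric] by (subst (1) gauss_def) (intro PiM_cong refl, simp add: distr_gauss_coord)
    finally show "distr (gauss n) (Pi\<^sub>M {..<n} (\<lambda>i. borel)) (\<lambda>\<omega>. \<lambda>i\<in>{..<n}. \<omega> i) = (\<Pi>\<^sub>M i\<in>{..<n}. distr (gauss n) borel (\<lambda>\<omega>. \<omega> i))" .
  qed auto
  thus ?thesis using assms(1) by (rule gauss.indep_vars_subset)
qed

text \<open>Rotation invariance of the Gaussian, obtained from sums of independent normal
  variables.\<close>

lemma gauss_projection_distributed:
  assumes u: "dim_vec u = n" "u \<bullet> u = 1"
  shows "distributed (gauss n) lborel (\<lambda>\<omega>. \<Sum>i<n. u $ i * \<omega> i) std_normal_density"
proof -
  \<comment> \<open>Indices with \<open>u $ i = 0\<close> are left out, because each normal summand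
    must have positive standard deviation.\<close>
  define I where "I = {i\<in>{..<n}. u $ i \<noteq> 0}"
  have one: "(\<Sum>i\<in>I. \<bar>u $ i\<bar>\<^sup>2) = 1"
  proof -
    have "1 = (\<Sum>i<n. (u $ i)\<^sup>2)" using u by (simp add: ip_sum power2_eq_square)
    also have "\<dots> = (\<Sum>i\<in>I. (u $ i)\<^sup>2)" unfolding I_def by (rule sum.mono_neutral_right) auto
    finally show ?thesis by simp
  qed
  have "I \<noteq> {}" using one by (intro notI) simp
  hence I: "finite I" "I \<noteq> {}" "I \<subseteq> {..<n}" by (auto simp: I_def)
  have ind: "gauss.indep_vars n (\<lambda>_. borel) (\<lambda>i \<omega>. u $ i * \<omega> i) I"
    by (rule gauss.indep_vars_compose2[OF gauss_indep[OF I(3,2)]]) simp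
  have "distributed (gauss n) lborel (\<lambda>\<omega>. \<Sum>i\<in>I. u $ i * \<omega> i) (normal_density (\<Sum>i\<in>I. 0) (sqrt (\<Sum>i\<in>I. \<bar>u $ i\<bar>\<^sup>2)))"
  proof (rule gauss.sum_indep_normal[OF I(1,2) ind])
    fix i assume i: "i \<in> I"
    show "0 < \<bar>u $ i\<bar>" using i by (simp add: I_def)
    have "distributed (gauss n) lborel (\<lambda>\<omega>. 0 + u $ i * \<omega> i) (normal_density (0 + u $ i * 0) (\<bar>u $ i\<bar> * 1))"
      using i by (intro gauss.normal_density_affine gauss_coord_distributed) (auto simp: I_def)
    thus "distributed (gauss n) lborel (\<lambda>\<omega>. u $ i * \<omega> i) (normal_density 0 \<bar>u $ i\<bar>)" by simp
  qed
  moreover have "(\<Sum>i\<in>I. u $ i * \<omega> i) = (\<Sum>i<n. u $ i * \<omega> i)" for \<omega> :: "nat \<Rightarrow> real"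
    unfolding I_def by (rule sum.mono_neutral_left) auto
  ultimately show ?thesis unfolding one by simp
qed

text \<open>With this bound the interval (- t, t) has probability at most \<open>t\<close>.\<close>

lemma std_normal_density_le_half: "std_normal_density x \<le> 1 / 2"
proof -
  have "2\<^sup>2 \<le> 2 * pi" using pi_gt3 by simp
  hence "2 \<le> sqrt (2 * pi)" by (rule real_le_rsqrt)
  hence "1 / sqrt (2 * pi) \<le> 1 / 2" by (intro divide_left_mono) auto
  moreover have "exp (- x\<^sup>2 / 2) \<le> 1" by simp
  ultimately have "1 / sqrt (2 * pi) * exp (- x\<^sup>2 / 2) \<le> 1 / 2 * 1" by (intro mult_mono) auto
  thus ?thesis by (simp add: std_normal_density_def)
qed

lemma gauss_projection_small:
  assumes u: "dim_vec u = n" "u \<bullet> u = 1" and t: "0 \<le> t"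
  shows "measure (gauss n) {\<omega> \<in> space (gauss n). \<bar>\<Sum>i<n. u $ i * \<omega> i\<bar> < t} \<le> t"
proof -
  let ?X = "\<lambda>\<omega>. \<Sum>i<n. u $ i * \<omega> i"
  have "{\<omega> \<in> space (gauss n). \<bar>?X \<omega>\<bar> < t} = ?X -` {-t<..<t} \<inter> space (gauss n)" by (auto simp: abs_less_iff)
  hence "emeasure (gauss n) {\<omega> \<in> space (gauss n). \<bar>?X \<omega>\<bar> < t} =
      (\<integral>\<^sup>+x. ennreal (std_normal_density x) * indicator {-t<..<t} x \<partial>lborel)"
    using distributed_emeasure[OF gauss_projection_distributed[OF u], of "{-t<..<t}"] by simp
  also have "\<dots> \<le> (\<integral>\<^sup>+x. ennreal (1 / 2) * indicator {-t<..<t} x \<partial>lborel)"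
    by (intro nn_integral_mono mult_right_mono ennreal_leI std_normal_density_le_half) auto
  also have "\<dots> = ennreal (1 / 2) * emeasure lborel {-t<..<t}" by (rule nn_integral_cmult_indicator) simp
  also have "\<dots> = ennreal (1 / 2 * (2 * t))" using t by (subst ennreal_mult) auto
  finally show ?thesis using t by (simp add: gauss.emeasure_eq_measure)
qed

text \<open>Markov's inequality is enough: sharper concentration would only improve the power of
  \<delta> inside a logarithm.\<close>

lemma gauss_norm_large:
  assumes "0 < c"
  shows "measure (gauss n) {\<omega> \<in> space (gauss n). c \<le> (\<Sum>i<n. (\<omega> i)\<^sup>2)} \<le> real n / c"
proof -
  have int: "integrable (gauss n) (\<lambda>\<omega>. (\<omega> i)\<^sup>2) \<and> (\<integral>\<omega>. (\<omega> i)\<^sup>2 \<partial>gauss n) = 1" if i: "i < n" for i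
  proof -
    have "integrable std_normal_distribution (\<lambda>x. x\<^sup>2)"
      using std_normal_distribution_even_moments(2)[of 1] by simp
    moreover have "(LINT x|std_normal_distribution. x\<^sup>2) = 1"
      using std_normal_distribution_even_moments(1)[of 1] by (simp add: numeral_2_eq_2)
    ultimately show ?thesis
      using integrable_distr_eq[OF gauss_measurable_coord[OF i], of "\<lambda>x. x\<^sup>2"]
        integral_distr[OF gauss_measurable_coord[OF i], of "\<lambda>x. x\<^sup>2"] distr_gauss_coord[OF i] by simp
  qed
  have "(\<integral>\<omega>. (\<Sum>i<n. (\<omega> i)\<^sup>2) \<partial>gauss n) = real n" using int by (subst Bochner_Integration.integral_sum) auto
  moreover have "integrable (gauss n) (\<lambda>\<omega>. \<Sum>i<n. (\<omega> i)\<^sup>2)" using int by (intro Bochner_Integration.integrable_sum) auto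
  ultimately show ?thesis using assms
    using integral_Markov_inequality_measure[of "gauss n" "\<lambda>\<omega>. \<Sum>i<n. (\<omega> i)\<^sup>2" "space (gauss n)" c]
    by (simp add: sum_nonneg)
qed

text \<open>Three bad events of probability at most \<delta>/4 each: two small projections and a
  large norm. The weight is the quotient of (\<delta>/4)^2 by 4 n / \<delta>. The two directions
  will be eigenvectors for the smallest eigenvalue and for one of largest modulus; they may
  coincide.\<close>

lemma gauss_start_event:
  assumes u: "dim_vec u = n" "u \<bullet> u = 1" and u': "dim_vec u' = n" "u' \<bullet> u' = 1"
    and n: "0 < n" and \<delta>: "0 < \<delta>" "\<delta> < 1"
  obtains E where "E \<in> sets (gauss n)" "1 - \<delta> \<le> measure (gauss n) E"
    "\<And>\<omega> v. \<omega> \<in> E \<Longrightarrow> v = result (t_normalize (Matrix.vec n \<omega>)) \<Longrightarrow>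
      dim_vec v = n \<and> v \<bullet> v = 1 \<and> \<delta> ^ 3 / (64 * real n) \<le> (u \<bullet> v)\<^sup>2 \<and> \<delta> ^ 3 / (64 * real n) \<le> (u' \<bullet> v)\<^sup>2"
proof -
  let ?X = "\<lambda>u \<omega>. \<Sum>i<n. u $ i * \<omega> i"
  define B where "B u = {\<omega> \<in> space (gauss n). \<bar>?X u \<omega>\<bar> < \<delta> / 4}" for u :: "real vec"
  define C where "C = {\<omega> \<in> space (gauss n). 4 * real n / \<delta> \<le> (\<Sum>i<n. (\<omega> i)\<^sup>2)}"
  define E where "E = space (gauss n) - (B u \<union> B u' \<union> C)"
  have [measurable]: "?X u \<in> borel_measurable (gauss n)" for u :: "real vec"
    by (intro borel_measurable_sum borel_measurable_times borel_measurable_const gauss_measurable_coord) auto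
  have [measurable]: "(\<lambda>\<omega>. \<Sum>i<n. (\<omega> i)\<^sup>2) \<in> borel_measurable (gauss n)"
    by (intro borel_measurable_sum borel_measurable_power gauss_measurable_coord) auto
  have ms: "B u \<in> sets (gauss n)" "C \<in> sets (gauss n)" for u by (simp_all add: B_def C_def)
  have mB: "measure (gauss n) (B u) \<le> \<delta> / 4" if "dim_vec u = n" "u \<bullet> u = 1" for u
    unfolding B_def using gauss_projection_small[OF that, of "\<delta> / 4"] \<delta> by simp
  have mC: "measure (gauss n) C \<le> \<delta> / 4"
    unfolding C_def using gauss_norm_large[of "4 * real n / \<delta>" n] n \<delta> by simp
  have "measure (gauss n) (B u \<union> B u' \<union> C) \<le> measure (gauss n) (B u \<union> B u') + measure (gauss n) C"
    by (rule measure_Un_le) (use ms in auto)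
  also have "\<dots> \<le> measure (gauss n) (B u) + measure (gauss n) (B u') + measure (gauss n) C"
    using measure_Un_le[of "B u" "gauss n" "B u'"] ms by auto
  also have "\<dots> \<le> \<delta>" using mB[OF u] mB[OF u'] mC \<delta> by linarith
  finally have bad: "measure (gauss n) (B u \<union> B u' \<union> C) \<le> \<delta>" .
  show thesis
  proof (rule that)
    show "E \<in> sets (gauss n)" unfolding E_def using ms by auto
    show "1 - \<delta> \<le> measure (gauss n) E" unfolding E_def using bad ms by (subst gauss.prob_compl) auto
  next
    fix \<omega> v assume \<omega>: "\<omega> \<in> E" and v: "v = result (t_normalize (Matrix.vec n \<omega>))"
    let ?w = "Matrix.vec n \<omega>"
    have ww: "?w \<bullet> ?w = (\<Sum>i<n. (\<omega> i)\<^sup>2)" by (simp add: ip_sum power2_eq_square)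
    have uw: "u \<bullet> ?w = ?X u \<omega>" for u by (simp add: ip_sum)
    have up: "?w \<bullet> ?w \<le> 4 * real n / \<delta>" using \<omega> unfolding ww by (auto simp: E_def C_def)
    have lo: "\<delta> / 4 \<le> \<bar>u \<bullet> ?w\<bar>" "\<delta> / 4 \<le> \<bar>u' \<bullet> ?w\<bar>" using \<omega> unfolding uw by (auto simp: E_def B_def)
    have "?w \<noteq> 0\<^sub>v n" using lo(1) \<delta> u by auto
    hence pos: "0 < ?w \<bullet> ?w" by (rule ip_self_pos) simp
    have v': "v = (1 / vnorm ?w) \<cdot>\<^sub>v ?w" by (simp add: v t_normalize_def t_norm_def t_scale_def)
    have nz: "vnorm ?w * vnorm ?w = ?w \<bullet> ?w" using vnorm_sq[of ?w] by (simp only: power2_eq_square)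
    have "v \<bullet> v = 1" using pos nz by (simp add: v' ip_simps)
    moreover have dv: "dim_vec v = n" by (simp add: v')
    moreover have "\<delta> ^ 3 / (64 * real n) \<le> (z \<bullet> v)\<^sup>2" if z: "dim_vec z = n" "\<delta> / 4 \<le> \<bar>z \<bullet> ?w\<bar>" for z
    proof -
      have "(z \<bullet> v)\<^sup>2 = (z \<bullet> ?w)\<^sup>2 / (?w \<bullet> ?w)"
        using z unfolding v' by (simp add: ip_simps power_divide)
      moreover have "(\<delta> / 4)\<^sup>2 \<le> (z \<bullet> ?w)\<^sup>2" using z \<delta> by (intro abs_le_square_iff[THEN iffD1]) auto
      hence "(\<delta> / 4)\<^sup>2 / (4 * real n / \<delta>) \<le> (z \<bullet> ?w)\<^sup>2 / (?w \<bullet> ?w)"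
        using pos up by (intro frac_le) auto
      moreover have "(\<delta> / 4)\<^sup>2 / (4 * real n / \<delta>) = \<delta> ^ 3 / (64 * real n)"
        using n \<delta> by (simp add: field_simps power2_eq_square power3_eq_cube)
      ultimately show ?thesis by simp
    qed
    ultimately show "dim_vec v = n \<and> v \<bullet> v = 1 \<and> \<delta> ^ 3 / (64 * real n) \<le> (u \<bullet> v)\<^sup>2 \<and> \<delta> ^ 3 / (64 * real n) \<le> (u' \<bullet> v)\<^sup>2"
      using lo u u' dv by blast
  qed
qed

section \<open>Accuracy of the Ritz pair\<close>

lemma lin_comb_vsum:
  assumes "length cs = length vs" "\<And>v. v \<in> set vs \<Longrightarrow> dim_vec v = n"
  shows "result (lin_comb n cs vs) = vsum n (length vs) ((!) cs) ((!) vs)"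
  using assms
proof (induction cs vs rule: list_induct2)
  case Nil
  show ?case by (auto simp: vsum_def)
next
  case (Cons c cs v vs)
  thus ?case
    by (intro eq_vecI) (simp_all add: t_axpy_def vsum_def sum.lessThan_Suc_shift del: sum.lessThan_Suc)
qed

lemma two_power_ge_exp: "exp (real m / 2) \<le> 2 ^ m"
proof -
  have "exp (1 / 2 :: real) \<le> 1 + 1 / 2 + (1 / 2)\<^sup>2" by (rule exp_bound) auto
  hence "exp (1 / 2 :: real) \<le> 2" by (simp add: power2_eq_square)
  hence "exp (1 / 2 :: real) ^ m \<le> 2 ^ m" by (intro power_mono) auto
  thus ?thesis by (simp add: exp_of_nat_mult[symmetric])
qed

text \<open>Bisection places \<open>lo\<close> below all Ritz values and within \<eta> of one of
  them. The result may lie \<eta> below \<open>lambda_min Q\<close>, so Ritz values within \<eta> of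
  \<open>lambda_min Q\<close> exceed \<open>lo\<close> by less than 2 \<eta>, and inverse iteration
  doubles this to 4 \<eta>.\<close>

lemma ritz_pair_accuracy:
  fixes rs :: "(real \<times> real \<times> real vec) list"
  assumes K: "krylov n (length rs) Q ((!) (basis rs)) (\<lambda>i. fst (tridiag rs ! i)) (\<lambda>i. snd (tridiag rs ! i)) r"
    and u: "eigenbasis n Q u \<mu>" and \<epsilon>: "0 < \<epsilon>" and \<eta>: "0 < \<eta>" and \<tau>: "0 < \<tau>"
    and weight: "\<And>e \<theta>. eigenbasis (length rs) (compression Q (length rs) ((!) (basis rs))) e \<theta> \<Longrightarrow>
       \<tau> / 2 \<le> (\<Sum>l | l < length rs \<and> \<theta> l < lambda_min Q + \<eta>. (e l $ 0)\<^sup>2)"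
    and R: "R = result (tri_bound 0 (tridiag rs))"
    and m: "(2 * R + \<epsilon>) / 2 ^ m \<le> \<eta>" and p: "0 < p" "2 \<le> \<tau> * 2 ^ (2 * p - 1)"
    and res: "result (ritz_pair n \<epsilon> R m p rs) = (lo, x)"
  shows "dim_vec x = n \<and> x \<bullet> x = 1 \<and> lo < lambda_min Q + \<eta> \<and> lambda_min Q - \<eta> \<le> lo \<and> x \<bullet> (Q *\<^sub>v x) \<le> lo + 4 * \<eta>"
proof -
  interpret krylov n "length rs" Q "(!) (basis rs)" "\<lambda>i. fst (tridiag rs ! i)" "\<lambda>i. snd (tridiag rs ! i)" r by (rule K)
  let ?j = "length rs" and ?ts = "tridiag rs"
  obtain e \<theta> where e: "eigenbasis ?j T e \<theta>" using eigenbasis_exists[OF T_carrier T_sym] by blast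
  have T: "T = tmat ?ts" using T_eq by simp
  have e': "eigenbasis (length ?ts) (tmat ?ts) e \<theta>" using e by (simp add: T)
  have de: "dim_vec (e i) = ?j" if "i < ?j" for i using e that by (simp add: eigenbasis_def orthonormal_def)
  have \<theta>R: "\<bar>\<theta> i\<bar> \<le> R" if "i < ?j" for i
  proof (rule gershgorin_tri_mat[OF e'])
    show "i < length ?ts" using that by simp
    fix l assume "l < length ?ts"
    from tri_bound_row[OF this, of 0]
    show "(if l = 0 then 0 else \<bar>snd (?ts ! (l - 1))\<bar>) + \<bar>fst (?ts ! l)\<bar> + \<bar>snd (?ts ! l)\<bar> \<le> R"
      by (simp add: R)
  qed
  have lo: "lo = result (bisect ?ts m (- R - \<epsilon>) R)" using res by (simp add: ritz_pair_def)
  have "(\<forall>i<?j. lo < \<theta> i) \<and> (\<exists>i<?j. \<theta> i \<le> lo + (R - (- R - \<epsilon>)) / 2 ^ m)"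
  proof -
    have "- R - \<epsilon> < \<theta> i" "\<theta> i \<le> R" if "i < ?j" for i using \<theta>R[OF that] \<epsilon> by linarith+
    moreover from this(2) have "\<exists>i<?j. \<theta> i \<le> R" using j by blast
    ultimately show ?thesis using bisect_bounds[OF e', of "- R - \<epsilon>" R m] unfolding lo[symmetric] by auto
  qed
  then obtain i0 where lo_lt: "\<And>i. i < ?j \<Longrightarrow> lo < \<theta> i" and i0: "i0 < ?j" "\<theta> i0 \<le> lo + \<eta>"
    using m by (auto simp: algebra_simps)
  have lower: "lambda_min Q - \<eta> \<le> lo" using i0 ritz_ge_lambda_min[OF u e i0(1)] by linarith
  have upper: "lo < lambda_min Q + \<eta>"
  proof (rule ccontr)
    assume "\<not> ?thesis"
    hence "{l. l < ?j \<and> \<theta> l < lambda_min Q + \<eta>} = {}" using lo_lt by fastforce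
    hence "\<tau> / 2 \<le> 0" using weight[OF e] by (simp only: sum.empty)
    thus False using \<tau> by simp
  qed
  define z0 where "z0 = 1 # replicate (?j - 1) (0 :: real)"
  define zs where "zs = result (inverse_iteration lo ?ts p z0)"
  have lz0: "length z0 = length ?ts" using j by (simp add: z0_def)
  have lz: "length zs = ?j" using length_inverse_iteration[OF lz0] by (simp add: zs_def)
  let ?z = "vec_of_list zs"
  have dz: "dim_vec ?z = ?j" using lz by simp
  define X where "X i = \<theta> i - lo" for i
  have X: "0 < X i" if "i < ?j" for i using lo_lt[OF that] by (simp add: X_def)
  have coord: "(e i \<bullet> ?z)\<^sup>2 = (e i $ 0)\<^sup>2 / X i ^ (2 * p)" if i: "i < ?j" for i
  proof -
    have "vec_of_list z0 = unit_vec ?j 0"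
    proof (rule eq_vecI)
      fix k assume "k < dim_vec (unit_vec ?j 0 :: real vec)"
      hence "k < ?j" by simp
      thus "vec_of_list z0 $ k = unit_vec ?j 0 $ k" using j by (cases k) (simp_all add: vec_of_list_index z0_def)
    qed (use lz0 in simp)
    hence "X i ^ p * (e i \<bullet> ?z) = e i $ 0"
      using inverse_iteration_ip[OF e', of lo i z0 p] lo_lt i lz0 j by (simp add: zs_def X_def)
    hence "e i \<bullet> ?z = e i $ 0 / X i ^ p" using X[OF i] by (simp add: field_simps)
    thus ?thesis by (simp add: power_divide power_mult[symmetric] mult.commute)
  qed
  \<comment> \<open>In the Rayleigh quotient of the iterate, shifted by \<open>lo\<close>, numerator
    and denominator carry the exponents 2 p - 1 and 2 p; this is
    \<open>inverse_power_weights\<close> with an odd exponent.\<close>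
  have q: "2 * p = Suc (2 * p - 1)" using p by simp
  have zz: "?z \<bullet> ?z = (\<Sum>i<?j. (e i $ 0)\<^sup>2 / X i ^ Suc (2 * p - 1))"
    unfolding eigenbasis_norm[OF T_carrier T_sym e dz] q[symmetric] by (intro sum.cong refl coord) simp
  have "?z \<bullet> (T *\<^sub>v ?z) - lo * (?z \<bullet> ?z) = (\<Sum>i<?j. X i * (e i \<bullet> ?z)\<^sup>2)"
    unfolding eigenbasis_bilinear[OF T_carrier T_sym e dz dz] eigenbasis_norm[OF T_carrier T_sym e dz]
    by (simp add: X_def sum_distrib_left sum_subtractf[symmetric] algebra_simps power2_eq_square)
  also have "\<dots> = (\<Sum>i<?j. (e i $ 0)\<^sup>2 / X i ^ (2 * p - 1))"
  proof (intro sum.cong refl)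
    fix i assume "i \<in> {..<?j}"
    hence i: "i < ?j" by simp
    have "X i * ((e i $ 0)\<^sup>2 / X i ^ Suc (2 * p - 1)) = (e i $ 0)\<^sup>2 / X i ^ (2 * p - 1)" using X[OF i] by simp
    thus "X i * (e i \<bullet> ?z)\<^sup>2 = (e i $ 0)\<^sup>2 / X i ^ (2 * p - 1)" unfolding coord[OF i] q[symmetric] .
  qed
  also have "\<dots> \<le> 2 * (2 * \<eta>) * (\<Sum>i<?j. (e i $ 0)\<^sup>2 / X i ^ Suc (2 * p - 1))"
  proof (rule inverse_power_weights[OF X _ eigenbasis_first_coords[OF e T_carrier T_sym j] _ p(2)])
    have "\<tau> / 2 \<le> (\<Sum>l | l < ?j \<and> \<theta> l < lambda_min Q + \<eta>. (e l $ 0)\<^sup>2)" by (rule weight[OF e])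
    also have "\<dots> \<le> (\<Sum>l | l < ?j \<and> X l < 2 * \<eta>. (e l $ 0)\<^sup>2)"
      using lower by (intro sum_mono2) (auto simp: X_def)
    finally show "\<tau> / 2 \<le> (\<Sum>l | l < ?j \<and> X l < 2 * \<eta>. (e l $ 0)\<^sup>2)" .
  qed (use \<eta> in auto)
  finally have ray: "?z \<bullet> (T *\<^sub>v ?z) \<le> (lo + 4 * \<eta>) * (?z \<bullet> ?z)" unfolding zz[symmetric] by (simp add: algebra_simps)
  have pos: "0 < ?z \<bullet> ?z"
  proof -
    have "?z \<bullet> ?z \<noteq> 0"
    proof
      assume "?z \<bullet> ?z = 0"
      hence "(\<Sum>i<?j. (e i \<bullet> ?z)\<^sup>2) = 0" using eigenbasis_norm[OF T_carrier T_sym e dz] by simp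
      hence "\<forall>i\<in>{..<?j}. (e i \<bullet> ?z)\<^sup>2 = 0" by (subst (asm) sum_nonneg_eq_0_iff) auto
      hence "(e i $ 0)\<^sup>2 = 0" if "i < ?j" for i using coord[OF that] X[OF that] that by auto
      thus False using eigenbasis_first_coords[OF e T_carrier T_sym j] by simp
    qed
    thus ?thesis using ip_self_nonneg[of ?z] by linarith
  qed
  have "result (lin_comb n zs (basis rs)) = lift ?z"
  proof -
    have "dim_vec v = n" if "v \<in> set (basis rs)" for v using that by (auto simp: in_set_conv_nth)
    moreover have "($) ?z = (!) zs" by (rule ext) (simp add: vec_of_list_index)
    ultimately show ?thesis using lin_comb_vsum[of zs "basis rs" n] lz unfolding lift_def by simp
  qed
  hence x: "x = (1 / vnorm (lift ?z)) \<cdot>\<^sub>v lift ?z"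
    using res lo by (simp add: ritz_pair_def t_normalize_def t_norm_def t_scale_def zs_def z0_def)
  define N where "N = vnorm (lift ?z)"
  have N: "N * N = ?z \<bullet> ?z" "0 < N"
    using vnorm_sq[of "lift ?z"] lift_ip[OF dz dz] pos by (simp_all add: N_def power2_eq_square vnorm_def)
  have "Q *\<^sub>v ((1 / N) \<cdot>\<^sub>v lift ?z) = (1 / N) \<cdot>\<^sub>v (Q *\<^sub>v lift ?z)" using Q by (intro mult_mat_vec) auto
  hence "x \<bullet> (Q *\<^sub>v x) = (?z \<bullet> (T *\<^sub>v ?z)) / (N * N)"
    unfolding x N_def[symmetric] using lift_quadratic[OF dz dz] by (simp add: ip_simps)
  also have "\<dots> \<le> lo + 4 * \<eta>" using ray pos unfolding N(1) by (simp add: pos_divide_le_eq)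
  finally have "x \<bullet> (Q *\<^sub>v x) \<le> lo + 4 * \<eta>" .
  moreover have "x \<bullet> x = 1" unfolding x N_def[symmetric] using lift_ip[OF dz dz] N pos by (simp add: ip_simps)
  moreover have "dim_vec x = n" by (simp add: x)
  ultimately show ?thesis using lower upper by simp
qed

section \<open>Numerical estimates for the iteration counts\<close>

lemma exp_int_ge_two_power: "2 ^ k \<le> exp (real k)"
proof -
  have "2 \<le> exp (1 :: real)" using exp_ge_add_one_self[of 1] by simp
  hence "2 ^ k \<le> exp (1 :: real) ^ k" by (intro power_mono) auto
  thus ?thesis by (simp add: exp_of_nat_mult[symmetric])
qed

lemma log_ratio_ge_1: "0 < n \<Longrightarrow> 0 < \<delta> \<Longrightarrow> \<delta> < 1 \<Longrightarrow> 1 \<le> ln (real n / \<delta>) + 1"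
  by (simp add: field_simps)

text \<open>The reciprocal weight is 64 n / \<delta>^3, where 64 \<le> exp 5 and n / \<delta>^3
  \<le> (n / \<delta>)^5.\<close>

lemma start_weight_exp:
  assumes "0 < n" "0 < \<delta>" "\<delta> < 1"
  shows "1 \<le> \<delta> ^ 3 / (64 * real n) * exp (5 * (ln (real n / \<delta>) + 1))"
proof -
  define X where "X = real n / \<delta>"
  have n1: "1 \<le> real n" using assms(1) by simp
  have X: "1 \<le> X" using n1 assms by (simp add: X_def field_simps)
  have "exp (5 * (ln X + 1)) = exp 5 * exp (ln X) ^ 5"
    by (simp add: exp_add[symmetric] exp_of_nat_mult[symmetric] algebra_simps)
  hence E: "exp (5 * (ln X + 1)) = exp 5 * X ^ 5" using X by simp
  have "64 \<le> exp (5 :: real)"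
  proof -
    have "(1 + 1 + 1 / 2) \<le> exp (1 :: real)" using exp_lower_Taylor_quadratic[of 1] by simp
    hence "(5 / 2) ^ 5 \<le> exp (1 :: real) ^ 5" by (intro power_mono) auto
    also have "exp (1 :: real) ^ 5 = exp 5" by (simp add: exp_of_nat_mult[symmetric])
    finally show ?thesis by (simp add: power_divide)
  qed
  moreover have "real n / \<delta> ^ 3 \<le> X ^ 5"
  proof -
    have "real n / \<delta> ^ 3 \<le> real n ^ 3 / \<delta> ^ 3" using n1 assms by (intro divide_right_mono self_le_power) auto
    also have "\<dots> = X ^ 3" by (simp add: X_def power_divide)
    also have "\<dots> \<le> X ^ 5" using X by (intro power_increasing) auto
    finally show ?thesis .
  qed
  ultimately have "64 * (real n / \<delta> ^ 3) \<le> exp 5 * X ^ 5" using assms by (intro mult_mono) auto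
  thus ?thesis unfolding E X_def[symmetric] using assms n1 by (simp add: field_simps)
qed

lemma bisection_steps:
  fixes R \<epsilon> :: real
  assumes "0 \<le> R" "0 < \<epsilon>"
  shows "(2 * R + \<epsilon>) / 2 ^ nat \<lceil>100 * (ln (R / \<epsilon> + 1) + 1)\<rceil> \<le> \<epsilon> / 64"
proof -
  define X where "X = R / \<epsilon>"
  define m where "m = nat \<lceil>100 * (ln (X + 1) + 1)\<rceil>"
  have X: "0 \<le> X" "R = X * \<epsilon>" using assms by (simp_all add: X_def)
  have lnX: "0 \<le> ln (X + 1)" using X by simp
  have "100 * (ln (X + 1) + 1) \<le> real m" unfolding m_def by linarith
  hence "ln (X + 1) + real 7 \<le> real m / 2" using lnX by simp
  hence "exp (ln (X + 1) + real 7) \<le> exp (real m / 2)" by (simp only: exp_le_cancel_iff)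
  also have "\<dots> \<le> 2 ^ m" by (rule two_power_ge_exp)
  finally have "(X + 1) * exp (real 7) \<le> 2 ^ m" using X by (simp add: exp_add)
  \<comment> \<open>The power 2^7 = 2 * 64 pays for the factor 2 in \<open>2 * R\<close> and for the
    target \<epsilon>/64.\<close>
  moreover have "(X + 1) * 2 ^ 7 \<le> (X + 1) * exp (real 7)" using X by (intro mult_left_mono exp_int_ge_two_power) auto
  ultimately have "(2 * X + 1) * 64 \<le> 2 ^ m" using X by simp
  hence "(2 * X + 1) * 64 * \<epsilon> \<le> 2 ^ m * \<epsilon>" using assms by (intro mult_right_mono) auto
  thus ?thesis unfolding X_def[symmetric] m_def[symmetric] by (simp add: X(2) field_simps)
qed

section \<open>Correctness of the solver\<close>

text \<open>A zero draw has probability 0, but the operation count covers it too: division by 0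
  yields 0, so it is normalized to the zero vector.\<close>

lemma normalize_cases:
  fixes w :: "real vec"
  defines "v \<equiv> result (t_normalize w)"
  shows "dim_vec v = dim_vec w" "v \<bullet> v = 1 \<or> v = 0\<^sub>v (dim_vec w)"
proof -
  have v: "v = (1 / vnorm w) \<cdot>\<^sub>v w" by (simp add: v_def t_normalize_def t_norm_def t_scale_def)
  show "dim_vec v = dim_vec w" by (simp add: v)
  have N: "vnorm w * vnorm w = w \<bullet> w" using vnorm_sq[of w] by (simp only: power2_eq_square)
  show "v \<bullet> v = 1 \<or> v = 0\<^sub>v (dim_vec w)"
  proof (cases "vnorm w = 0")
    case True
    thus ?thesis unfolding v by (intro disjI2 eq_vecI) auto
  next
    case False
    have "v \<bullet> v = (w \<bullet> w) / (vnorm w * vnorm w)" by (simp add: v ip_simps)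
    thus ?thesis using False unfolding N[symmetric] by simp
  qed
qed

lemma tri_bound_lanczos:
  assumes Q: "Q \<in> carrier_mat n n" "transpose_mat Q = Q" and n: "0 < n" "0 < K"
    and v: "dim_vec v = n" "v \<bullet> v = 1 \<or> v = 0\<^sub>v n"
  defines "R \<equiv> result (tri_bound 0 (tridiag (result (lanczos Q (min n K) (0\<^sub>v n) 0 v))))"
  shows "0 \<le> R \<and> R \<le> 3 * spectral_norm Q"
proof -
  obtain u \<mu> where u: "eigenbasis n Q u \<mu>" using eigenbasis_exists[OF Q] by blast
  note sn = spectral_norm_nonneg[OF Q u n(1)]
  show ?thesis
  proof (cases "v \<bullet> v = 1")
    case True
    define rs where "rs = result (lanczos Q (min n K) (0\<^sub>v n) 0 v)"
    obtain r where K: "krylov n (length rs) Q ((!) (basis rs)) (\<lambda>i. fst (tridiag rs ! i)) (\<lambda>i. snd (tridiag rs ! i)) r"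
      and last: "snd (tridiag rs ! (length rs - 1)) = vnorm r"
      using lanczos_krylov[OF Q v(1) True n(2,1) rs_def] by blast
    interpret krylov n "length rs" Q "(!) (basis rs)" "\<lambda>i. fst (tridiag rs ! i)" "\<lambda>i. snd (tridiag rs ! i)" r by (rule K)
    note eb = entry_bounds[OF n(1) u]
    have "\<bar>fst t\<bar> \<le> spectral_norm Q \<and> \<bar>snd t\<bar> \<le> spectral_norm Q" if "t \<in> set (tridiag rs)" for t
    proof -
      obtain l where l: "l < length rs" "t = tridiag rs ! l" using \<open>t \<in> set (tridiag rs)\<close> by (auto simp: in_set_conv_nth)
      have "\<bar>snd t\<bar> \<le> spectral_norm Q"
      proof (cases "Suc l < length rs")
        case True
        thus ?thesis using eb(2)[of l] l by simp
      next
        case False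
        hence "l = length rs - 1" using l by simp
        thus ?thesis using last eb(3) l by simp
      qed
      thus ?thesis using eb(1)[of l] l by simp
    qed
    thus ?thesis unfolding R_def rs_def[symmetric] using tri_bound_le[of 0 "spectral_norm Q" "tridiag rs"] sn by simp
  next
    case False
    \<comment> \<open>From the zero vector the recurrence stops at once with all entries 0.\<close>
    hence v0: "v = 0\<^sub>v n" using v by simp
    obtain k where k: "min n K = Suc k" using n by (metis gr0_implies_Suc min_less_iff_conj)
    have Q0: "Q *\<^sub>v 0\<^sub>v n = 0\<^sub>v n" using Q by (intro eq_vecI) auto
    have "(- 0) \<cdot>\<^sub>v 0\<^sub>v n + 0\<^sub>v n = (0\<^sub>v n :: real vec)" "(- (0 :: real)) \<cdot>\<^sub>v 0\<^sub>v n = 0\<^sub>v n" by auto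
    hence "R = 0" unfolding R_def k v0
      by (simp add: t_matvec_def t_axpy_def t_dot_def t_norm_def vnorm_def Q0 tridiag_def)
    thus ?thesis using sn by simp
  qed
qed

text \<open>Error budget: \<epsilon>/64 from the gradient method and 4 times 5 \<epsilon>/64 from
  the move to the sphere, where the excess 5 \<epsilon>/64 is 4 \<epsilon>/64 from inverse iteration
  plus the shift in \<open>\<gamma>\<close>.\<close>

lemma trs_solver_correct:
  assumes Q: "Q \<in> carrier_mat n n" "transpose_mat Q = Q" and neg: "lambda_min Q < 0" and n: "0 < n"
    and g: "dim_vec g = n" and \<epsilon>: "0 < \<epsilon>" and \<delta>: "0 < \<delta>" "\<delta> < 1"
    and u: "eigenbasis n Q u \<mu>" and i1: "i1 < n" "\<mu> i1 = lambda_min Q" and i2: "i2 < n" "\<bar>\<mu> i2\<bar> = spectral_norm Q"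
    and v: "v = result (t_normalize (Matrix.vec n \<omega>))" "v \<bullet> v = 1"
    and w1: "\<delta> ^ 3 / (64 * real n) \<le> (u i1 \<bullet> v)\<^sup>2" and w2: "\<delta> ^ 3 / (64 * real n) \<le> (u i2 \<bullet> v)\<^sup>2"
  shows "eps_solution n Q g \<epsilon> (result (trs_solver 100 n Q g \<epsilon> \<delta> \<omega>))"
proof -
  let ?\<rho> = "spectral_norm Q"
  define \<tau> where "\<tau> = \<delta> ^ 3 / (64 * real n)"
  define l where "l = ln (real n / \<delta>) + 1"
  define p where "p = nat \<lceil>100 * l\<rceil>"
  define rs0 where "rs0 = result (lanczos Q (min n p) (0\<^sub>v n) 0 v)"
  define M where "M = 2 * result (tri_bound 0 (tridiag rs0))"
  define s where "s = sqrt (M / \<epsilon>) + 1"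
  define rs where "rs = result (lanczos Q (min n (nat \<lceil>100 * s * l\<rceil>)) (0\<^sub>v n) 0 v)"
  define R where "R = result (tri_bound 0 (tridiag rs))"
  define m where "m = nat \<lceil>100 * (ln (R / \<epsilon> + 1) + 1)\<rceil>"
  define lo where "lo = fst (result (ritz_pair n \<epsilon> R m p rs))"
  define x where "x = snd (result (ritz_pair n \<epsilon> R m p rs))"
  define \<gamma> where "\<gamma> = lo - \<epsilon> / 64"
  define L where "L = 2 * (M + \<bar>\<gamma>\<bar>)"
  define a where "a = nat \<lceil>100 * s\<rceil>"
  define y where "y = result (agd Q g \<gamma> L a (0\<^sub>v n) (0\<^sub>v n) 1)"
  define z where "z = result (to_sphere Q g \<gamma> x y)"
  have res: "result (trs_solver 100 n Q g \<epsilon> \<delta> \<omega>) = z"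
    by (simp only: trs_solver_def draw_def case_prod_beta result_bind ops_simps timed.sel v(1)[symmetric] l_def[symmetric]
        p_def[symmetric] rs0_def[symmetric] M_def[symmetric] s_def[symmetric] rs_def[symmetric] R_def[symmetric]
        m_def[symmetric] lo_def[symmetric] x_def[symmetric] \<gamma>_def[symmetric] L_def[symmetric] a_def[symmetric]
        y_def[symmetric] z_def[symmetric])
  have \<tau>: "0 < \<tau>" using n \<delta> by (simp add: \<tau>_def)
  have \<tau>l: "1 \<le> \<tau> * exp (5 * l)" unfolding \<tau>_def l_def by (rule start_weight_exp[OF n \<delta>])
  have l: "1 \<le> l" unfolding l_def by (rule log_ratio_ge_1[OF n \<delta>])
  \<comment> \<open>All thresholds on the iteration counts are brought into this form: 5 l in the
    exponent cancels the weight, each further unit gains a factor 2.\<close>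
  have \<tau>exp: "2 ^ k \<le> \<tau> * exp t" if "5 * l + real k \<le> t" for k t
  proof -
    have "1 * 2 ^ k \<le> \<tau> * exp (5 * l) * exp (real k)" using \<tau>l by (intro mult_mono exp_int_ge_two_power) auto
    also have "\<dots> = \<tau> * exp (5 * l + real k)" by (simp add: exp_add)
    also have "\<dots> \<le> \<tau> * exp t" using that \<tau> by (intro mult_left_mono) auto
    finally show ?thesis by simp
  qed
  have \<rho>: "0 < ?\<rho>" "- ?\<rho> \<le> lambda_min Q"
    using spectral_norm_ge[OF Q u n i1(1)] i1(2) neg by auto
  have dv: "dim_vec v = n" using normalize_cases(1)[of "Matrix.vec n \<omega>"] v(1) by simp
  \<comment> \<open>Some Ritz value reaches half of the spectral norm, and Gershgorin puts it below
    \<open>tri_bound\<close>; the factor 2 in \<open>M\<close> makes up for the half.\<close>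
  have M: "?\<rho> \<le> M"
  proof -
    let ?K = p
    have K: "0 < ?K" "100 * l \<le> real ?K" using l unfolding p_def by linarith+
    have K1: "real (?K - 1) = real ?K - 1" using K(1) by (simp add: of_nat_diff)
    obtain r where k: "krylov n (length rs0) Q ((!) (basis rs0)) (\<lambda>i. fst (tridiag rs0 ! i)) (\<lambda>i. snd (tridiag rs0 ! i)) r"
      and len: "length rs0 = ?K \<or> r = 0\<^sub>v n" and b0: "basis rs0 ! 0 = v"
      using lanczos_krylov[OF Q dv v(2) K(1) n rs0_def] by blast
    interpret krylov n "length rs0" Q "(!) (basis rs0)" "\<lambda>i. fst (tridiag rs0 ! i)" "\<lambda>i. snd (tridiag rs0 ! i)" r by (rule k)
    obtain e \<theta> where e: "eigenbasis (length rs0) T e \<theta>" using eigenbasis_exists[OF T_carrier T_sym] by blast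
    have "\<exists>i<length rs0. ?\<rho> / 2 \<le> \<bar>\<theta> i\<bar>"
    proof (rule ritz_abs_attained[OF u e _ i2 _ \<rho>(1) _ \<tau>])
      show "?K - 1 < length rs0 \<or> r = 0\<^sub>v n" using len K(1) by auto
      show "\<tau> \<le> (u i2 \<bullet> basis rs0 ! 0)\<^sup>2" using w2 by (simp add: \<tau>_def b0)
      have "5 * l + real 3 \<le> 2 * real (?K - 1)" using K(2) l unfolding K1 of_nat_numeral by argo
      hence "2 ^ 3 \<le> \<tau> * exp (2 * real (?K - 1))" by (rule \<tau>exp)
      thus "4 < \<tau> * exp (2 * real (?K - 1))" by simp
    qed
    then obtain i where i: "i < length rs0" "?\<rho> / 2 \<le> \<bar>\<theta> i\<bar>" by blast
    have "\<bar>\<theta> i\<bar> \<le> result (tri_bound 0 (tridiag rs0))"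
    proof (rule gershgorin_tri_mat[OF e[unfolded T_eq] i(1)])
      fix l assume "l < length rs0"
      thus "(if l = 0 then 0 else \<bar>snd (tridiag rs0 ! (l - 1))\<bar>) + \<bar>fst (tridiag rs0 ! l)\<bar> + \<bar>snd (tridiag rs0 ! l)\<bar>
        \<le> result (tri_bound 0 (tridiag rs0))" using tri_bound_row[of l "tridiag rs0" 0] by simp
    qed
    thus ?thesis using i(2) by (simp add: M_def)
  qed
  have Mpos: "0 < M" using M \<rho> by linarith
  have s: "1 \<le> s" using Mpos \<epsilon> by (simp add: s_def)
  have s2: "M / \<epsilon> + 1 \<le> s\<^sup>2" using Mpos \<epsilon> by (simp add: s_def power2_sum)
  have sl: "s \<le> s * l" "l \<le> s * l" "1 \<le> s * l" using s l mult_mono[of 1 s 1 l] by auto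
  \<comment> \<open>The largest rate with ?\<rho> t^2 \<le> \<epsilon>/64, capped at 1 for the
    estimate of cosh.\<close>
  define t where "t = min 1 (sqrt (\<epsilon> / (64 * ?\<rho>)))"
  have t: "0 < t" "t \<le> 1" "?\<rho> * t\<^sup>2 \<le> \<epsilon> / 64"
  proof -
    show "0 < t" "t \<le> 1" using \<rho> \<epsilon> by (auto simp: t_def)
    have "t\<^sup>2 \<le> (sqrt (\<epsilon> / (64 * ?\<rho>)))\<^sup>2" using \<open>0 < t\<close> by (intro power_mono) (auto simp: t_def)
    hence "t\<^sup>2 \<le> \<epsilon> / (64 * ?\<rho>)" using \<rho> \<epsilon> by simp
    thus "?\<rho> * t\<^sup>2 \<le> \<epsilon> / 64" using \<rho> by (simp add: field_simps)
  qed
  \<comment> \<open>Rate times step count: sqrt (\<epsilon> / (64 ?\<rho>)) times sqrt (?\<rho> /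
    \<epsilon>) is 1/8, and \<open>s\<close> dominates the second factor. So s l steps give an
    exponent proportional to \<open>l\<close>.\<close>
  have ts: "1 / 8 \<le> t * s"
  proof (cases "1 \<le> sqrt (\<epsilon> / (64 * ?\<rho>))")
    case True
    thus ?thesis using s by (simp add: t_def)
  next
    case False
    have "1 / 8 = sqrt (\<epsilon> / (64 * ?\<rho>)) * sqrt (?\<rho> / \<epsilon>)"
      using \<rho> \<epsilon> by (simp add: real_sqrt_mult[symmetric] real_sqrt_divide[symmetric]) (simp add: real_sqrt_divide)
    also have "\<dots> \<le> sqrt (\<epsilon> / (64 * ?\<rho>)) * s"
    proof (rule mult_left_mono)
      have "sqrt (?\<rho> / \<epsilon>) \<le> sqrt (M / \<epsilon>)" using M \<epsilon> by (intro real_sqrt_le_mono divide_right_mono) auto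
      thus "sqrt (?\<rho> / \<epsilon>) \<le> s" unfolding s_def by linarith
    qed (use \<rho> \<epsilon> in auto)
    finally show ?thesis using False by (simp add: t_def)
  qed
  have p: "0 < p" "2 \<le> \<tau> * 2 ^ (2 * p - 1)"
  proof -
    have pl: "100 * l \<le> real p" unfolding p_def by linarith
    thus "0 < p" using l by (cases p) auto
    have "2 ^ 1 \<le> \<tau> * exp (real (2 * p - 1) / 2)" using pl l \<open>0 < p\<close> by (intro \<tau>exp) (simp add: of_nat_diff)
    also have "\<dots> \<le> \<tau> * 2 ^ (2 * p - 1)" using \<tau> by (intro mult_left_mono two_power_ge_exp) auto
    finally show "2 \<le> \<tau> * 2 ^ (2 * p - 1)" by simp
  qed
  have acc: "dim_vec x = n \<and> x \<bullet> x = 1 \<and> lo < lambda_min Q + \<epsilon> / 64 \<and> lambda_min Q - \<epsilon> / 64 \<le> lo \<and>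
      x \<bullet> (Q *\<^sub>v x) \<le> lo + 4 * (\<epsilon> / 64)"
  proof -
    define K where "K = nat \<lceil>100 * s * l\<rceil>"
    let ?K = K
    have K: "0 < ?K" "100 * s * l \<le> real ?K" using sl unfolding K_def by linarith+
    have K1: "real (?K - 1) = real ?K - 1" using K(1) by (simp add: of_nat_diff)
    obtain r where k: "krylov n (length rs) Q ((!) (basis rs)) (\<lambda>i. fst (tridiag rs ! i)) (\<lambda>i. snd (tridiag rs ! i)) r"
      and len: "length rs = ?K \<or> r = 0\<^sub>v n" and b0: "basis rs ! 0 = v"
      using lanczos_krylov[OF Q dv v(2) K(1) n rs_def[folded K_def]] by blast
    interpret krylov n "length rs" Q "(!) (basis rs)" "\<lambda>i. fst (tridiag rs ! i)" "\<lambda>i. snd (tridiag rs ! i)" r by (rule k)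
    have weight: "\<tau> / 2 \<le> (\<Sum>l | l < length rs \<and> \<theta> l < lambda_min Q + \<epsilon> / 64. (e l $ 0)\<^sup>2)"
      if e: "eigenbasis (length rs) T e \<theta>" for e \<theta>
    proof (rule ritz_low_weight[OF u e _ i1 _ \<rho>(1) _ \<tau> t])
      show "?K - 1 < length rs \<or> r = 0\<^sub>v n" using len K(1) by auto
      show "\<tau> \<le> (u i1 \<bullet> basis rs ! 0)\<^sup>2" using w1 by (simp add: \<tau>_def b0)
      \<comment> \<open>A run of \<open>K\<close> steps allows degree at most \<open>K - 1\<close>;
        the lost unit is absorbed by 99 in place of 100, since s l \<ge> 1.\<close>
      have "99 * s * l \<le> real (?K - 1)" using K(2) sl unfolding K1 by linarith
      hence "99 * s * l * t \<le> real (?K - 1) * t" using t by (intro mult_right_mono) auto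
      moreover have "1 / 8 * l \<le> t * s * l" using ts l by (intro mult_right_mono) auto
      moreover have "99 * s * l * t = 99 * (t * s * l)" by (simp add: mult_ac)
      ultimately have "8 * l \<le> 2 * (real (?K - 1) * t)" using l by linarith
      hence "5 * l + real 3 \<le> 2 * real (?K - 1) * t" using l unfolding of_nat_numeral mult.assoc by linarith
      hence "2 ^ 3 \<le> \<tau> * exp (2 * real (?K - 1) * t)" by (rule \<tau>exp)
      thus "8 \<le> \<tau> * exp (2 * real (?K - 1) * t)" by simp
    qed
    have R0: "0 \<le> R" unfolding R_def rs_def[folded K_def] using tri_bound_lanczos[OF Q n K(1) dv] v(2) by simp
    show ?thesis
      by (rule ritz_pair_accuracy[OF k u \<epsilon> _ \<tau> weight R_def _ p])
        (use bisection_steps[OF R0 \<epsilon>] \<epsilon> in \<open>auto simp: lo_def x_def m_def\<close>)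
  qed
  have \<gamma>: "\<gamma> \<le> lambda_min Q" "\<bar>\<gamma>\<bar> \<le> M + \<epsilon>" using acc \<rho> M \<epsilon> neg by (auto simp: \<gamma>_def abs_le_iff)
  interpret trs_convex n Q g \<gamma> L
  proof
    fix y :: "real vec" assume y: "dim_vec y = n"
    have "\<gamma> * (y \<bullet> y) \<le> lambda_min Q * (y \<bullet> y)" using \<gamma>(1) by (intro mult_right_mono) auto
    thus "0 \<le> y \<bullet> (Q *\<^sub>v y) - \<gamma> * (y \<bullet> y)" using rayleigh_lower[OF Q u n y] by linarith
    have "- \<gamma> * (y \<bullet> y) \<le> \<bar>\<gamma>\<bar> * (y \<bullet> y)" by (intro mult_right_mono) auto
    moreover have "?\<rho> * (y \<bullet> y) \<le> M * (y \<bullet> y)" using M by (intro mult_right_mono) auto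
    ultimately show "y \<bullet> (Q *\<^sub>v y) - \<gamma> * (y \<bullet> y) \<le> L / 2 * (y \<bullet> y)"
      using rayleigh_abs[OF Q u n y] by (simp add: L_def distrib_right abs_le_iff)
  qed (use Q g Mpos in \<open>auto simp: L_def\<close>)
  have a: "100 * s \<le> real a" "0 < a" using s unfolding a_def by linarith+
  have gap: "2 * L / (real a)\<^sup>2 \<le> \<epsilon> / 64"
  proof -
    \<comment> \<open>With s^2 \<ge> M / \<epsilon> + 1, the needed inequality is 8 \<le> 100^2 /
      64.\<close>
    have "2 * L \<le> 8 * (M + \<epsilon>)" using \<gamma>(2) \<epsilon> Mpos by (simp add: L_def)
    also have "\<dots> = 8 * \<epsilon> * (M / \<epsilon> + 1)" using \<epsilon> by (simp add: field_simps)
    also have "\<dots> \<le> 8 * \<epsilon> * s\<^sup>2" using s2 \<epsilon> by (intro mult_left_mono) auto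
    also have "\<dots> \<le> \<epsilon> / 64 * (100 * s)\<^sup>2" using \<epsilon> by (simp add: power_mult_distrib)
    also have "\<dots> \<le> \<epsilon> / 64 * (real a)\<^sup>2" using a s \<epsilon> by (intro mult_left_mono power_mono) auto
    finally show ?thesis using a by (simp add: pos_divide_le_eq)
  qed
  have y: "dim_vec y = n" "y \<bullet> y \<le> 1"
    using agd_convergence[of "0\<^sub>v n" a] a unfolding y_def by auto
  have x: "dim_vec x = n" "x \<bullet> x = 1" using acc by auto
  note ts = to_sphere_correct[OF x y, folded z_def]
  show ?thesis unfolding res
  proof (rule sphere_solution[OF ts(1,2)])
    show "\<gamma> \<le> 0" using \<gamma>(1) neg by linarith
    fix w :: "real vec" assume w: "dim_vec w = n" "w \<bullet> w \<le> 1"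
    have "F y - F w \<le> \<epsilon> / 64" using agd_convergence(3)[OF w a(2), folded y_def] gap by linarith
    moreover have "x \<bullet> (Q *\<^sub>v x) - \<gamma> \<le> 5 * \<epsilon> / 64" using acc by (simp add: \<gamma>_def)
    ultimately show "F z - F w \<le> \<epsilon>" using ts(3) \<epsilon> by argo
  qed
qed

section \<open>Operation counts\<close>

lemma length_lanczos_le: "length (result (lanczos Q k p \<beta> v)) \<le> k"
proof (induction k arbitrary: p \<beta> v)
  case (Suc k)
  show ?case using Suc by (auto simp: ret_def Let_def)
qed (simp add: ret_def)

lemma lanczos_dims:
  assumes "dim_row Q = n" "dim_vec v = n" "r \<in> set (result (lanczos Q k p \<beta> v))"
  shows "dim_vec (snd (snd r)) = n"
  using assms(2,3)
proof (induction k arbitrary: p \<beta> v)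
  case (Suc k)
  define w where "w = (- \<beta>) \<cdot>\<^sub>v p + Q *\<^sub>v v"
  define q where "q = (- (v \<bullet> w)) \<cdot>\<^sub>v v + w"
  have eq: "result (lanczos Q (Suc k) p \<beta> v) = (if vnorm q = 0 then [(v \<bullet> w, vnorm q, v)]
      else (v \<bullet> w, vnorm q, v) # result (lanczos Q k v (vnorm q) ((1 / vnorm q) \<cdot>\<^sub>v q)))"
    by (simp add: t_matvec_def t_axpy_def t_dot_def t_norm_def t_scale_def w_def q_def)
  have "dim_vec ((1 / vnorm q) \<cdot>\<^sub>v q) = n" by (simp add: q_def w_def assms(1))
  note IH = Suc.IH[OF this]
  show ?case using Suc.prems(2) Suc.prems(1) IH unfolding eq by (auto split: if_splits)
qed (simp add: ret_def)

text \<open>A full step costs 2 nnz + 9 n + 5 operations; \<open>X\<close> bounds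
  \<open>nnz Q\<close>, \<open>n\<close> and 1 at once, and 16 = 2 + 9 + 5.\<close>

lemma cost_lanczos:
  assumes Q: "dim_row Q = n" and X: "n \<le> X" "nnz Q \<le> X" "1 \<le> X" and v: "dim_vec v = n"
  shows "cost (lanczos Q k p \<beta> v) \<le> 16 * X * k"
  using v
proof (induction k arbitrary: p \<beta> v)
  case (Suc k)
  let ?w' = "(- \<beta>) \<cdot>\<^sub>v p + Q *\<^sub>v v"
  let ?r = "(- (v \<bullet> ?w')) \<cdot>\<^sub>v v + ?w'"
  have "cost (lanczos Q k v (vnorm ?r) ((1 / vnorm ?r) \<cdot>\<^sub>v ?r)) \<le> 16 * X * k" by (rule Suc.IH) (simp add: Q)
  thus ?case using X Suc.prems
    by (simp add: t_matvec_def t_axpy_def t_dot_def t_norm_def t_scale_def Q)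
qed simp

lemma cost_tri_bound: "cost (tri_bound q ts) \<le> 6 * length ts"
  by (induction q ts rule: tri_bound.induct) auto

lemma cost_pivots_pos: "cost (pivots_pos \<mu> c ts) \<le> 5 * length ts"
proof (induction ts arbitrary: c)
  case (Cons t ts)
  show ?case using Cons[of "snd t * snd t / (fst t - \<mu> - c)"] by (cases t) auto
qed simp

lemma cost_bisect: "cost (bisect ts m lo hi) \<le> m * (2 + 5 * length ts)"
proof (induction m arbitrary: lo hi)
  case (Suc m)
  show ?case using Suc[of "(lo + hi) / 2" hi] Suc[of lo "(lo + hi) / 2"] cost_pivots_pos[of "(lo + hi) / 2" 0 ts] by simp
qed simp

lemma cost_tri_solve: "cost (tri_solve \<mu> c e ts ws) \<le> 10 * length ts"
proof (induction ts arbitrary: c e ws)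
  case (Cons t ts)
  obtain \<alpha> \<beta> where t: "t = (\<alpha>, \<beta>)" by (cases t)
  show ?case
  proof (cases ws)
    case (Cons w vs)
    thus ?thesis using Cons.IH[of "\<beta> * \<beta> / (\<alpha> - \<mu> - c)" "\<beta> * (w - e) / (\<alpha> - \<mu> - c)" vs]
      by (auto simp: t split: list.split)
  qed (simp add: ret_def)
qed (simp add: ret_def)

lemma cost_inverse_iteration: "cost (inverse_iteration \<mu> ts p z) \<le> p * (10 * length ts)"
proof (induction p arbitrary: z)
  case (Suc p)
  show ?case using Suc[of "result (tri_solve \<mu> 0 0 ts z)"] cost_tri_solve[of \<mu> 0 0 ts z] by simp
qed simp

lemma lin_comb_cost_dim:
  assumes "\<And>v. v \<in> set vs \<Longrightarrow> dim_vec v = n"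
  shows "cost (lin_comb n cs vs) \<le> 2 * n * length vs \<and> dim_vec (result (lin_comb n cs vs)) = n"
  using assms
proof (induction n cs vs rule: lin_comb.induct)
  case (1 n c cs v vs)
  thus ?case by (simp add: t_axpy_def)
qed auto

lemma cost_normalize: "cost (t_normalize v) = 3 * dim_vec v + 2"
  by (simp add: t_normalize_def t_norm_def t_scale_def)

text \<open>Work on the tridiagonal matrix is linear in its size, hence at most a multiple of
  \<open>X\<close> per step. Forming the vector costs 2 n for each of at most \<open>k\<close> basis
  vectors, which is why both bounds on the length are needed.\<close>

lemma ritz_pair_cost:
  assumes rs: "\<And>r. r \<in> set rs \<Longrightarrow> dim_vec (snd (snd r)) = n" and X: "n \<le> X" "1 \<le> X" and len: "length rs \<le> n" "length rs \<le> k"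
  shows "cost (ritz_pair n \<epsilon> R m p rs) \<le> X * (7 + 7 * m + 10 * p + 2 * k) \<and> dim_vec (snd (result (ritz_pair n \<epsilon> R m p rs))) = n"
proof -
  let ?j = "length rs"
  define lo where "lo = result (bisect (tridiag rs) m (- R - \<epsilon>) R)"
  define z where "z = result (inverse_iteration lo (tridiag rs) p (1 # replicate (?j - 1) 0))"
  define w where "w = result (lin_comb n z (basis rs))"
  have "dim_vec v = n" if "v \<in> set (basis rs)" for v using that rs by (auto simp: basis_def)
  hence lc: "cost (lin_comb n z (basis rs)) \<le> 2 * n * ?j" "dim_vec w = n"
    using lin_comb_cost_dim[of "basis rs" n z] by (simp_all add: w_def)
  have "cost (ritz_pair n \<epsilon> R m p rs) = 2 + (cost (bisect (tridiag rs) m (- R - \<epsilon>) R) +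
      (cost (inverse_iteration lo (tridiag rs) p (1 # replicate (?j - 1) 0)) +
        (cost (lin_comb n z (basis rs)) + (cost (t_normalize w) + 0))))"
    by (simp only: ritz_pair_def cost_bind result_bind ops_simps ret_simps lo_def[symmetric] z_def[symmetric] w_def[symmetric])
  also have "\<dots> \<le> 2 + (m * (2 + 5 * ?j) + (p * (10 * ?j) + (2 * n * ?j + ((3 * n + 2) + 0))))"
    using cost_bisect[of "tridiag rs" m "- R - \<epsilon>" R] cost_inverse_iteration[of lo "tridiag rs" p] lc
    by (intro add_mono) (auto simp: cost_normalize)
  also have "\<dots> \<le> 2 * X + (m * (7 * X) + (p * (10 * X) + (2 * X * k + (5 * X + 0))))"
    using X len by (intro add_mono mult_mono) auto
  finally have "cost (ritz_pair n \<epsilon> R m p rs) \<le> X * (7 + 7 * m + 10 * p + 2 * k)" by (simp add: algebra_simps)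
  moreover have "snd (result (ritz_pair n \<epsilon> R m p rs)) = result (t_normalize w)"
    by (simp only: ritz_pair_def cost_bind result_bind ops_simps ret_simps lo_def[symmetric] z_def[symmetric] w_def[symmetric] snd_conv)
  ultimately show ?thesis using normalize_cases(1)[of w] lc(2) by simp
qed

lemma cost_proj_ball: "cost (proj_ball v) \<le> 3 * dim_vec v + 3"
  by (simp add: proj_ball_def t_norm_def t_scale_def)

text \<open>A step costs at most 2 nnz + 13 n + 14, of which 3 n + 3 is the projection.\<close>

lemma cost_agd:
  assumes Q: "dim_row Q = n" and g: "dim_vec g = n" and X: "n \<le> X" "nnz Q \<le> X" "1 \<le> X"
    and "dim_vec x = n" "dim_vec y = n"
  shows "cost (agd Q g \<gamma> L a x y t) \<le> 29 * X * a \<and> dim_vec (result (agd Q g \<gamma> L a x y t)) = n"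
  using assms(6,7)
proof (induction a arbitrary: x y t)
  case (Suc a)
  define u where "u = (- (2 / L)) \<cdot>\<^sub>v (1 \<cdot>\<^sub>v g + ((- \<gamma>) \<cdot>\<^sub>v y + Q *\<^sub>v y)) + y"
  define x' where "x' = result (proj_ball u)"
  define t' where "t' = (1 + sqrt (1 + 4 * t * t)) / 2"
  define y' where "y' = ((t - 1) / t') \<cdot>\<^sub>v ((- 1) \<cdot>\<^sub>v x + x') + x'"
  have d: "dim_vec u = n" "dim_vec x' = n" "dim_vec y' = n" using Suc.prems by (simp_all add: u_def x'_def y'_def)
  have "cost (agd Q g \<gamma> L (Suc a) x y t) = 2 * nnz Q + 10 * n + 11 + cost (proj_ball u) + cost (agd Q g \<gamma> L a x' y' t')"
    by (simp only: agd.simps cost_bind result_bind ops_simps t_matvec_def t_axpy_def timed.sel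
        u_def[symmetric] x'_def[symmetric] t'_def[symmetric] y'_def[symmetric]) (use Suc.prems Q d in simp)
  also have "\<dots> \<le> 29 * X * Suc a" using Suc.IH[OF d(2,3), of t'] cost_proj_ball[of u] X d by simp
  finally have "cost (agd Q g \<gamma> L (Suc a) x y t) \<le> 29 * X * Suc a" .
  moreover have "result (agd Q g \<gamma> L (Suc a) x y t) = result (agd Q g \<gamma> L a x' y' t')"
    by (simp add: t_matvec_def t_axpy_def u_def x'_def t'_def y'_def)
  ultimately show ?case using Suc.IH[OF d(2,3), of t'] by simp
qed simp

lemma cost_to_sphere:
  assumes "dim_row Q = n" "n \<le> X" "nnz Q \<le> X" "1 \<le> X" "dim_vec x = n" "dim_vec y = n"
  shows "cost (to_sphere Q g \<gamma> x y) \<le> 23 * X"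
  using assms by (simp add: to_sphere_def t_dot_def t_matvec_def t_axpy_def)

text \<open>Lets the square root of the norm over \<epsilon> absorb the logarithmic number of
  bisection steps.\<close>

lemma ln_one_plus_le_sqrt:
  assumes "0 \<le> (x :: real)"
  shows "ln (x + 1) \<le> 2 * sqrt x"
proof -
  have "x + 1 \<le> (1 + sqrt x)\<^sup>2" using assms by (simp add: power2_sum)
  hence "ln (x + 1) \<le> ln ((1 + sqrt x)\<^sup>2)" using assms by (intro ln_mono) auto
  also have "\<dots> = 2 * ln (1 + sqrt x)" using assms by (simp add: ln_realpow add_pos_nonneg)
  also have "\<dots> \<le> 2 * sqrt x" using assms ln_add_one_self_le_self[of "sqrt x"] by simp
  finally show ?thesis .
qed

text \<open>Only upper bounds on \<open>M\<close> and \<open>R\<close> enter, and these hold for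
  every draw, so no probability is involved. Rounding up each iteration count is paid for by S \<ge>
  1 and l \<ge> 1.\<close>

lemma trs_solver_cost:
  assumes Q: "Q \<in> carrier_mat n n" "transpose_mat Q = Q" and n: "0 < n"
    and g: "dim_vec g = n" and \<epsilon>: "0 < \<epsilon>" and \<delta>: "0 < \<delta>" "\<delta> < 1"
  defines "S \<equiv> max 1 (sqrt (spectral_norm Q) / sqrt \<epsilon>)"
  shows "real (cost (trs_solver 100 n Q g \<epsilon> \<delta> \<omega>)) \<le> 30000 * (real (max (nnz Q) n) * (S * (ln (real n / \<delta>) + 1)))"
proof -
  let ?\<rho> = "spectral_norm Q"
  define X where "X = max (nnz Q) n"
  define v where "v = result (t_normalize (Matrix.vec n \<omega>))"
  define l where "l = ln (real n / \<delta>) + 1"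
  define p where "p = nat \<lceil>100 * l\<rceil>"
  define rs0 where "rs0 = result (lanczos Q (min n p) (0\<^sub>v n) 0 v)"
  define M where "M = 2 * result (tri_bound 0 (tridiag rs0))"
  define s where "s = sqrt (M / \<epsilon>) + 1"
  define K where "K = nat \<lceil>100 * s * l\<rceil>"
  define rs where "rs = result (lanczos Q (min n K) (0\<^sub>v n) 0 v)"
  define R where "R = result (tri_bound 0 (tridiag rs))"
  define m where "m = nat \<lceil>100 * (ln (R / \<epsilon> + 1) + 1)\<rceil>"
  define lo where "lo = fst (result (ritz_pair n \<epsilon> R m p rs))"
  define x where "x = snd (result (ritz_pair n \<epsilon> R m p rs))"
  define \<gamma> where "\<gamma> = lo - \<epsilon> / 64"
  define L where "L = 2 * (M + \<bar>\<gamma>\<bar>)"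
  define a where "a = nat \<lceil>100 * s\<rceil>"
  define y where "y = result (agd Q g \<gamma> L a (0\<^sub>v n) (0\<^sub>v n) 1)"
  have cost: "cost (trs_solver 100 n Q g \<epsilon> \<delta> \<omega>) = n + (cost (t_normalize (Matrix.vec n \<omega>)) + (3 + (3 +
      (cost (lanczos Q (min n p) (0\<^sub>v n) 0 v) + (cost (tri_bound 0 (tridiag rs0)) + (1 + (3 + (4 +
      (cost (lanczos Q (min n K) (0\<^sub>v n) 0 v) + (cost (tri_bound 0 (tridiag rs)) + (6 + (2 +
      (cost (ritz_pair n \<epsilon> R m p rs) + (2 + (3 + (2 + (cost (agd Q g \<gamma> L a (0\<^sub>v n) (0\<^sub>v n) 1) + cost (to_sphere Q g \<gamma> x y))))))))))))))))))"
    by (simp only: trs_solver_def draw_def case_prod_beta result_bind cost_bind ops_simps timed.sel v_def[symmetric] l_def[symmetric]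
        p_def[symmetric] rs0_def[symmetric] M_def[symmetric] s_def[symmetric] K_def[symmetric] rs_def[symmetric] R_def[symmetric]
        m_def[symmetric] lo_def[symmetric] x_def[symmetric] \<gamma>_def[symmetric] L_def[symmetric] a_def[symmetric]
        y_def[symmetric])
  have dQ: "dim_row Q = n" using Q by auto
  have X: "n \<le> X" "nnz Q \<le> X" "1 \<le> X" using n by (auto simp: X_def)
  have v: "dim_vec v = n" "v \<bullet> v = 1 \<or> v = 0\<^sub>v n" using normalize_cases[of "Matrix.vec n \<omega>"] by (simp_all add: v_def)
  have len: "length rs0 \<le> p" "length rs \<le> n" "length rs \<le> K"
    using length_lanczos_le[of Q "min n p" "0\<^sub>v n" 0 v] length_lanczos_le[of Q "min n K" "0\<^sub>v n" 0 v]
    by (simp_all add: rs0_def rs_def)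
  have rp: "cost (ritz_pair n \<epsilon> R m p rs) \<le> X * (7 + 7 * m + 10 * p + 2 * K) \<and> dim_vec x = n"
    unfolding x_def by (rule ritz_pair_cost[OF _ X(1,3) len(2,3)]) (use lanczos_dims[OF dQ v(1)] in \<open>auto simp: rs_def\<close>)
  have ag: "cost (agd Q g \<gamma> L a (0\<^sub>v n) (0\<^sub>v n) 1) \<le> 29 * X * a \<and> dim_vec y = n"
    unfolding y_def by (rule cost_agd[OF dQ g X]) auto
  have sp: "cost (to_sphere Q g \<gamma> x y) \<le> 23 * X" using rp ag by (intro cost_to_sphere[OF dQ X]) auto
  have la: "cost (lanczos Q (min n p) (0\<^sub>v n) 0 v) \<le> 16 * X * p" "cost (lanczos Q (min n K) (0\<^sub>v n) 0 v) \<le> 16 * X * K"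
    using cost_lanczos[OF dQ X v(1), of "min n p" "0\<^sub>v n" 0] cost_lanczos[OF dQ X v(1), of "min n K" "0\<^sub>v n" 0]
    by (auto intro: order.trans[OF _ mult_left_mono])
  have tb: "cost (tri_bound 0 (tridiag rs0)) \<le> 6 * X * p" "cost (tri_bound 0 (tridiag rs)) \<le> 6 * X * K"
  proof -
    have "6 * p \<le> 6 * X * p" "6 * K \<le> 6 * X * K" using X(3) by auto
    thus "cost (tri_bound 0 (tridiag rs0)) \<le> 6 * X * p" "cost (tri_bound 0 (tridiag rs)) \<le> 6 * X * K"
      using cost_tri_bound[of 0 "tridiag rs0"] cost_tri_bound[of 0 "tridiag rs"] len
      unfolding length_tridiag by linarith+
  qed
  have "cost (trs_solver 100 n Q g \<epsilon> \<delta> \<omega>) \<le>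
      31 * X + 4 * X + 16 * X * p + 6 * X * p + 16 * X * K + 6 * X * K + X * (7 + 7 * m + 10 * p + 2 * K) + 29 * X * a + 23 * X"
    unfolding cost cost_normalize dim_vec using la tb rp ag sp X(1,3) by linarith
  also have "\<dots> = X * (65 + 32 * p + 24 * K + 7 * m + 29 * a)" by (simp add: algebra_simps)
  finally have "real (cost (trs_solver 100 n Q g \<epsilon> \<delta> \<omega>)) \<le> real (X * (65 + 32 * p + 24 * K + 7 * m + 29 * a))"
    by (simp only: of_nat_le_iff)
  hence main: "real (cost (trs_solver 100 n Q g \<epsilon> \<delta> \<omega>)) \<le> real X * (65 + 32 * real p + 24 * real K + 7 * real m + 29 * real a)"
    by simp
  have l: "1 \<le> l" unfolding l_def by (rule log_ratio_ge_1[OF n \<delta>])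
  have S: "1 \<le> S" by (simp add: S_def)
  have Sl: "S \<le> S * l" "l \<le> S * l" "1 \<le> S * l" using S l mult_mono[of 1 S 1 l] by auto
  have sq: "sqrt (?\<rho> / \<epsilon>) \<le> S" by (simp add: S_def real_sqrt_divide)
  have p: "0 < p" "real p \<le> 100 * l + 1" using l unfolding p_def by linarith+
  have R0: "0 \<le> M" "M \<le> 6 * ?\<rho>"
    using tri_bound_lanczos[OF Q n p(1) v, folded rs0_def] unfolding M_def by auto
  have \<rho>: "0 \<le> ?\<rho>" using R0 by linarith
  \<comment> \<open>The factor 6 is rounded up to the square 9, as is 3 to 4 for \<open>R\<close>
    below, to keep the roots integral.\<close>
  have "sqrt (M / \<epsilon>) \<le> sqrt (3\<^sup>2 * (?\<rho> / \<epsilon>))"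
  proof (rule real_sqrt_le_mono)
    have "M \<le> 9 * ?\<rho>" using R0 \<rho> by linarith
    thus "M / \<epsilon> \<le> 3\<^sup>2 * (?\<rho> / \<epsilon>)" using \<epsilon> by (simp add: field_simps)
  qed
  also have "\<dots> = 3 * sqrt (?\<rho> / \<epsilon>)" unfolding real_sqrt_mult by simp
  finally have s: "1 \<le> s" "s \<le> 4 * S" using sq S R0 \<epsilon> unfolding s_def by auto
  have K: "0 < K" "real K \<le> 401 * (S * l)"
  proof -
    have "1 * 1 \<le> s * l" using s l by (intro mult_mono) auto
    moreover have "s * l \<le> 4 * S * l" using s l by (intro mult_right_mono) auto
    ultimately show "0 < K" "real K \<le> 401 * (S * l)" using Sl unfolding K_def by linarith+
  qed
  have R: "0 \<le> R" "R \<le> 3 * ?\<rho>"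
    using tri_bound_lanczos[OF Q n K(1) v, folded rs_def] unfolding R_def by auto
  have "ln (R / \<epsilon> + 1) \<le> 2 * sqrt (R / \<epsilon>)" using R \<epsilon> by (intro ln_one_plus_le_sqrt) auto
  also have "sqrt (R / \<epsilon>) \<le> sqrt (2\<^sup>2 * (?\<rho> / \<epsilon>))"
  proof (rule real_sqrt_le_mono)
    have "R \<le> 4 * ?\<rho>" using R \<rho> by linarith
    thus "R / \<epsilon> \<le> 2\<^sup>2 * (?\<rho> / \<epsilon>)" using \<epsilon> by (simp add: field_simps)
  qed
  also have "\<dots> = 2 * sqrt (?\<rho> / \<epsilon>)" unfolding real_sqrt_mult by simp
  finally have "ln (R / \<epsilon> + 1) \<le> 4 * S" using sq by simp
  moreover have "0 \<le> ln (R / \<epsilon> + 1)" using R \<epsilon> by simp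
  ultimately have "0 \<le> 100 * (ln (R / \<epsilon> + 1) + 1)" "100 * (ln (R / \<epsilon> + 1) + 1) \<le> 400 * S + 100" by argo+
  hence m: "real m \<le> 501 * S" using S unfolding m_def by linarith
  have a: "real a \<le> 401 * S" using s S unfolding a_def by linarith
  have "65 + 32 * real p + 24 * real K + 7 * real m + 29 * real a \<le> 30000 * (S * l)"
    using p(2) K(2) m a Sl by linarith
  hence "real X * (65 + 32 * real p + 24 * real K + 7 * real m + 29 * real a) \<le> real X * (30000 * (S * l))"
    by (intro mult_left_mono) auto
  thus ?thesis using main unfolding X_def[symmetric] l_def[symmetric] by (simp add: mult_ac)
qed

text \<open>Vector operations cost \<open>n\<close> even if \<open>Q\<close> is very sparse, hence
  \<open>max N n\<close>; at least one iteration is made however large \<epsilon> is, hence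
  \<open>max 1 s\<close>. For n / \<delta> near 1 the logarithm is near 0 and cannot absorb the
  second summand, which explains the condition on the last bound. The time bounds are claimed for
  every draw, not only on \<open>E\<close>.\<close>

theorem theorem10:
  "\<exists>\<kappa> > 0. \<exists>C > 0. \<forall>(n::nat) (Q::real mat) (g::real vec) (\<epsilon>::real) (\<delta>::real).
     0 < n \<longrightarrow> Q \<in> carrier_mat n n \<longrightarrow> transpose_mat Q = Q \<longrightarrow> lambda_min Q < 0 \<longrightarrow>
     g \<in> carrier_vec n \<longrightarrow> 0 < \<epsilon> \<longrightarrow> 0 < \<delta> \<longrightarrow> \<delta> < 1 \<longrightarrow>
     (\<exists>E \<in> sets (gauss n). measure (gauss n) E \<ge> 1 - \<delta> \<and>
        (\<forall>\<omega> \<in> E. eps_solution n Q g \<epsilon> (result (trs_solver \<kappa> n Q g \<epsilon> \<delta> \<omega>)))) \<and>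
     (\<forall>\<omega> \<in> space (gauss n).
        let time = real (cost (trs_solver \<kappa> n Q g \<epsilon> \<delta> \<omega>));
            N = nnz Q;
            s = sqrt (spectral_norm Q) / sqrt \<epsilon>
        in time \<le> C * (real (max N n) * (max 1 s * ln (real n / \<delta>) + max 1 s)) \<and>
           (n \<le> N \<and> \<epsilon> \<le> spectral_norm Q \<longrightarrow>
              time \<le> C * (real N * (s * ln (real n / \<delta>) + s))) \<and>
           (n \<le> N \<and> \<epsilon> \<le> spectral_norm Q \<and> 2 \<le> real n / \<delta> \<longrightarrow>
              time \<le> C * (real N * s * ln (real n / \<delta>))))"
proof (rule exI[of _ 100], intro conjI, simp, rule exI[of _ 90000], intro conjI, simp, intro allI impI conjI)
  fix n :: nat and Q :: "real mat" and g :: "real vec" and \<epsilon> \<delta> :: real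
  assume n: "0 < n" and Q: "Q \<in> carrier_mat n n" "transpose_mat Q = Q" and neg: "lambda_min Q < 0"
    and g': "g \<in> carrier_vec n" and \<epsilon>: "0 < \<epsilon>" and \<delta>: "0 < \<delta>" "\<delta> < 1"
  have g: "dim_vec g = n" using g' by simp
  obtain u \<mu> where u: "eigenbasis n Q u \<mu>" using eigenbasis_exists[OF Q] by blast
  obtain i1 where i1: "i1 < n" "\<mu> i1 = lambda_min Q" using lambda_min_attained[OF Q u n] by blast
  obtain i2 where i2: "i2 < n" "\<bar>\<mu> i2\<bar> = spectral_norm Q" using spectral_norm_attained[OF Q u n] by blast
  have d: "dim_vec (u i) = n" "u i \<bullet> u i = 1" if "i < n" for i
    using u that by (auto simp: eigenbasis_def orthonormal_def)
  from gauss_start_event[OF d[OF i1(1)] d[OF i2(1)] n \<delta>] obtain E where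
    E: "E \<in> sets (gauss n)" "1 - \<delta> \<le> measure (gauss n) E"
    and good: "\<And>\<omega> v. \<omega> \<in> E \<Longrightarrow> v = result (t_normalize (Matrix.vec n \<omega>)) \<Longrightarrow>
      dim_vec v = n \<and> v \<bullet> v = 1 \<and> \<delta> ^ 3 / (64 * real n) \<le> (u i1 \<bullet> v)\<^sup>2 \<and> \<delta> ^ 3 / (64 * real n) \<le> (u i2 \<bullet> v)\<^sup>2"
    by blast
  have "eps_solution n Q g \<epsilon> (result (trs_solver 100 n Q g \<epsilon> \<delta> \<omega>))" if "\<omega> \<in> E" for \<omega>
    using good[OF that refl] by (intro trs_solver_correct[OF Q neg n g \<epsilon> \<delta> u i1 i2 refl]) auto
  thus "\<exists>E \<in> sets (gauss n). measure (gauss n) E \<ge> 1 - \<delta> \<and>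
        (\<forall>\<omega> \<in> E. eps_solution n Q g \<epsilon> (result (trs_solver 100 n Q g \<epsilon> \<delta> \<omega>)))"
    using E by blast
  show "\<forall>\<omega> \<in> space (gauss n).
        let time = real (cost (trs_solver 100 n Q g \<epsilon> \<delta> \<omega>));
            N = nnz Q;
            s = sqrt (spectral_norm Q) / sqrt \<epsilon>
        in time \<le> 90000 * (real (max N n) * (max 1 s * ln (real n / \<delta>) + max 1 s)) \<and>
           (n \<le> N \<and> \<epsilon> \<le> spectral_norm Q \<longrightarrow>
              time \<le> 90000 * (real N * (s * ln (real n / \<delta>) + s))) \<and>
           (n \<le> N \<and> \<epsilon> \<le> spectral_norm Q \<and> 2 \<le> real n / \<delta> \<longrightarrow>
              time \<le> 90000 * (real N * s * ln (real n / \<delta>)))"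
  proof
    fix \<omega> assume "\<omega> \<in> space (gauss n)"
    define time where "time = real (cost (trs_solver 100 n Q g \<epsilon> \<delta> \<omega>))"
    define s where "s = sqrt (spectral_norm Q) / sqrt \<epsilon>"
    define lg where "lg = ln (real n / \<delta>)"
    have lg: "0 \<le> lg" using log_ratio_ge_1[OF n \<delta>] by (simp add: lg_def)
    have main: "time \<le> 30000 * (real (max (nnz Q) n) * (max 1 s * (lg + 1)))"
      unfolding time_def s_def lg_def by (rule trs_solver_cost[OF Q n g \<epsilon> \<delta>])
    have "0 \<le> real (max (nnz Q) n) * (max 1 s * (lg + 1))" using lg by simp
    hence 1: "time \<le> 90000 * (real (max (nnz Q) n) * (max 1 s * (lg + 1)))" using main by argo
    have large: "real (max (nnz Q) n) = real (nnz Q) \<and> max 1 s = s" if "n \<le> nnz Q" "\<epsilon> \<le> spectral_norm Q"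
      using that \<epsilon> by (simp add: s_def)
    have 3: "time \<le> 90000 * (real (nnz Q) * s * lg)"
      if A: "n \<le> nnz Q" "\<epsilon> \<le> spectral_norm Q" and B: "2 \<le> real n / \<delta>"
    proof -
      \<comment> \<open>A logarithm of at least 1/2 gives lg + 1 \<le> 3 lg; this raises the
        constant from 30000 to 90000.\<close>
      have "1 / 2 \<le> ln (2 :: real)"
        using two_power_ge_exp[of 1] ln_le_cancel_iff[of "exp (1 / 2)" 2] by simp
      also have "\<dots> \<le> lg" unfolding lg_def using B by (intro ln_mono) auto
      finally have "lg + 1 \<le> 3 * lg" by simp
      moreover have "0 \<le> real (nnz Q) * s" using large[OF A] by (metis max.cobounded1 mult_nonneg_nonneg of_nat_0_le_iff order.trans zero_le_one)
      ultimately have "real (nnz Q) * s * (lg + 1) \<le> real (nnz Q) * s * (3 * lg)" by (intro mult_left_mono)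
      thus ?thesis using main large[OF A] by (simp add: mult.assoc)
    qed
    have 2: "time \<le> 90000 * (real (nnz Q) * (s * lg + s))" if "n \<le> nnz Q" "\<epsilon> \<le> spectral_norm Q"
      using 1 large[OF that] by (simp add: distrib_left)
    show "let time = real (cost (trs_solver 100 n Q g \<epsilon> \<delta> \<omega>));
            N = nnz Q;
            s = sqrt (spectral_norm Q) / sqrt \<epsilon>
        in time \<le> 90000 * (real (max N n) * (max 1 s * ln (real n / \<delta>) + max 1 s)) \<and>
           (n \<le> N \<and> \<epsilon> \<le> spectral_norm Q \<longrightarrow>
              time \<le> 90000 * (real N * (s * ln (real n / \<delta>) + s))) \<and>
           (n \<le> N \<and> \<epsilon> \<le> spectral_norm Q \<and> 2 \<le> real n / \<delta> \<longrightarrow>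
              time \<le> 90000 * (real N * s * ln (real n / \<delta>)))"
      unfolding Let_def time_def[symmetric] s_def[symmetric] lg_def[symmetric]
      using 1 2 3 by (simp add: distrib_left)
  qed
qed

end
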